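(* Assume the standing conditions ($\mathcal L$), ($E\mathcal S$), ($G|\Gamma$), ($\mathcal L_0$) of the context. Let $n$ be a large-sample parameter (e.g. $n=\sigma^{-2}$) and $\mathtt x=2\log n$. Let $\Omega(\mathtt x)$ be a random event with $P(\Omega(\mathtt x))\ge1-Ce^{-\mathtt x}$ on which $\sigma^{-2}\varepsilon^\top\mathbb H_G^{-1}\varepsilon\le z^2(B_{\mathcal S|G},\mathtt x)$, let $\mathtt r_G$ satisfy, for some $\rho\le1/2$, $3\delta_{3,G}(\mathtt r_G)/\mathtt r_G^2\le\rho$ and $(1-\rho)\mathtt r_G\ge z(B_{\mathcal S|G},\mathtt x)$, and let $\Upsilon_0\supseteq\{\upsilon:\|\mathcal D_G(\upsilon-\upsilon^*_G)\|\le\mathtt r_G\}$. Suppose that $\mathtt r_0$ satisfies $$\diamondsuit(\mathtt r_0):=4\delta_3^2(\mathtt r_0)+4\delta_4(\mathtt r_0)\le\tfrac12,\quad C_0:=1-3\mathtt r_0^{-2}\delta_3(\mathtt r_0)\ge\tfrac12,\quad C_0\mathtt r_0\ge2\sqrt{\mathtt p_G(\upsilon)}+\sqrt{\mathtt x}\ \ \forall\upsilon\in\Upsilon_0 .$$ Then on $\Omega(\mathtt x)$, with a fixed constant $C$, $$\sup_{B\in\mathcal B_s(\mathcal X^d)}\bigl|P(f_G-\tilde f_G\in B\mid Y)-P'(\tilde{\mathbb D}_G^{-1}\gamma\in B)\bigr|\le C\{\diamondsuit(\mathtt r_0)+1/n\},$$ $$\sup_{B\in\mathcal B(\mathcal X^d)}\bigl|P(f_G-\tilde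 f_G\in B\mid Y)-P'(\tilde{\mathbb D}_G^{-1}\gamma\in B)\bigr|\le C\{\delta_3(\mathtt r_0)+1/n\},$$ where $\mathcal B(\mathcal X^d)$ is the class of Borel sets in $\mathcal X^d$, $\mathcal B_s(\mathcal X^d)$ the class of centrally symmetric Borel sets, $\gamma$ is standard Gaussian in $\mathcal X^d$ and $P'$ is the conditional distribution given $\tilde{\mathbb D}_G$.
   Context: Model. $\mathcal X^d,\mathcal Y^d$ are finite-dimensional Euclidean spaces, $q=\dim\mathcal Y^d$, $\Upsilon^d=\mathcal X^d\times\mathcal Y^d$, with points $\upsilon=(f,g)$; $A:\mathcal X^d\to\mathcal Y^d$ is a known smooth, possibly nonlinear operator; $\sigma,\lambda>0$. One observes a random $Y\in\mathcal Y^d$ with $EY=g^*:=A(f^* )$ for an unknown $f^*$; $\varepsilon:=\sigma^{-1}(Y-EY)$. Given $f_0\in\mathcal X^d$, $g_0\in\mathcal Y^d$ and prior precision operators $G^2$ on $\mathcal X^d$, $\Gamma^2$ on $\mathcal Y^d$ (symmetric, positive), put $$\mathcal L(\upsilon)=-\tfrac1{2\sigma^2}\|Y-g\|^2-\tfrac\lambda2\|g-A(f)\|^2,\quad \mathcal L_G(\upsilon)=\mathcal L(\upsilon)-\tfrac12\|G(f-f_0)\|^2-\tfrac12\|\Gamma(g-g_0)\|^2 .$$ $\Upsilon^\circ\subseteq\Upsilon^d$ is a parameter set to which the prior is restricted and $\Upsilon_0\subseteq\Upsilon^\circ$ a local set. $\tilde\upsilon_G=(\tilde f_G,\tilde g_G)=\arg\max_{\Upsilon^\circ}\mathcal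 L_G$, $\upsilon^*_G=(f^*_G,g^*_G)=\arg\max_{\Upsilon^\circ}E\mathcal L_G$. Matrices. $\mathcal F_G(\upsilon)=-\nabla^2E\mathcal L_G(\upsilon)$, $\mathcal F(\upsilon)=-\nabla^2E\mathcal L(\upsilon)$, $\mathcal D_G(\upsilon)=\mathcal F_G(\upsilon)^{1/2}$, $\mathcal D(\upsilon)=\mathcal F(\upsilon)^{1/2}$; $F_G(\upsilon),F(\upsilon)$ are the $ff$-blocks of $\mathcal F_G(\upsilon),\mathcal F(\upsilon)$. $\mathbb F_G^{-1}(\upsilon)$ and $\mathbb H_G^{-1}(\upsilon)$ denote the $ff$- and $gg$-blocks of $\mathcal F_G^{-1}(\upsilon)$. Omitting the argument means evaluation at $\upsilon^*_G$. $\tilde{\mathbb D}_G=\mathbb F_G^{1/2}(\tilde\upsilon_G)$. Standing conditions. ($\mathcal L$): $\Upsilon^\circ$ is open and convex and $E\mathcal L_G$ is concave on it. ($E\mathcal S$): there are a positive symmetric $q\times q$ matrix $\mathcal S$ and constants $\mathtt g>0$, $\nu_0\ge1$ with $\mathrm{Var}(\varepsilon)\le\mathcal S^2$ and $\sup_{u\in\mathcal Y^d}\log E\exp\{t\langle u,\varepsilon\rangle/\|\mathcal Su\|\}\le\nu_0^2t^2/2$ for $|t|\le\mathtt g$ (with $\mathtt g=\infty$ where $z$ below is used). ($G|\Gamma$): $g_0=A(f_0)$ and for a constant $C_{G|\Gamma}$, $\|\Gamma\{A(f^* )-g_0\}\|^2\le C_{G|\Gamma}\|G(f^*-f_0)\|^2$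 and $\mathrm{tr}(\sigma^2\Gamma^2+I_q)^{-1}\le C_{G|\Gamma}\,\mathrm{tr}\{F_G^{-1}(\upsilon_G^* )F(\upsilon_G^* )\}$. ($\mathcal L_0$): for the local set $\Upsilon_0$ and a set $\mathcal U^\circ\subseteq\Upsilon^d$, the directional derivatives $\partial_\alpha^mA(f)=\frac{d^m}{dt^m}A(f+t\alpha)|_{t=0}$, $m=3,4$, exist and are bounded uniformly over $(f,g)\in\Upsilon_0$, $(\alpha,\beta)\in\mathcal U^\circ$. Quantities. $z(B,\mathtt x)=\sqrt{\mathrm{tr}B}+\sqrt{2\lambda_{\max}(B)\mathtt x}$; $B_{\mathcal S|G}=\sigma^{-2}\mathcal S\,\mathbb H_G^{-1}\mathcal S$. With $\partial_u^m\Phi(\upsilon)=\frac{d^m}{dt^m}\Phi(\upsilon+tu)|_{t=0}$ and $\Phi(\upsilon)=\frac\lambda2\|g-A(f)\|^2$, $$\delta_m(\mathtt r)=\sup_{\upsilon\in\Upsilon_0}\ \sup_{u:\|\mathcal D(\upsilon)u\|\le\mathtt r}|\partial_u^m\Phi(\upsilon)|\ (m=3,4),\qquad \delta_{3,G}(\mathtt r)=\sup_{\upsilon:\|\mathcal D_G(\upsilon-\upsilon^*_G)\|\le\mathtt r}\ \sup_{u:\|\mathcal D_Gu\|\le\mathtt r}|\partial_u^3\Phi(\upsilon)| .$$ Effective dimension: $\mathtt p_G(\upsilon)=\mathrm{tr}\{\mathcal F(\upsilon)\mathcal F_G^{-1}(\upsilon)\}$. Posterior. Given $Y$, $\upsilon_G=(f_G,g_G)$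 has density proportional to $\exp\mathcal L_G(\upsilon)$ on $\Upsilon^\circ$; $f_G\mid Y$ is its $f$-marginal.
   Formalization: Adds that on Ω(x) the set {υ: ‖D(υ̃_G)(υ−υ̃_G)‖≤r_0} lies in Υ_0 (otherwise a truncated Gaussian posterior with A=id refutes the bound), and that F(υ) is positive semidefinite on Υ_0 so that D(υ) is defined; the constant is C=10^6. *)

theory Defs
  imports "HOL-Probability.Probability"
begin

section \<open>Linear operators on Euclidean spaces\<close>

text \<open>Matrices are represented by linear maps, and the inverse of a nonsingular operator is
  the Hilbert-choice inverse \<^const>\<open>inv\<close>.\<close>

definition op_symmetric :: "('a::euclidean_space \<Rightarrow> 'a) \<Rightarrow> bool" where
  "op_symmetric T \<longleftrightarrow> linear T \<and> (\<forall>u v. T u \<bullet> v = u \<bullet> T v)"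

definition op_psd :: "('a::euclidean_space \<Rightarrow> 'a) \<Rightarrow> bool" where
  "op_psd T \<longleftrightarrow> op_symmetric T \<and> (\<forall>u. 0 \<le> T u \<bullet> u)"

definition op_pd :: "('a::euclidean_space \<Rightarrow> 'a) \<Rightarrow> bool" where
  "op_pd T \<longleftrightarrow> op_symmetric T \<and> (\<forall>u. u \<noteq> 0 \<longrightarrow> 0 < T u \<bullet> u)"

definition op_le :: "('a::euclidean_space \<Rightarrow> 'a) \<Rightarrow> ('a \<Rightarrow> 'a) \<Rightarrow> bool" where
  "op_le S T \<longleftrightarrow> op_psd (\<lambda>u. T u - S u)"

definition op_trace :: "('a::euclidean_space \<Rightarrow> 'a) \<Rightarrow> real" where
  "op_trace T = (\<Sum>b\<in>Basis. T b \<bullet> b)"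

definition op_sqrt :: "('a::euclidean_space \<Rightarrow> 'a) \<Rightarrow> 'a \<Rightarrow> 'a" where
  "op_sqrt T = (THE R. op_psd R \<and> R \<circ> R = T)"

definition eig_max :: "('a::euclidean_space \<Rightarrow> 'a) \<Rightarrow> real" where
  "eig_max T = Max {l. \<exists>u. u \<noteq> 0 \<and> T u = l *\<^sub>R u}"

definition ff_block ::
  "('x::euclidean_space \<times> 'y::euclidean_space \<Rightarrow> 'x \<times> 'y) \<Rightarrow> 'x \<Rightarrow> 'x" where
  "ff_block T = (\<lambda>f. fst (T (f, 0)))"

definition gg_block ::
  "('x::euclidean_space \<times> 'y::euclidean_space \<Rightarrow> 'x \<times> 'y) \<Rightarrow> 'y \<Rightarrow> 'y" where
  "gg_block T = (\<lambda>g. snd (T (0, g)))"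


section \<open>Derivatives\<close>

primrec C_k :: "nat \<Rightarrow> ('a::euclidean_space \<Rightarrow> 'b::euclidean_space) \<Rightarrow> bool" where
  "C_k 0 = (\<lambda>f. continuous_on UNIV f)"
| "C_k (Suc k) = (\<lambda>f. (\<forall>x. f differentiable (at x)) \<and>
      (\<forall>v. C_k k (\<lambda>x. frechet_derivative f (at x) v)))"

definition smooth :: "('a::euclidean_space \<Rightarrow> 'b::euclidean_space) \<Rightarrow> bool" where
  "smooth f \<longleftrightarrow> (\<forall>k. C_k k f)"

definition gradient :: "('a::euclidean_space \<Rightarrow> real) \<Rightarrow> 'a \<Rightarrow> 'a" where
  "gradient \<phi> x = (\<Sum>b\<in>Basis. frechet_derivative \<phi> (at x) b *\<^sub>R b)"

definition hessian :: "('a::euclidean_space \<Rightarrow> real) \<Rightarrow> 'a \<Rightarrow> 'a \<Rightarrow> 'a" where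
  "hessian \<phi> x = frechet_derivative (gradient \<phi>) (at x)"

definition dir_deriv ::
  "nat \<Rightarrow> 'a::euclidean_space \<Rightarrow> ('a \<Rightarrow> 'b::euclidean_space) \<Rightarrow> 'a \<Rightarrow> 'b" where
  "dir_deriv m u \<phi> x =
     ((\<lambda>h t. vector_derivative h (at t)) ^^ m) (\<lambda>t::real. \<phi> (x + t *\<^sub>R u)) 0"


section \<open>The calmed nonlinear inverse problem\<close>

text \<open>\<open>G\<close> and \<open>Gam\<close> are the positive symmetric square roots of the prior precision operators;
  \<open>pset\<close> is the set to which the prior is restricted.\<close>

record ('x, 'y) inverse_model =
  fwd :: "'x \<Rightarrow> 'y"
  sig :: real
  lam :: real
  prior_f :: 'x
  prior_g :: 'y
  G :: "'x \<Rightarrow> 'x"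
  Gam :: "'y \<Rightarrow> 'y"
  pset :: "('x \<times> 'y) set"

definition Phi :: "('x::euclidean_space, 'y::euclidean_space) inverse_model \<Rightarrow> 'x \<times> 'y \<Rightarrow> real" where
  "Phi m = (\<lambda>(f, g). lam m / 2 * (norm (g - fwd m f))\<^sup>2)"

definition loglik ::
  "('x::euclidean_space, 'y::euclidean_space) inverse_model \<Rightarrow> 'y \<Rightarrow> 'x \<times> 'y \<Rightarrow> real" where
  "loglik m y = (\<lambda>(f, g). - 1 / (2 * (sig m)\<^sup>2) * (norm (y - g))\<^sup>2
      - lam m / 2 * (norm (g - fwd m f))\<^sup>2)"

definition loglik_G ::
  "('x::euclidean_space, 'y::euclidean_space) inverse_model \<Rightarrow> 'y \<Rightarrow> 'x \<times> 'y \<Rightarrow> real" where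
  "loglik_G m y = (\<lambda>(f, g). loglik m y (f, g)
      - 1 / 2 * (norm (G m (f - prior_f m)))\<^sup>2 - 1 / 2 * (norm (Gam m (g - prior_g m)))\<^sup>2)"

text \<open>In the following, \<open>P\<close> is the underlying probability measure and \<open>Y\<close> the observation.\<close>

definition E_loglik :: "('x::euclidean_space, 'y::euclidean_space) inverse_model \<Rightarrow>
    'w measure \<Rightarrow> ('w \<Rightarrow> 'y) \<Rightarrow> 'x \<times> 'y \<Rightarrow> real" where
  "E_loglik m P Y \<upsilon> = (\<integral>\<omega>. loglik m (Y \<omega>) \<upsilon> \<partial>P)"

definition E_loglik_G :: "('x::euclidean_space, 'y::euclidean_space) inverse_model \<Rightarrow>
    'w measure \<Rightarrow> ('w \<Rightarrow> 'y) \<Rightarrow> 'x \<times> 'y \<Rightarrow> real" where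
  "E_loglik_G m P Y \<upsilon> = (\<integral>\<omega>. loglik_G m (Y \<omega>) \<upsilon> \<partial>P)"

definition noise :: "('x::euclidean_space, 'y::euclidean_space) inverse_model \<Rightarrow>
    'w measure \<Rightarrow> ('w \<Rightarrow> 'y) \<Rightarrow> 'w \<Rightarrow> 'y" where
  "noise m P Y \<omega> = (1 / sig m) *\<^sub>R (Y \<omega> - (\<integral>\<omega>'. Y \<omega>' \<partial>P))"

definition info :: "('x::euclidean_space, 'y::euclidean_space) inverse_model \<Rightarrow>
    'w measure \<Rightarrow> ('w \<Rightarrow> 'y) \<Rightarrow> 'x \<times> 'y \<Rightarrow> 'x \<times> 'y \<Rightarrow> 'x \<times> 'y" where
  "info m P Y \<upsilon> = (\<lambda>u. - hessian (E_loglik m P Y) \<upsilon> u)"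

definition info_G :: "('x::euclidean_space, 'y::euclidean_space) inverse_model \<Rightarrow>
    'w measure \<Rightarrow> ('w \<Rightarrow> 'y) \<Rightarrow> 'x \<times> 'y \<Rightarrow> 'x \<times> 'y \<Rightarrow> 'x \<times> 'y" where
  "info_G m P Y \<upsilon> = (\<lambda>u. - hessian (E_loglik_G m P Y) \<upsilon> u)"

definition DD :: "('x::euclidean_space, 'y::euclidean_space) inverse_model \<Rightarrow>
    'w measure \<Rightarrow> ('w \<Rightarrow> 'y) \<Rightarrow> 'x \<times> 'y \<Rightarrow> 'x \<times> 'y \<Rightarrow> 'x \<times> 'y" where
  "DD m P Y \<upsilon> = op_sqrt (info m P Y \<upsilon>)"

definition DD_G :: "('x::euclidean_space, 'y::euclidean_space) inverse_model \<Rightarrow>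
    'w measure \<Rightarrow> ('w \<Rightarrow> 'y) \<Rightarrow> 'x \<times> 'y \<Rightarrow> 'x \<times> 'y \<Rightarrow> 'x \<times> 'y" where
  "DD_G m P Y \<upsilon> = op_sqrt (info_G m P Y \<upsilon>)"

text \<open>Two different objects: the inverse of the \<open>ff\<close>-block of \<open>info_G\<close> enters condition
  \<open>cond_G_Gam\<close> below, whereas \<open>marg_f\<close> inverts the \<open>ff\<close>-block of the inverse (a Schur
  complement).\<close>

definition marg_f :: "('x::euclidean_space, 'y::euclidean_space) inverse_model \<Rightarrow>
    'w measure \<Rightarrow> ('w \<Rightarrow> 'y) \<Rightarrow> 'x \<times> 'y \<Rightarrow> 'x \<Rightarrow> 'x" where
  "marg_f m P Y \<upsilon> = inv (ff_block (inv (info_G m P Y \<upsilon>)))"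

definition marg_g_inv :: "('x::euclidean_space, 'y::euclidean_space) inverse_model \<Rightarrow>
    'w measure \<Rightarrow> ('w \<Rightarrow> 'y) \<Rightarrow> 'x \<times> 'y \<Rightarrow> 'y \<Rightarrow> 'y" where
  "marg_g_inv m P Y \<upsilon> = gg_block (inv (info_G m P Y \<upsilon>))"

definition eff_dim :: "('x::euclidean_space, 'y::euclidean_space) inverse_model \<Rightarrow>
    'w measure \<Rightarrow> ('w \<Rightarrow> 'y) \<Rightarrow> 'x \<times> 'y \<Rightarrow> real" where
  "eff_dim m P Y \<upsilon> = op_trace (info m P Y \<upsilon> \<circ> inv (info_G m P Y \<upsilon>))"

definition zq :: "('a::euclidean_space \<Rightarrow> 'a) \<Rightarrow> real \<Rightarrow> real" where
  "zq B x = sqrt (op_trace B) + sqrt (2 * eig_max B * x)"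

definition B_SG :: "('x::euclidean_space, 'y::euclidean_space) inverse_model \<Rightarrow>
    'w measure \<Rightarrow> ('w \<Rightarrow> 'y) \<Rightarrow> ('y \<Rightarrow> 'y) \<Rightarrow> 'x \<times> 'y \<Rightarrow> 'y \<Rightarrow> 'y" where
  "B_SG m P Y S \<upsilon>s = (\<lambda>v. (1 / (sig m)\<^sup>2) *\<^sub>R S (marg_g_inv m P Y \<upsilon>s (S v)))"


section \<open>Standing conditions\<close>

definition cond_L :: "('x::euclidean_space, 'y::euclidean_space) inverse_model \<Rightarrow>
    'w measure \<Rightarrow> ('w \<Rightarrow> 'y) \<Rightarrow> bool" where
  "cond_L m P Y \<longleftrightarrow> open (pset m) \<and> convex (pset m) \<and> concave_on (pset m) (E_loglik_G m P Y)"

definition covariance_op ::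
  "'w measure \<Rightarrow> ('w \<Rightarrow> 'y::euclidean_space) \<Rightarrow> 'y \<Rightarrow> 'y" where
  "covariance_op P X u = (let c = (\<integral>\<omega>. X \<omega> \<partial>P) in
     \<integral>\<omega>. ((X \<omega> - c) \<bullet> u) *\<^sub>R (X \<omega> - c) \<partial>P)"

text \<open>Integrability is stated explicitly since the Bochner integral of a non-integrable function
  is 0. For \<open>u = 0\<close> the quotient is 0 and the bound is trivial.\<close>

definition cond_ES :: "('x::euclidean_space, 'y::euclidean_space) inverse_model \<Rightarrow>
    'w measure \<Rightarrow> ('w \<Rightarrow> 'y) \<Rightarrow> ('y \<Rightarrow> 'y) \<Rightarrow> ereal \<Rightarrow> real \<Rightarrow> bool" where
  "cond_ES m P Y S gg \<nu>0 \<longleftrightarrow> op_pd S \<and> 0 < gg \<and> 1 \<le> \<nu>0 \<and>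
     op_le (covariance_op P (noise m P Y)) (S \<circ> S) \<and>
     (\<forall>t u. ereal \<bar>t\<bar> \<le> gg \<longrightarrow>
        integrable P (\<lambda>\<omega>. exp (t * (u \<bullet> noise m P Y \<omega>) / norm (S u))) \<and>
        ln (\<integral>\<omega>. exp (t * (u \<bullet> noise m P Y \<omega>) / norm (S u)) \<partial>P) \<le> \<nu>0\<^sup>2 * t\<^sup>2 / 2)"

definition cond_G_Gam :: "('x::euclidean_space, 'y::euclidean_space) inverse_model \<Rightarrow>
    'w measure \<Rightarrow> ('w \<Rightarrow> 'y) \<Rightarrow> 'x \<Rightarrow> 'x \<times> 'y \<Rightarrow> real \<Rightarrow> bool" where
  "cond_G_Gam m P Y fs \<upsilon>s C \<longleftrightarrow> prior_g m = fwd m (prior_f m) \<and>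
     (norm (Gam m (fwd m fs - prior_g m)))\<^sup>2 \<le> C * (norm (G m (fs - prior_f m)))\<^sup>2 \<and>
     op_trace (inv (\<lambda>v. (sig m)\<^sup>2 *\<^sub>R Gam m (Gam m v) + v))
       \<le> C * op_trace (inv (ff_block (info_G m P Y \<upsilon>s)) \<circ> ff_block (info m P Y \<upsilon>s))"

text \<open>The directional derivatives always exist here, because the forward operator is assumed
  to be smooth on the whole space.\<close>

definition cond_L0 :: "('x::euclidean_space, 'y::euclidean_space) inverse_model \<Rightarrow>
    ('x \<times> 'y) set \<Rightarrow> ('x \<times> 'y) set \<Rightarrow> bool" where
  "cond_L0 m \<Upsilon>0 U \<longleftrightarrow> (\<exists>K. \<forall>(f, g)\<in>\<Upsilon>0. \<forall>(\<alpha>, \<beta>)\<in>U. \<forall>k\<in>{3, 4}.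
     norm (dir_deriv k \<alpha> (fwd m) f) \<le> K)"


section \<open>Local smoothness\<close>

text \<open>Suprema are taken in the extended reals, so that an unbounded family has supremum
  infinity.\<close>

definition \<delta> :: "('x::euclidean_space, 'y::euclidean_space) inverse_model \<Rightarrow>
    'w measure \<Rightarrow> ('w \<Rightarrow> 'y) \<Rightarrow> ('x \<times> 'y) set \<Rightarrow> nat \<Rightarrow> real \<Rightarrow> ereal" where
  "\<delta> m P Y \<Upsilon>0 k r =
     (SUP \<upsilon>\<in>\<Upsilon>0. SUP u\<in>{u. norm (DD m P Y \<upsilon> u) \<le> r}. ereal \<bar>dir_deriv k u (Phi m) \<upsilon>\<bar>)"

definition \<delta>3G :: "('x::euclidean_space, 'y::euclidean_space) inverse_model \<Rightarrow>
    'w measure \<Rightarrow> ('w \<Rightarrow> 'y) \<Rightarrow> 'x \<times> 'y \<Rightarrow> real \<Rightarrow> ereal" where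
  "\<delta>3G m P Y \<upsilon>s r =
     (SUP \<upsilon>\<in>{\<upsilon>. norm (DD_G m P Y \<upsilon>s (\<upsilon> - \<upsilon>s)) \<le> r}.
      SUP u\<in>{u. norm (DD_G m P Y \<upsilon>s u) \<le> r}. ereal \<bar>dir_deriv 3 u (Phi m) \<upsilon>\<bar>)"

definition diamond :: "('x::euclidean_space, 'y::euclidean_space) inverse_model \<Rightarrow>
    'w measure \<Rightarrow> ('w \<Rightarrow> 'y) \<Rightarrow> ('x \<times> 'y) set \<Rightarrow> real \<Rightarrow> ereal" where
  "diamond m P Y \<Upsilon>0 r = 4 * (\<delta> m P Y \<Upsilon>0 3 r)\<^sup>2 + 4 * \<delta> m P Y \<Upsilon>0 4 r"

definition C0 :: "('x::euclidean_space, 'y::euclidean_space) inverse_model \<Rightarrow>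
    'w measure \<Rightarrow> ('w \<Rightarrow> 'y) \<Rightarrow> ('x \<times> 'y) set \<Rightarrow> real \<Rightarrow> ereal" where
  "C0 m P Y \<Upsilon>0 r = 1 - ereal (3 / r\<^sup>2) * \<delta> m P Y \<Upsilon>0 3 r"

text \<open>A local set of radius \<open>r\<close> at the expansion point \<open>\<upsilon>\<close>: \<open>\<delta> m P Y \<Upsilon>0\<close> is a modulus for the
  Taylor expansion of \<open>Phi m\<close> on the \<open>r\<close>-vicinity of \<open>\<upsilon>\<close> only if this vicinity lies in \<open>\<Upsilon>0\<close>.
  The requirement cannot be dropped: for a linear forward operator and deterministic \<open>Y\<close> all
  \<open>\<delta>\<close> vanish, whereas for a small bounded \<open>pset m\<close> the posterior is a truncated Gaussian.\<close>

definition local_set :: "('x::euclidean_space, 'y::euclidean_space) inverse_model \<Rightarrow>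
    'w measure \<Rightarrow> ('w \<Rightarrow> 'y) \<Rightarrow> ('x \<times> 'y) set \<Rightarrow> 'x \<times> 'y \<Rightarrow> real \<Rightarrow> bool" where
  "local_set m P Y \<Upsilon>0 \<upsilon> r \<longleftrightarrow> \<Upsilon>0 \<subseteq> pset m \<and> {\<upsilon>'. norm (DD m P Y \<upsilon> (\<upsilon>' - \<upsilon>)) \<le> r} \<subseteq> \<Upsilon>0"


section \<open>Posterior and its Gaussian approximation\<close>

definition posterior :: "('x::euclidean_space, 'y::euclidean_space) inverse_model \<Rightarrow>
    'y \<Rightarrow> ('x \<times> 'y) measure" where
  "posterior m y =
     (let Z = (\<integral>\<^sup>+\<upsilon>\<in>pset m. ennreal (exp (loglik_G m y \<upsilon>)) \<partial>lborel)
      in density lborel (\<lambda>\<upsilon>. ennreal (exp (loglik_G m y \<upsilon>)) * indicator (pset m) \<upsilon> / Z))"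

definition posterior_f :: "('x::euclidean_space, 'y::euclidean_space) inverse_model \<Rightarrow>
    'y \<Rightarrow> 'x measure" where
  "posterior_f m y = distr (posterior m y) borel fst"

definition std_gaussian :: "'x::euclidean_space measure" where
  "std_gaussian = density lborel (\<lambda>x. ennreal (\<Prod>b\<in>Basis. std_normal_density (x \<bullet> b)))"

text \<open>The last argument is the realised value of the maximum of the penalised likelihood, and
  the operator is frozen at this value: conditionally on it, only the Gaussian vector is random.\<close>

definition gauss_error :: "('x::euclidean_space, 'y::euclidean_space) inverse_model \<Rightarrow>
    'w measure \<Rightarrow> ('w \<Rightarrow> 'y) \<Rightarrow> 'y \<Rightarrow> 'x \<times> 'y \<Rightarrow> 'x set \<Rightarrow> real" where
  "gauss_error m P Y y \<upsilon> B =
     \<bar>measure (posterior_f m y) {f. f - fst \<upsilon> \<in> B}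
      - measure std_gaussian {\<gamma>. inv (op_sqrt (marg_f m P Y \<upsilon>)) \<gamma> \<in> B}\<bar>"

definition symmetric_borel :: "'x::euclidean_space set set" where
  "symmetric_borel = {B \<in> sets borel. uminus ` B = B}"

text \<open>The unspecified absolute constant of the error bounds. An existential quantifier inside a
  theorem would come after the universally quantified types and would let the constant depend
  on the dimensions of both spaces; a closed real number is independent of them.\<close>

definition abs_const :: real where
  "abs_const = 10 ^ 6"

end

theory Submission
  imports Defs
begin

text \<open>Fix a realisation \<open>y\<close> of the data and let \<open>v\<close> maximize the penalized log-likelihood. Its
quadratic part at \<open>v\<close> is \<open>- 1/2 * F\<^sub>G u \<bullet> u\<close>, and what is left is the third order Taylor
remainder of \<open>Phi\<close>, since all other terms are quadratic. In a basis that is orthonormal for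
\<open>F\<^sub>G\<close> and diagonal for \<open>F\<close> (\<open>simultaneous_diagonalization\<close>) the Gaussian approximation
becomes the standard Gaussian measure, the local set \<open>\<parallel>D u\<parallel> \<le> r0\<close> becomes an ellipsoid
\<open>\<Sum> \<beta>\<^sub>b z\<^sub>b\<^sup>2 \<le> r0\<^sup>2\<close> with \<open>0 \<le> \<beta>\<^sub>b \<le> 1\<close>, and \<open>\<Sum> \<beta>\<^sub>b\<close> is the effective dimension \<open>p\<close>.

Inside the ellipsoid the remainder is at most a multiple of \<open>\<delta>\<^sub>3\<close> (\<open>taylor_remainders\<close>), so
the posterior density, divided by the Gaussian one, differs from 1 by \<open>O(\<delta>\<^sub>3)\<close>. On a symmetric
set one may first average the ratio over \<open>z\<close> and \<open>- z\<close>. The cubic term is odd and cancels,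
which leaves \<open>O(\<delta>\<^sub>3\<^sup>2 + \<delta>\<^sub>4)\<close>: this is the gain for symmetric sets.

Outside the ellipsoid only the concavity of the penalized log-likelihood is available.
Extrapolating it along rays from \<open>v\<close> would bring in the full dimension. Instead, \<open>z\<close> is
compared with \<open>p\<^sub>z = (1 + \<kappa> B)\<^sup>-\<^sup>1 z\<close>, where \<open>B\<close> is diagonal with entries \<open>\<beta>\<^sub>b\<close> and \<open>\<kappa>\<close> is
chosen such that \<open>p\<^sub>z\<close> lies on a slightly smaller ellipsoid. Concavity on the segment from
\<open>p\<^sub>z\<close> to \<open>z\<close> bounds the density ratio, up to a constant factor, by
\<open>exp ((\<Sum> A\<^sub>b z\<^sub>b\<^sup>2 - \<kappa> r\<^sup>2) / 2)\<close> with \<open>A\<^sub>b = \<kappa> \<beta>\<^sub>b / (1 + \<kappa> \<beta>\<^sub>b)\<close> (\<open>chord_bound\<close>). For fixed \<open>\<kappa>\<close>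
its Gaussian expectation is \<open>\<Prod> sqrt (1 + \<kappa> \<beta>\<^sub>b) * exp (- \<kappa> r\<^sup>2 / 2) \<le> exp (- \<kappa> (r\<^sup>2 - p) / 2)\<close>,
which depends on the dimension through \<open>p\<close> only. A union bound over a grid of values of \<open>\<kappa>\<close>
yields a tail of order \<open>1/n\<close> (\<open>posterior_tail\<close>).

Normalizing (\<open>laplace_tv\<close>) and projecting to the \<open>f\<close>-component, whose Gaussian law is
identified by a Schur complement (\<open>gaussian_marginal\<close>), gives the two bounds. Large constants
cost nothing: the error is at most 1, so that one may assume \<open>n > 10\<^sup>6\<close> and tiny \<open>\<delta>\<^sub>3\<close> or
diamond.

One more fact is needed: \<open>v\<close> must belong to \<open>\<Upsilon>\<^sub>0\<close>, for otherwise the information operator at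
\<open>v\<close> need not be positive and its square root would be meaningless. This follows from the bound
on the noise by a concavity argument around the maximizer of the expected log-likelihood
(\<open>maximizer_localized\<close>).\<close>


section \<open>Symmetric operators\<close>

lemma op_symmetricD:
  assumes "op_symmetric T"
  shows "linear T" "T u \<bullet> v = u \<bullet> T v"
  using assms unfolding op_symmetric_def by auto

lemma op_pd_imp_psd: "op_pd T \<Longrightarrow> op_psd T"
  unfolding op_pd_def op_psd_def
  by (metis inner_zero_right less_eq_real_def order_refl)

lemma op_symmetric_id: "op_symmetric (\<lambda>u. u)"
  unfolding op_symmetric_def by (simp add: linear_id[unfolded id_def])

lemma op_pd_id: "op_pd (\<lambda>u. u)"
  unfolding op_pd_def by (simp add: op_symmetric_id)

text \<open>The first-order condition for the maximizer of a Rayleigh quotient: near 0 the linear term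
dominates.\<close>

lemma nonpos_quadratic_slope_zero:
  fixes a b :: real
  assumes "\<And>t. 2 * a * t + b * t\<^sup>2 \<le> 0"
  shows "a = 0"
proof (rule ccontr)
  assume a: "a \<noteq> 0"
  define s where "s = a / (\<bar>b\<bar> + 1)"
  have as: "a * s = s\<^sup>2 * (\<bar>b\<bar> + 1)"
    unfolding s_def by (simp add: power2_eq_square)
  have s: "s\<^sup>2 > 0" unfolding s_def using a by simp
  have "- \<bar>b\<bar> * s\<^sup>2 \<le> b * s\<^sup>2" by (intro mult_right_mono) auto
  then have "2 * a * s + b * s\<^sup>2 \<ge> 2 * (s\<^sup>2 * (\<bar>b\<bar> + 1)) - \<bar>b\<bar> * s\<^sup>2"
    using as by linarith
  also have "2 * (s\<^sup>2 * (\<bar>b\<bar> + 1)) - \<bar>b\<bar> * s\<^sup>2 = s\<^sup>2 * (\<bar>b\<bar> + 2)"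
    by (simp add: algebra_simps)
  finally show False using assms[of s] s by (smt (verit) mult_pos_pos abs_ge_zero)
qed

text \<open>The quotient \<open>(A u \<bullet> u) / (M u \<bullet> u)\<close> attains its maximum \<open>b\<close> on the unit sphere of the
subspace; there the nonpositive form \<open>A - b M\<close> vanishes, hence so does its derivative.\<close>

lemma rayleigh_maximizer:
  fixes A M :: "'a::euclidean_space \<Rightarrow> 'a"
  assumes A: "op_symmetric A" and M: "op_pd M" and S: "subspace S"
    and w: "w \<in> S" "w \<noteq> 0"
  obtains e b where "e \<in> S" "M e \<bullet> e = 1" "\<And>u. u \<in> S \<Longrightarrow> A e \<bullet> u = b * (M e \<bullet> u)"
proof -
  have M': "op_symmetric M" using M unfolding op_pd_def by auto
  note linA = op_symmetricD(1)[OF A] and linM = op_symmetricD(1)[OF M']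
  have Mpos: "M u \<bullet> u > 0" if "u \<noteq> 0" for u using M that unfolding op_pd_def by auto
  let ?K = "sphere (0::'a) 1 \<inter> S"
  have comp: "compact ?K"
    by (intro compact_Int_closed closed_subspace S) auto
  have ne: "(1 / norm w) *\<^sub>R w \<in> ?K"
    using w S by (auto simp: subspace_scale)
  have Mne: "\<forall>u\<in>?K. M u \<bullet> u \<noteq> 0"
  proof
    fix u assume "u \<in> ?K"
    then have "u \<noteq> 0" by auto
    then show "M u \<bullet> u \<noteq> 0" using Mpos[of u] by simp
  qed
  have contA: "continuous_on ?K (\<lambda>u. (A u \<bullet> u) / (M u \<bullet> u))"
    by (intro continuous_intros linear_continuous_on linear_conv_bounded_linear[THEN iffD1] linA linM)
       (rule Mne)
  obtain k where k: "k \<in> ?K" "\<And>u. u \<in> ?K \<Longrightarrow> (A u \<bullet> u) / (M u \<bullet> u) \<le> (A k \<bullet> k) / (M k \<bullet> k)"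
    using continuous_attains_sup[OF comp _ contA] ne by blast
  define b where "b = (A k \<bullet> k) / (M k \<bullet> k)"
  have k0: "k \<noteq> 0" using k(1) by auto
  have ray: "A u \<bullet> u \<le> b * (M u \<bullet> u)" if "u \<in> S" for u
  proof (cases "u = 0")
    case True then show ?thesis by (simp add: linear_0[OF linA] linear_0[OF linM])
  next
    case False
    let ?u = "(1 / norm u) *\<^sub>R u"
    have uK: "?u \<in> ?K" using that False S by (auto simp: subspace_scale)
    have "(A ?u \<bullet> ?u) / (M ?u \<bullet> ?u) = (A u \<bullet> u) / (M u \<bullet> u)"
      using False by (simp add: linear_scale[OF linA] linear_scale[OF linM])
    then have "(A u \<bullet> u) / (M u \<bullet> u) \<le> b" using k(2)[OF uK] unfolding b_def by simp
    then show ?thesis using Mpos[OF False] by (simp add: field_simps)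
  qed
  have eqk: "A k \<bullet> k = b * (M k \<bullet> k)" unfolding b_def using Mpos[OF k0] by simp
  have stat: "A k \<bullet> u = b * (M k \<bullet> u)" if u: "u \<in> S" for u
  proof -
    have "2 * (A k \<bullet> u - b * (M k \<bullet> u)) * t + (A u \<bullet> u - b * (M u \<bullet> u)) * t\<^sup>2 \<le> 0" for t
    proof -
      have "k + t *\<^sub>R u \<in> S" using k(1) u S by (auto intro: subspace_add subspace_scale)
      from ray[OF this]
      have r: "(A k + t *\<^sub>R A u) \<bullet> (k + t *\<^sub>R u) \<le> b * ((M k + t *\<^sub>R M u) \<bullet> (k + t *\<^sub>R u))"
        by (simp add: linear_add[OF linA] linear_add[OF linM] linear_scale[OF linA] linear_scale[OF linM])
      have sA: "A u \<bullet> k = A k \<bullet> u" using op_symmetricD(2)[OF A, of u k] by (simp add: inner_commute)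
      have sM: "M u \<bullet> k = M k \<bullet> u" using op_symmetricD(2)[OF M', of u k] by (simp add: inner_commute)
      show ?thesis using r eqk
        by (simp add: inner_add_left inner_add_right sA sM power2_eq_square algebra_simps)
    qed
    then have "A k \<bullet> u - b * (M k \<bullet> u) = 0" by (rule nonpos_quadratic_slope_zero)
    then show ?thesis by simp
  qed
  define c where "c = 1 / sqrt (M k \<bullet> k)"
  show ?thesis
  proof (rule that[of "c *\<^sub>R k" b])
    show "c *\<^sub>R k \<in> S" using k(1) S by (auto simp: subspace_scale)
    have "c * c = 1 / (M k \<bullet> k)" unfolding c_def using Mpos[OF k0] by simp
    then show "M (c *\<^sub>R k) \<bullet> (c *\<^sub>R k) = 1"
      using Mpos[OF k0] by (simp add: linear_scale[OF linM] mult.assoc[symmetric])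
    show "A (c *\<^sub>R k) \<bullet> u = b * (M (c *\<^sub>R k) \<bullet> u)" if "u \<in> S" for u
      using stat[OF that] by (simp add: linear_scale[OF linA] linear_scale[OF linM])
  qed
qed

text \<open>Fewer linear conditions than the dimension have a common nonzero solution.\<close>

lemma nontrivial_orthogonal_vector:
  fixes m :: "'a::euclidean_space \<Rightarrow> 'a"
  assumes J: "J \<subseteq> Basis" and k: "k \<in> Basis" "k \<notin> J"
  obtains u where "u \<noteq> 0" "\<And>j. j \<in> J \<Longrightarrow> m j \<bullet> u = 0"
proof -
  let ?L = "\<lambda>u. \<Sum>j\<in>J. (m j \<bullet> u) *\<^sub>R j"
  have fJ: "finite J" using J finite_subset finite_Basis by blast
  have lin: "linear ?L"
    by (rule linearI) (simp_all add: inner_add_right scaleR_add_left sum.distrib scaleR_sum_right)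
  have "\<not> surj ?L"
  proof
    assume "surj ?L"
    then obtain u where "k = ?L u" unfolding surj_def by blast
    then have "k \<bullet> k = ?L u \<bullet> k" by (rule arg_cong)
    also have "\<dots> = (\<Sum>j\<in>J. (m j \<bullet> u) * (j \<bullet> k))" by (simp add: inner_sum_left)
    also have "\<dots> = 0"
    proof (intro sum.neutral ballI)
      fix j assume "j \<in> J"
      then have "j \<bullet> k = 0" using J k by (intro inner_not_same_Basis) auto
      then show "(m j \<bullet> u) * (j \<bullet> k) = 0" by simp
    qed
    finally show False using k by (simp add: inner_Basis)
  qed
  then have "\<not> inj ?L" using linear_injective_imp_surjective[OF lin] by auto
  then obtain u where u: "?L u = 0" "u \<noteq> 0" using linear_injective_0[OF lin] by auto
  have "m j \<bullet> u = 0" if j: "j \<in> J" for j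
  proof -
    have "0 = ?L u \<bullet> j" using u by simp
    also have "\<dots> = (\<Sum>i\<in>J. (m i \<bullet> u) * (i \<bullet> j))" by (simp add: inner_sum_left)
    also have "\<dots> = (\<Sum>i\<in>J. if i = j then m j \<bullet> u else 0)"
      using J j by (intro sum.cong refl) (auto simp: inner_Basis subset_iff)
    also have "\<dots> = m j \<bullet> u" using fJ j by simp
    finally show ?thesis by simp
  qed
  then show ?thesis using u(2) that by blast
qed

text \<open>Generalized eigenvectors are collected one at a time, each maximizing the Rayleigh quotient
over the \<open>M\<close>-orthogonal complement of the previous ones. The case \<open>M = id\<close> is the spectral
theorem.\<close>

theorem simultaneous_diagonalization:
  fixes A M :: "'a::euclidean_space \<Rightarrow> 'a"
  assumes A: "op_symmetric A" and M: "op_pd M"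
  obtains e :: "'a \<Rightarrow> 'a" and \<beta> where "\<And>i j. i \<in> Basis \<Longrightarrow> j \<in> Basis \<Longrightarrow> M (e i) \<bullet> e j = (if i = j then 1 else 0)"
    and "\<And>i. i \<in> Basis \<Longrightarrow> A (e i) = \<beta> i *\<^sub>R M (e i)"
proof -
  have M': "op_symmetric M" using M unfolding op_pd_def by auto
  note linA = op_symmetricD(1)[OF A] and linM = op_symmetricD(1)[OF M']
  have "\<exists>e \<beta>. (\<forall>i\<in>J. \<forall>j\<in>J. M (e i) \<bullet> e j = (if i = j then 1 else 0)) \<and>
      (\<forall>i\<in>J. A (e i) = \<beta> i *\<^sub>R M (e i))" if "finite J" "J \<subseteq> (Basis :: 'a set)" for J
    using that
  proof (induction J rule: finite_induct)
    case empty
    then show ?case by simp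
  next
    case (insert k J)
    then obtain e \<beta> where orth: "\<And>i j. i \<in> J \<Longrightarrow> j \<in> J \<Longrightarrow> M (e i) \<bullet> e j = (if i = j then 1 else 0)"
      and eig: "\<And>i. i \<in> J \<Longrightarrow> A (e i) = \<beta> i *\<^sub>R M (e i)" by blast
    let ?S = "{u. \<forall>j\<in>J. M (e j) \<bullet> u = 0}"
    have S: "subspace ?S" by (auto simp: subspace_def inner_add_right)
    obtain w where w: "w \<noteq> 0" "\<And>j. j \<in> J \<Longrightarrow> M (e j) \<bullet> w = 0"
      using nontrivial_orthogonal_vector[of J k "\<lambda>j. M (e j)"] insert.hyps insert.prems by auto
    have wS: "w \<in> ?S" using w by auto
    obtain f b where fS: "f \<in> ?S" and fn: "M f \<bullet> f = 1" and fe: "\<And>u. u \<in> ?S \<Longrightarrow> A f \<bullet> u = b * (M f \<bullet> u)"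
      by (rule rayleigh_maximizer[OF A M S wS w(1)]) blast
    have fz: "M (e j) \<bullet> f = 0" "M f \<bullet> e j = 0" if "j \<in> J" for j
    proof -
      show "M (e j) \<bullet> f = 0" using fS that by auto
      then show "M f \<bullet> e j = 0" using op_symmetricD(2)[OF M', of f "e j"] by (simp add: inner_commute)
    qed
    have "A f = b *\<^sub>R M f"
    proof (rule vector_eq_rdot[THEN iffD1], rule allI)
      fix u
      \<comment> \<open>removing the components along the previous vectors brings the test vector into \<open>?S\<close>\<close>
      define u' where "u' = u - (\<Sum>j\<in>J. (M (e j) \<bullet> u) *\<^sub>R e j)"
      have "M (e i) \<bullet> u' = 0" if i: "i \<in> J" for i
      proof -
        have "M (e i) \<bullet> (\<Sum>j\<in>J. (M (e j) \<bullet> u) *\<^sub>R e j) = (\<Sum>j\<in>J. (M (e j) \<bullet> u) * (M (e i) \<bullet> e j))"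
          by (simp add: inner_sum_right)
        also have "\<dots> = (\<Sum>j\<in>J. if j = i then M (e i) \<bullet> u else 0)"
          using i by (intro sum.cong) (auto simp: orth)
        also have "\<dots> = M (e i) \<bullet> u" using i insert.hyps by simp
        finally show ?thesis unfolding u'_def by (simp add: inner_diff_right)
      qed
      then have 1: "A f \<bullet> u' = b * (M f \<bullet> u')" by (intro fe) auto
      have Afe: "A f \<bullet> e j = 0" if "j \<in> J" for j
        using op_symmetricD(2)[OF A, of f "e j"] eig[OF that] fz[OF that] by (simp add: inner_commute)
      have "A f \<bullet> u = A f \<bullet> u'" unfolding u'_def
        by (simp add: inner_diff_right inner_sum_right Afe)
      moreover have "M f \<bullet> u = M f \<bullet> u'" unfolding u'_def
        by (simp add: inner_diff_right inner_sum_right fz)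
      ultimately show "A f \<bullet> u = (b *\<^sub>R M f) \<bullet> u" using 1 by simp
    qed
    then show ?case
      using orth eig fz fn insert.hyps
      by (intro exI[of _ "e(k := f)"] exI[of _ "\<beta>(k := b)"]) auto
  qed
  from this[OF finite_Basis order_refl]
  obtain e :: "'a \<Rightarrow> 'a" and \<beta> where "\<forall>i\<in>Basis. \<forall>j\<in>Basis. M (e i) \<bullet> e j = (if i = j then 1 else 0)"
    "\<forall>i\<in>Basis. A (e i) = \<beta> i *\<^sub>R M (e i)"
    by blast
  then show ?thesis by (intro that[of e \<beta>]) auto
qed

definition frame_map :: "('a::euclidean_space \<Rightarrow> 'a) \<Rightarrow> 'a \<Rightarrow> 'a" where
  "frame_map e z = (\<Sum>b\<in>Basis. (z \<bullet> b) *\<^sub>R e b)"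

lemma linear_frame_map: "linear (frame_map e)"
  unfolding frame_map_def
  by (rule linearI) (simp_all add: inner_add_left scaleR_add_left sum.distrib scaleR_sum_right)

definition diag_form :: "('a::euclidean_space \<Rightarrow> real) \<Rightarrow> 'a \<Rightarrow> real" where
  "diag_form c z = (\<Sum>b\<in>Basis. c b * (z \<bullet> b)\<^sup>2)"

lemma diag_form_minus [simp]: "diag_form c (- z) = diag_form c z"
  by (simp add: diag_form_def)

lemma frame_map_form:
  fixes e :: "'a::euclidean_space \<Rightarrow> 'a"
  assumes T: "linear T"
    and d: "\<And>i j. i \<in> Basis \<Longrightarrow> j \<in> Basis \<Longrightarrow> T (e i) \<bullet> e j = (if i = j then c i else 0)"
  shows "T (frame_map e z) \<bullet> frame_map e z = diag_form c z"
proof -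
  have "T (frame_map e z) \<bullet> frame_map e z =
      (\<Sum>i\<in>Basis. \<Sum>j\<in>Basis. (z \<bullet> i) * (z \<bullet> j) * (T (e i) \<bullet> e j))"
    unfolding frame_map_def
    by (simp add: linear_sum[OF T] linear_scale[OF T] inner_sum_left inner_sum_right
        sum_distrib_left mult_ac)
       (subst sum.swap, simp add: mult_ac)
  also have "\<dots> = (\<Sum>i\<in>Basis. \<Sum>j\<in>Basis. if j = i then c i * (z \<bullet> i)\<^sup>2 else 0)"
    by (intro sum.cong refl) (auto simp: d power2_eq_square)
  finally show ?thesis by (simp add: diag_form_def)
qed

lemma sum_squared_coordinates:
  fixes z :: "'a::euclidean_space"
  shows "(\<Sum>b\<in>Basis. (z \<bullet> b)\<^sup>2) = (norm z)\<^sup>2"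
  unfolding power2_norm_eq_inner by (subst euclidean_inner) (simp add: power2_eq_square)

lemma bij_frame_map:
  fixes M e :: "'a::euclidean_space \<Rightarrow> 'a"
  assumes M: "linear M"
    and orth: "\<And>i j. i \<in> Basis \<Longrightarrow> j \<in> Basis \<Longrightarrow> M (e i) \<bullet> e j = (if i = j then 1 else 0)"
  shows "bij (frame_map e)"
proof -
  have "inj (frame_map e)"
  proof (subst linear_injective_0[OF linear_frame_map], intro allI impI)
    fix z assume "frame_map e z = 0"
    moreover have "M (frame_map e z) \<bullet> frame_map e z = (norm z)\<^sup>2"
      by (subst frame_map_form[OF M orth]) (simp_all add: diag_form_def sum_squared_coordinates)
    ultimately show "z = 0" by simp
  qed
  then show ?thesis
    using linear_injective_imp_surjective[OF linear_frame_map] by (auto simp: bij_def)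
qed

lemma op_pd_bij:
  assumes "op_pd M" shows "bij M"
proof -
  have lin: "linear M" using assms unfolding op_pd_def op_symmetric_def by auto
  have "inj M"
    using assms unfolding linear_injective_0[OF lin] op_pd_def by (metis inner_zero_left less_irrefl)
  then show ?thesis using linear_injective_imp_surjective[OF lin] by (auto simp: bij_def)
qed

lemma op_pd_inv:
  assumes M: "op_pd M" shows "op_pd (inv M)" "M (inv M u) = u" "inv M (M u) = u"
proof -
  have M': "op_symmetric M" using M unfolding op_pd_def by auto
  note linM = op_symmetricD(1)[OF M']
  have b: "bij M" by (rule op_pd_bij[OF M])
  show 1: "M (inv M u) = u" for u using b by (simp add: bij_def surj_f_inv_f)
  show 2: "inv M (M u) = u" for u using b by (simp add: bij_def)
  have lin: "linear (inv M)" using inj_linear_imp_inv_linear linM b unfolding bij_def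
    by (metis bij_def b inj_linear_imp_inv_linear)
  have sym: "inv M u \<bullet> v = u \<bullet> inv M v" for u v
    using op_symmetricD(2)[OF M', of "inv M u" "inv M v"] by (simp add: 1)
  have pos: "inv M u \<bullet> u > 0" if "u \<noteq> 0" for u
  proof -
    have "inv M u \<noteq> 0" using 1[of u] that linear_0[OF linM] by auto
    then have "M (inv M u) \<bullet> inv M u > 0" using M unfolding op_pd_def by auto
    then show ?thesis by (simp add: 1 inner_commute)
  qed
  show "op_pd (inv M)" unfolding op_pd_def op_symmetric_def using lin sym pos by auto
qed

text \<open>The trace of \<open>A M\<^sup>-\<^sup>1\<close> can be read off from any \<open>M\<close>-orthonormal frame, because
\<open>M\<^sup>-\<^sup>1 w = \<Sum> (w \<bullet> e\<^sub>i) e\<^sub>i\<close>. This turns the effective dimension into a sum of eigenvalues.\<close>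

lemma frame_trace:
  fixes A M e :: "'a::euclidean_space \<Rightarrow> 'a"
  assumes A: "linear A" and M: "op_pd M"
    and orth: "\<And>i j. i \<in> Basis \<Longrightarrow> j \<in> Basis \<Longrightarrow> M (e i) \<bullet> e j = (if i = j then 1 else 0)"
  shows "op_trace (A \<circ> inv M) = (\<Sum>b\<in>Basis. A (e b) \<bullet> e b)"
proof -
  have M': "op_symmetric M" using M unfolding op_pd_def by auto
  note linM = op_symmetricD(1)[OF M']
  have invM: "inv M w = (\<Sum>i\<in>Basis. (w \<bullet> e i) *\<^sub>R e i)" for w
  proof -
    obtain z where z: "inv M w = frame_map e z"
      using bij_frame_map[OF linM orth] by (metis bij_pointE)
    then have w: "w = M (frame_map e z)" by (metis op_pd_inv(2)[OF M])
    have "w \<bullet> e j = z \<bullet> j" if j: "j \<in> Basis" for j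
    proof -
      have "w \<bullet> e j = (\<Sum>i\<in>Basis. (z \<bullet> i) * (M (e i) \<bullet> e j))"
        unfolding w frame_map_def
        by (simp add: linear_sum[OF linM] linear_scale[OF linM] inner_sum_left)
      also have "\<dots> = (\<Sum>i\<in>Basis. if i = j then z \<bullet> j else 0)"
        using j by (intro sum.cong refl) (auto simp: orth)
      finally show ?thesis using j by simp
    qed
    then show ?thesis unfolding z frame_map_def by simp
  qed
  have "op_trace (A \<circ> inv M) = (\<Sum>b\<in>Basis. \<Sum>i\<in>Basis. (b \<bullet> e i) * (A (e i) \<bullet> b))"
    unfolding op_trace_def
    by (simp add: invM linear_sum[OF A] linear_scale[OF A] inner_sum_left)
  also have "\<dots> = (\<Sum>i\<in>Basis. \<Sum>b\<in>Basis. (A (e i) \<bullet> b) * (e i \<bullet> b))"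
    by (subst sum.swap) (simp add: inner_commute mult.commute)
  also have "\<dots> = (\<Sum>i\<in>Basis. A (e i) \<bullet> e i)"
    by (simp add: euclidean_inner[symmetric])
  finally show ?thesis .
qed

text \<open>For \<open>w = R u - sqrt \<beta> u\<close> one has \<open>R w = - sqrt \<beta> w\<close>, which contradicts positivity unless
\<open>w = 0\<close> or \<open>\<beta> = 0\<close>. Since eigenvectors span the space, the square root is unique.\<close>

lemma op_sqrt_unique_on_eigenvector:
  assumes R: "op_psd R" and RT: "R \<circ> R = T" and e: "T u = \<beta> *\<^sub>R u" and \<beta>: "0 \<le> \<beta>"
  shows "R u = sqrt \<beta> *\<^sub>R u"
proof -
  have Rs: "op_symmetric R" and Rp: "\<And>u. 0 \<le> R u \<bullet> u" using R unfolding op_psd_def by auto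
  note linR = op_symmetricD(1)[OF Rs]
  have RR: "R (R u) = \<beta> *\<^sub>R u" using RT e by (metis comp_apply)
  define y where "y = R u - sqrt \<beta> *\<^sub>R u"
  have "R y + sqrt \<beta> *\<^sub>R y = 0"
    unfolding y_def using \<beta> by (simp add: linear_diff[OF linR] linear_scale[OF linR] RR algebra_simps)
  then have "R y \<bullet> y + sqrt \<beta> * (y \<bullet> y) = 0"
    by (metis inner_add_left inner_scaleR_left inner_zero_left)
  moreover have "sqrt \<beta> * (y \<bullet> y) \<ge> 0" using \<beta> by simp
  ultimately have z: "sqrt \<beta> * (y \<bullet> y) = 0" using Rp[of y] by linarith
  show ?thesis
  proof (cases "\<beta> = 0")
    case True
    then have "R u \<bullet> R u = 0" using op_symmetricD(2)[OF Rs, of u "R u"] RR by simp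
    then show ?thesis using True by simp
  next
    case False
    then have "y = 0" using z \<beta> by simp
    then show ?thesis unfolding y_def by simp
  qed
qed

text \<open>The description operator in the definition of the square root is harmless for positive
operators: existence comes from an eigenbasis, uniqueness from the preceding lemma.\<close>

theorem op_sqrt_props:
  fixes T :: "'a::euclidean_space \<Rightarrow> 'a"
  assumes T: "op_psd T"
  shows "op_psd (op_sqrt T)" "op_sqrt T (op_sqrt T u) = T u"
proof -
  have Ts: "op_symmetric T" and Tp: "\<And>u. 0 \<le> T u \<bullet> u" using T unfolding op_psd_def by auto
  obtain e :: "'a \<Rightarrow> 'a" and \<beta> where orth: "\<And>i j. i \<in> Basis \<Longrightarrow> j \<in> Basis \<Longrightarrow> e i \<bullet> e j = (if i = j then 1 else (0::real))"
    and eig: "\<And>i. i \<in> Basis \<Longrightarrow> T (e i) = \<beta> i *\<^sub>R e i"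
    by (rule simultaneous_diagonalization[OF Ts op_pd_id]) blast
  have bij: "bij (frame_map e)"
    by (rule bij_frame_map[where M = "\<lambda>u. u"]) (auto simp: orth op_symmetricD(1)[OF op_symmetric_id])
  have b0: "0 \<le> \<beta> i" if "i \<in> Basis" for i
    using Tp[of "e i"] by (simp add: eig that orth)
  define R where "R = (\<lambda>u. \<Sum>i\<in>Basis. (sqrt (\<beta> i) * (u \<bullet> e i)) *\<^sub>R e i)"
  have linR: "linear R" unfolding R_def
    by (rule linearI) (simp_all add: inner_add_left algebra_simps sum.distrib scaleR_sum_right)
  have Re: "R (e j) = sqrt (\<beta> j) *\<^sub>R e j" if "j \<in> Basis" for j
  proof -
    have "R (e j) = (\<Sum>i\<in>Basis. if i = j then sqrt (\<beta> j) *\<^sub>R e j else 0)"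
      unfolding R_def using that by (intro sum.cong refl) (auto simp: orth)
    then show ?thesis using that by simp
  qed
  have ext: "R1 u = R2 u" if "linear R1" "linear R2" "\<And>j. j \<in> Basis \<Longrightarrow> R1 (e j) = R2 (e j)"
    for R1 R2 :: "'a \<Rightarrow> 'a" and u
  proof -
    obtain z where z: "u = frame_map e z" using bij by (metis bij_pointE)
    show ?thesis unfolding z frame_map_def
      by (simp add: linear_sum[OF that(1)] linear_scale[OF that(1)]
          linear_sum[OF that(2)] linear_scale[OF that(2)] that(3))
  qed
  have R: "op_psd R"
    unfolding op_psd_def op_symmetric_def
  proof (intro conjI allI linR)
    show "R u \<bullet> v = u \<bullet> R v" for u v
      unfolding R_def by (simp add: inner_sum_left inner_sum_right inner_commute mult_ac)
    show "0 \<le> R u \<bullet> u" for u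
    proof -
      have "R u \<bullet> u = (\<Sum>i\<in>Basis. sqrt (\<beta> i) * (u \<bullet> e i)\<^sup>2)"
        unfolding R_def by (simp add: inner_sum_left inner_commute[of u] power2_eq_square mult_ac)
      then show ?thesis using b0 by (simp add: sum_nonneg)
    qed
  qed
  have RR: "R \<circ> R = T"
  proof
    fix u
    show "(R \<circ> R) u = T u"
    proof (rule ext[of "R \<circ> R" T])
      show "linear (R \<circ> R)" by (rule linear_compose[OF linR linR])
      show "linear T" by (rule op_symmetricD(1)[OF Ts])
      show "(R \<circ> R) (e j) = T (e j)" if "j \<in> Basis" for j
        using b0[OF that] by (simp add: Re that linear_scale[OF linR] eig)
    qed
  qed
  have uniq: "R' = R" if R': "op_psd R'" "R' \<circ> R' = T" for R'
  proof
    fix u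
    have "linear R'" using R' unfolding op_psd_def op_symmetric_def by auto
    then show "R' u = R u"
      by (rule ext[of R' R, OF _ linR])
         (simp add: op_sqrt_unique_on_eigenvector[OF R' eig] b0 Re)
  qed
  have "op_sqrt T = R" unfolding op_sqrt_def
  proof (rule the_equality)
    show "op_psd R \<and> R \<circ> R = T" using R RR by blast
    show "R' = R" if "op_psd R' \<and> R' \<circ> R' = T" for R' using uniq that by blast
  qed
  moreover have "R (R u) = T u" using RR by (metis comp_apply)
  ultimately show "op_psd (op_sqrt T)" "op_sqrt T (op_sqrt T u) = T u"
    using R by simp_all
qed

lemma norm_op_sqrt:
  assumes "op_psd T"
  shows "(norm (op_sqrt T u))\<^sup>2 = T u \<bullet> u"
  using op_sqrt_props(1)[OF assms] op_sqrt_props(2)[OF assms, of u] op_symmetricD(2)[of "op_sqrt T" u "op_sqrt T u"]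
  unfolding op_psd_def by (simp add: power2_norm_eq_inner inner_commute)

text \<open>Every eigenvalue occurs in an eigenbasis, so the maximum is taken over a finite nonempty set.\<close>

lemma eig_max_nonneg:
  fixes B :: "'a::euclidean_space \<Rightarrow> 'a"
  assumes B: "op_psd B"
  shows "0 \<le> eig_max B"
proof -
  have Bs: "op_symmetric B" and Bp: "\<And>u. 0 \<le> B u \<bullet> u" using B unfolding op_psd_def by auto
  obtain e :: "'a \<Rightarrow> 'a" and \<beta> where orth: "\<And>i j. i \<in> Basis \<Longrightarrow> j \<in> Basis \<Longrightarrow> e i \<bullet> e j = (if i = j then 1 else (0::real))"
    and eig: "\<And>i. i \<in> Basis \<Longrightarrow> B (e i) = \<beta> i *\<^sub>R e i"
    by (rule simultaneous_diagonalization[OF Bs op_pd_id]) blast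
  let ?E = "{l. \<exists>u. u \<noteq> 0 \<and> B u = l *\<^sub>R u}"
  have bij: "bij (frame_map e)"
    by (rule bij_frame_map[where M = "\<lambda>u. u"]) (auto simp: orth op_symmetricD(1)[OF op_symmetric_id])
  have "?E \<subseteq> \<beta> ` Basis"
  proof
    fix l assume "l \<in> ?E"
    then obtain u where u: "u \<noteq> 0" "B u = l *\<^sub>R u" by blast
    have "\<exists>b\<in>Basis. u \<bullet> e b \<noteq> 0"
    proof (rule ccontr)
      assume "\<not> ?thesis"
      moreover obtain z where "u = frame_map e z" using bij by (metis bij_pointE)
      ultimately have "u \<bullet> u = 0" by (auto simp: frame_map_def inner_sum_right)
      then show False using u by simp
    qed
    then obtain b where b: "b \<in> Basis" "u \<bullet> e b \<noteq> 0" by blast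
    have "l * (u \<bullet> e b) = \<beta> b * (u \<bullet> e b)"
      using op_symmetricD(2)[OF Bs, of u "e b"] by (simp add: u eig[OF b(1)])
    then show "l \<in> \<beta> ` Basis" using b by simp
  qed
  then have fin: "finite ?E" by (rule finite_subset) simp
  obtain b :: 'a where b: "b \<in> Basis" using nonempty_Basis by blast
  have "e b \<noteq> 0" using orth[OF b b] by auto
  then have "\<beta> b \<in> ?E" using eig[OF b] by blast
  then have "\<beta> b \<le> eig_max B" unfolding eig_max_def using fin by (intro Max_ge)
  moreover have "0 \<le> \<beta> b" using Bp[of "e b"] by (simp add: eig b orth)
  ultimately show ?thesis by simp
qed

lemma op_trace_nonneg: "op_psd B \<Longrightarrow> 0 \<le> op_trace B"
  unfolding op_trace_def op_psd_def by (simp add: sum_nonneg)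

lemma op_cauchy_schwarz:
  assumes M: "op_psd M"
  shows "M w \<bullet> u \<le> sqrt (M w \<bullet> w) * sqrt (M u \<bullet> u)"
proof -
  note R = op_sqrt_props[OF M]
  have Rs: "op_symmetric (op_sqrt M)" using R(1) unfolding op_psd_def by auto
  have nrm: "norm (op_sqrt M w) = sqrt (M w \<bullet> w)" for w
    by (simp flip: norm_op_sqrt[OF M])
  have "M w \<bullet> u = op_sqrt M w \<bullet> op_sqrt M u"
    using R(2)[of w] op_symmetricD(2)[OF Rs, of "op_sqrt M w" u] by simp
  also have "\<dots> \<le> norm (op_sqrt M w) * norm (op_sqrt M u)" by (rule norm_cauchy_schwarz)
  finally show ?thesis by (simp only: nrm)
qed

section \<open>Calculus of smooth functions\<close>

text \<open>The derivative as an operator on functions for a fixed direction, so that higher directional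
derivatives are iterates of it.\<close>

definition dirD :: "'a::euclidean_space \<Rightarrow> ('a \<Rightarrow> 'b::euclidean_space) \<Rightarrow> 'a \<Rightarrow> 'b" where
  "dirD u f x = frechet_derivative f (at x) u"

lemma dirD_eq:
  assumes "(f has_derivative f') (at x)"
  shows "dirD u f x = f' u"
  using frechet_derivative_at[OF assms] by (simp add: dirD_def)

lemma C_k_Suc: "C_k (Suc k) f \<longleftrightarrow> (\<forall>x. f differentiable (at x)) \<and> (\<forall>v. C_k k (dirD v f))"
  by (simp add: dirD_def[abs_def])

lemma C_k_Suc_imp: "C_k (Suc k) f \<Longrightarrow> C_k k f"
proof (induction k arbitrary: f)
  case 0
  then show ?case
    by (auto simp: continuous_on_eq_continuous_at intro: differentiable_imp_continuous_within)
next
  case (Suc k)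
  then show ?case by (simp only: C_k_Suc) blast
qed

lemma smooth_differentiable:
  assumes "smooth f" shows "f differentiable (at x)"
  using assms unfolding smooth_def by (metis C_k_Suc)

lemma smooth_dirD:
  assumes "smooth f" shows "smooth (dirD v f)"
  using assms unfolding smooth_def by (metis C_k_Suc)

lemma smooth_has_derivative:
  assumes "smooth f"
  shows "(f has_derivative (\<lambda>u. dirD u f x)) (at x)"
  using smooth_differentiable[OF assms, of x] frechet_derivative_works[of f "at x"]
  unfolding dirD_def by simp

lemma smooth_continuous:
  assumes "smooth f" shows "continuous_on UNIV f"
  using assms unfolding smooth_def by (metis C_k.simps(1))

lemma C_k_const:
  fixes c :: "'b::euclidean_space"
  shows "C_k k (\<lambda>x::'a::euclidean_space. c)"
proof (induction k arbitrary: c)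
  case (Suc k)
  have "dirD v (\<lambda>x::'a. c) = (\<lambda>x. 0)" for v by (rule ext) (subst dirD_eq, auto)
  then show ?case using Suc by (simp only: C_k_Suc differentiable_const) simp
qed simp

lemma C_k_linear:
  assumes "linear L" shows "C_k k L"
proof (cases k)
  case 0
  then show ?thesis using assms by (simp add: linear_conv_bounded_linear linear_continuous_on)
next
  case (Suc j)
  have der: "(L has_derivative L) (at x)" for x
    using assms linear_conv_bounded_linear bounded_linear_imp_has_derivative by blast
  have "dirD v L = (\<lambda>x. L v)" for v using dirD_eq[OF der] by auto
  then show ?thesis unfolding Suc C_k_Suc using der C_k_const by (auto simp: differentiable_def)
qed

lemma C_k_add:
  assumes "C_k k f" "C_k k g" shows "C_k k (\<lambda>x. f x + g x)"
  using assms
proof (induction k arbitrary: f g)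
  case 0
  then show ?case by (simp add: continuous_on_add)
next
  case (Suc k)
  then have d: "\<And>x. f differentiable (at x)" "\<And>x. g differentiable (at x)"
    and c: "\<And>v. C_k k (dirD v f)" "\<And>v. C_k k (dirD v g)" by (auto simp only: C_k_Suc)
  have "dirD v (\<lambda>x. f x + g x) = (\<lambda>x. dirD v f x + dirD v g x)" for v
    using d by (intro ext dirD_eq) (auto simp: dirD_def frechet_derivative_works intro!: has_derivative_add)
  then show ?case using Suc.IH[OF c] d by (simp only: C_k_Suc) simp
qed

lemma C_k_inner:
  fixes f g :: "'a::euclidean_space \<Rightarrow> 'b::euclidean_space"
  assumes "C_k k f" "C_k k g" shows "C_k k (\<lambda>x. f x \<bullet> g x)"
  using assms
proof (induction k arbitrary: f g)
  case 0
  then show ?case by (simp add: continuous_on_inner)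
next
  case (Suc k)
  then have d: "\<And>x. f differentiable (at x)" "\<And>x. g differentiable (at x)"
    and c: "\<And>v. C_k k (dirD v f)" "\<And>v. C_k k (dirD v g)" by (auto simp only: C_k_Suc)
  have der: "((\<lambda>x. f x \<bullet> g x) has_derivative (\<lambda>v. f x \<bullet> dirD v g x + dirD v f x \<bullet> g x)) (at x)" for x
    using d by (auto simp: dirD_def frechet_derivative_works intro!: has_derivative_inner)
  have eq: "dirD v (\<lambda>x. f x \<bullet> g x) = (\<lambda>x. f x \<bullet> dirD v g x + dirD v f x \<bullet> g x)" for v
    by (rule ext) (rule dirD_eq[OF der])
  have "C_k k f" "C_k k g" using Suc.prems by (auto intro: C_k_Suc_imp)
  then have "C_k k (dirD v (\<lambda>x. f x \<bullet> g x))" for v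
    unfolding eq by (intro C_k_add Suc.IH c)
  then show ?case using der by (simp only: C_k_Suc) (auto simp: differentiable_def)
qed

lemma C_k_compose_fst:
  assumes "C_k k f" shows "C_k k (\<lambda>x::'a::euclidean_space \<times> 'c::euclidean_space. f (fst x))"
  using assms
proof (induction k arbitrary: f)
  case 0
  then show ?case by (auto intro!: continuous_on_compose2[of UNIV f] continuous_intros)
next
  case (Suc k)
  then have d: "\<And>x. f differentiable (at x)" and c: "\<And>v. C_k k (dirD v f)" by (auto simp only: C_k_Suc)
  have der: "((\<lambda>x::'a \<times> 'c. f (fst x)) has_derivative (\<lambda>v. dirD (fst v) f (fst x))) (at x)" for x
  proof -
    have "(fst has_derivative fst) (at x)" by (rule has_derivative_fst[OF has_derivative_ident])
    moreover have "(f has_derivative (\<lambda>v. dirD v f (fst x))) (at (fst x))"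
      using d[of "fst x"] by (simp add: frechet_derivative_works dirD_def)
    ultimately show ?thesis by (rule has_derivative_compose)
  qed
  have "dirD v (\<lambda>x::'a \<times> 'c. f (fst x)) = (\<lambda>x. dirD (fst v) f (fst x))" for v
    by (rule ext) (rule dirD_eq[OF der])
  moreover have "(\<lambda>x::'a \<times> 'c. f (fst x)) differentiable (at x)" for x
    using der[of x] unfolding differentiable_def by blast
  ultimately show ?case using Suc.IH[OF c] by (simp only: C_k_Suc) simp
qed

lemma smooth_const: "smooth (\<lambda>x. c)" by (simp add: smooth_def C_k_const)
lemma smooth_linear: "linear L \<Longrightarrow> smooth L" by (simp add: smooth_def C_k_linear)
lemma smooth_add: "smooth f \<Longrightarrow> smooth g \<Longrightarrow> smooth (\<lambda>x. f x + g x)" by (simp add: smooth_def C_k_add)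
lemma smooth_inner: "smooth f \<Longrightarrow> smooth g \<Longrightarrow> smooth (\<lambda>x. f x \<bullet> g x)"
  by (simp add: smooth_def C_k_inner)
lemma smooth_compose_fst: "smooth f \<Longrightarrow> smooth (\<lambda>x. f (fst x))"
  by (simp add: smooth_def C_k_compose_fst)
lemma smooth_cmult: "smooth f \<Longrightarrow> smooth (\<lambda>x. c * f x)" for f :: "'a::euclidean_space \<Rightarrow> real"
  using smooth_inner[OF smooth_const[of c], of f] by simp
lemma smooth_diff: "smooth f \<Longrightarrow> smooth g \<Longrightarrow> smooth (\<lambda>x. f x - g x)"
proof -
  assume f: "smooth f" and g: "smooth g"
  have "C_k k (\<lambda>x. - g x)" if "C_k k g" for k and g :: "'a \<Rightarrow> 'b"
    using that
  proof (induction k arbitrary: g)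
    case 0
    then show ?case by (simp add: continuous_on_minus)
  next
    case (Suc k)
    then have d: "\<And>x. g differentiable (at x)" and c: "\<And>v. C_k k (dirD v g)" by (auto simp only: C_k_Suc)
    have "dirD v (\<lambda>x. - g x) = (\<lambda>x. - dirD v g x)" for v
      using d by (intro ext dirD_eq) (auto simp: dirD_def frechet_derivative_works intro!: has_derivative_minus)
    then show ?case using Suc.IH[OF c] d by (simp only: C_k_Suc) simp
  qed
  then have "smooth (\<lambda>x. - g x)" using g by (simp add: smooth_def)
  from smooth_add[OF f this] show ?thesis by simp
qed

lemma smooth_line_derivative:
  fixes f :: "'a::euclidean_space \<Rightarrow> real"
  assumes "smooth f"
  shows "DERIV (\<lambda>t. f (x + t *\<^sub>R u)) t :> dirD u f (x + t *\<^sub>R u)"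
proof -
  have "((\<lambda>t. f (x + t *\<^sub>R u)) has_derivative (\<lambda>s. dirD (s *\<^sub>R u) f (x + t *\<^sub>R u))) (at t)"
    by (rule has_derivative_compose[OF _ smooth_has_derivative[OF assms]])
       (auto intro!: derivative_eq_intros)
  moreover have "dirD (s *\<^sub>R u) f y = s * dirD u f y" for s y
    using has_derivative_linear[OF smooth_has_derivative[OF assms, of y]] linear_scale by fastforce
  ultimately show ?thesis
    by (simp add: has_field_derivative_def mult_commute_abs)
qed

lemma smooth_funpow_dirD: "smooth f \<Longrightarrow> smooth ((dirD u ^^ k) f)"
  by (induction k) (auto intro: smooth_dirD)

text \<open>Differentiating along a line and restricting to the line commute.\<close>

lemma dir_deriv_eq_funpow:
  fixes f :: "'a::euclidean_space \<Rightarrow> real"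
  assumes "smooth f"
  shows "dir_deriv k u f x = (dirD u ^^ k) f x"
proof -
  have "((\<lambda>h t. vector_derivative h (at t)) ^^ k) (\<lambda>t::real. f (x + t *\<^sub>R u)) =
      (\<lambda>t. (dirD u ^^ k) f (x + t *\<^sub>R u))"
    using assms
  proof (induction k)
    case (Suc k)
    show ?case
      unfolding funpow.simps comp_apply Suc.IH[OF Suc.prems]
      using smooth_line_derivative[OF smooth_funpow_dirD[OF Suc.prems]]
      by (auto simp: fun_eq_iff has_real_derivative_iff_has_vector_derivative
          intro!: vector_derivative_at)
  qed simp
  then show ?thesis by (simp add: dir_deriv_def)
qed

lemma gradient_dirD: "gradient f = (\<lambda>x. \<Sum>b\<in>Basis. dirD b f x *\<^sub>R b)"
  by (simp add: gradient_def dirD_def fun_eq_iff)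

lemma hessian_has_derivative:
  fixes f :: "'a::euclidean_space \<Rightarrow> real"
  assumes "smooth f"
  shows "(gradient f has_derivative (\<lambda>u. \<Sum>b\<in>Basis. dirD u (dirD b f) x *\<^sub>R b)) (at x)"
  unfolding gradient_dirD
  by (intro has_derivative_sum has_derivative_scaleR_left smooth_has_derivative smooth_dirD assms)

lemma hessian_eq:
  fixes f :: "'a::euclidean_space \<Rightarrow> real"
  assumes "smooth f"
  shows "hessian f x u = (\<Sum>b\<in>Basis. dirD u (dirD b f) x *\<^sub>R b)"
  unfolding hessian_def by (simp flip: frechet_derivative_at[OF hessian_has_derivative[OF assms, of x]])

lemma linear_hessian:
  fixes f :: "'a::euclidean_space \<Rightarrow> real"
  assumes "smooth f"
  shows "linear (hessian f x)"
  using has_derivative_linear[OF hessian_has_derivative[OF assms, of x]] hessian_eq[OF assms, of x]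
  by presburger

lemma linear_dirD:
  assumes "smooth f" shows "linear (\<lambda>u. dirD u f x)"
  by (rule has_derivative_linear[OF smooth_has_derivative[OF assms]])

lemma dirD_expand:
  fixes f :: "'a::euclidean_space \<Rightarrow> real"
  assumes "smooth f"
  shows "dirD u f = (\<lambda>x. \<Sum>b\<in>Basis. (u \<bullet> b) * dirD b f x)"
proof
  fix x
  have "dirD u f x = dirD (\<Sum>b\<in>Basis. (u \<bullet> b) *\<^sub>R b) f x" by (simp add: euclidean_representation)
  also have "\<dots> = (\<Sum>b\<in>Basis. (u \<bullet> b) * dirD b f x)"
    by (simp add: linear_sum[OF linear_dirD[OF assms, of x]] linear_scale[OF linear_dirD[OF assms, of x]])
  finally show "dirD u f x = (\<Sum>b\<in>Basis. (u \<bullet> b) * dirD b f x)" .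
qed

lemma hessian_form:
  fixes f :: "'a::euclidean_space \<Rightarrow> real"
  assumes sm: "smooth f"
  shows "hessian f x u \<bullet> w = dirD u (dirD w f) x"
proof -
  have "((\<lambda>x. \<Sum>b\<in>Basis. (w \<bullet> b) * dirD b f x) has_derivative
      (\<lambda>u. \<Sum>b\<in>Basis. (w \<bullet> b) * dirD u (dirD b f) x)) (at x)"
    by (intro has_derivative_sum has_derivative_mult_right smooth_has_derivative smooth_dirD sm)
  then have "dirD u (dirD w f) x = (\<Sum>b\<in>Basis. (w \<bullet> b) * dirD u (dirD b f) x)"
    unfolding dirD_expand[OF sm, of w] by (rule dirD_eq)
  then show ?thesis
    by (simp add: hessian_eq[OF sm] inner_sum_left mult.commute inner_commute[of w])
qed

text \<open>Two applications of the mean value theorem. The left-hand side is symmetric in \<open>u\<close> and \<open>w\<close>,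
which is what makes mixed derivatives commute.\<close>

lemma mixed_difference:
  fixes f :: "'a::euclidean_space \<Rightarrow> real"
  assumes sm: "smooth f" and s: "0 < s"
  obtains a b where "0 < a" "a < s" "0 < b" "b < s"
    "f (x + s *\<^sub>R u + s *\<^sub>R w) - f (x + s *\<^sub>R u) - f (x + s *\<^sub>R w) + f x
      = s\<^sup>2 * dirD w (dirD u f) (x + a *\<^sub>R u + b *\<^sub>R w)"
proof -
  define g where "g t = f ((x + s *\<^sub>R w) + t *\<^sub>R u) - f (x + t *\<^sub>R u)" for t
  have dg: "DERIV g t :> dirD u f ((x + s *\<^sub>R w) + t *\<^sub>R u) - dirD u f (x + t *\<^sub>R u)" for t
    unfolding g_def by (intro DERIV_diff smooth_line_derivative sm)
  obtain a where a: "0 < a" "a < s"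
    "g s - g 0 = (s - 0) * (dirD u f ((x + s *\<^sub>R w) + a *\<^sub>R u) - dirD u f (x + a *\<^sub>R u))"
    using MVT2[OF s dg] by blast
  define h where "h t = dirD u f ((x + a *\<^sub>R u) + t *\<^sub>R w)" for t
  have dh: "DERIV h t :> dirD w (dirD u f) ((x + a *\<^sub>R u) + t *\<^sub>R w)" for t
    unfolding h_def by (intro smooth_line_derivative smooth_dirD sm)
  obtain b where b: "0 < b" "b < s" "h s - h 0 = (s - 0) * dirD w (dirD u f) ((x + a *\<^sub>R u) + b *\<^sub>R w)"
    using MVT2[OF s dh] by blast
  have "h s = dirD u f ((x + s *\<^sub>R w) + a *\<^sub>R u)" "h 0 = dirD u f (x + a *\<^sub>R u)"
    by (simp_all add: h_def algebra_simps)
  then have "g s - g 0 = s * (s * dirD w (dirD u f) ((x + a *\<^sub>R u) + b *\<^sub>R w))" using a(3) b(3) by simp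
  moreover have "g s - g 0 = f (x + s *\<^sub>R u + s *\<^sub>R w) - f (x + s *\<^sub>R u) - f (x + s *\<^sub>R w) + f x"
    by (simp add: g_def algebra_simps)
  ultimately show ?thesis using that[OF a(1,2) b(1,2)] by (simp add: power2_eq_square)
qed

text \<open>Both mixed derivatives are limits of the same second difference.\<close>

theorem dirD_commute:
  fixes f :: "'a::euclidean_space \<Rightarrow> real"
  assumes sm: "smooth f"
  shows "dirD u (dirD w f) x = dirD w (dirD u f) x"
proof (rule ccontr)
  assume ne: "dirD u (dirD w f) x \<noteq> dirD w (dirD u f) x"
  define e where "e = \<bar>dirD u (dirD w f) x - dirD w (dirD u f) x\<bar> / 2"
  have e: "e > 0" using ne by (simp add: e_def)
  have c: "continuous_on UNIV (dirD u (dirD w f))" "continuous_on UNIV (dirD w (dirD u f))"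
    by (intro smooth_continuous smooth_dirD sm)+
  obtain d1 where d1: "d1 > 0" "\<And>y. dist y x < d1 \<Longrightarrow> dist (dirD u (dirD w f) y) (dirD u (dirD w f) x) < e"
    using c(1) e unfolding continuous_on_iff by (metis UNIV_I)
  obtain d2 where d2: "d2 > 0" "\<And>y. dist y x < d2 \<Longrightarrow> dist (dirD w (dirD u f) y) (dirD w (dirD u f) x) < e"
    using c(2) e unfolding continuous_on_iff by (metis UNIV_I)
  define s where "s = min d1 d2 / (norm u + norm w + 1)"
  have n1: "0 < norm u + norm w + 1" using norm_ge_zero[of u] norm_ge_zero[of w] by linarith
  have s: "0 < s" using d1 d2 n1 by (simp add: s_def)
  have near: "dist (x + a *\<^sub>R p + b *\<^sub>R q) x < min d1 d2"
    if "0 < a" "a < s" "0 < b" "b < s" "norm p + norm q = norm u + norm w" for a b p q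
  proof -
    have "dist (x + a *\<^sub>R p + b *\<^sub>R q) x = norm (a *\<^sub>R p + b *\<^sub>R q)" by (simp add: dist_norm)
    also have "\<dots> \<le> norm (a *\<^sub>R p) + norm (b *\<^sub>R q)" by (rule norm_triangle_ineq)
    also have "\<dots> \<le> s * norm p + s * norm q"
      using that by (intro add_mono) (auto intro!: mult_right_mono)
    also have "\<dots> = s * (norm u + norm w)" using that(5) by (simp flip: distrib_left)
    also have "\<dots> < s * (norm u + norm w + 1)" using s by (intro mult_strict_left_mono) auto
    also have "\<dots> = min d1 d2" using n1 by (simp add: s_def)
    finally show ?thesis .
  qed
  obtain a b where 1: "0 < a" "a < s" "0 < b" "b < s"
    "f (x + s *\<^sub>R u + s *\<^sub>R w) - f (x + s *\<^sub>R u) - f (x + s *\<^sub>R w) + f x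
      = s\<^sup>2 * dirD w (dirD u f) (x + a *\<^sub>R u + b *\<^sub>R w)"
    by (rule mixed_difference[OF sm s, of x u w]) blast
  obtain a' b' where 2: "0 < a'" "a' < s" "0 < b'" "b' < s"
    "f (x + s *\<^sub>R w + s *\<^sub>R u) - f (x + s *\<^sub>R w) - f (x + s *\<^sub>R u) + f x
      = s\<^sup>2 * dirD u (dirD w f) (x + a' *\<^sub>R w + b' *\<^sub>R u)"
    by (rule mixed_difference[OF sm s, of x w u]) blast
  have "s\<^sup>2 * dirD w (dirD u f) (x + a *\<^sub>R u + b *\<^sub>R w) = s\<^sup>2 * dirD u (dirD w f) (x + a' *\<^sub>R w + b' *\<^sub>R u)"
    unfolding 1(5)[symmetric] 2(5)[symmetric] by (simp add: algebra_simps)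
  then have eq: "dirD w (dirD u f) (x + a *\<^sub>R u + b *\<^sub>R w) = dirD u (dirD w f) (x + a' *\<^sub>R w + b' *\<^sub>R u)"
    using s by simp
  have "dist (dirD w (dirD u f) (x + a *\<^sub>R u + b *\<^sub>R w)) (dirD w (dirD u f) x) < e"
    using near[OF 1(1-4)] by (intro d2(2)) simp
  moreover have "dist (dirD u (dirD w f) (x + a' *\<^sub>R w + b' *\<^sub>R u)) (dirD u (dirD w f) x) < e"
    using near[OF 2(1-4)] by (intro d1(2)) simp
  moreover have "\<bar>dirD u (dirD w f) x - dirD w (dirD u f) x\<bar> = 2 * e" by (simp add: e_def)
  ultimately show False unfolding eq dist_real_def by linarith
qed

lemma hessian_symmetric:
  fixes f :: "'a::euclidean_space \<Rightarrow> real"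
  assumes sm: "smooth f"
  shows "op_symmetric (hessian f x)"
  unfolding op_symmetric_def inner_commute[of _ "hessian f x _"] hessian_form[OF sm]
  using linear_hessian[OF sm] dirD_commute[OF sm] by blast

lemma interior_min_conditions:
  fixes f :: "'a::euclidean_space \<Rightarrow> real"
  assumes sm: "smooth f" and op: "open W" and v: "v \<in> W" and mn: "\<And>w. w \<in> W \<Longrightarrow> f v \<le> f w"
  shows "dirD u f v = 0" and "0 \<le> dirD u (dirD u f) v"
proof -
  obtain e where e: "e > 0" "ball v e \<subseteq> W" using op v by (meson openE)
  define d where "d = e / (norm u + 1)"
  have n1: "0 < norm u + 1" using norm_ge_zero[of u] by linarith
  have d: "0 < d" using e n1 by (simp add: d_def)
  have loc: "f v \<le> f (v + t *\<^sub>R u)" if "\<bar>t\<bar> < d" for t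
  proof -
    have "\<bar>t\<bar> * (norm u + 1) < e" using that n1 by (simp add: d_def pos_less_divide_eq)
    moreover have "\<bar>t\<bar> * norm u \<le> \<bar>t\<bar> * (norm u + 1)" by (intro mult_left_mono) auto
    ultimately have "v + t *\<^sub>R u \<in> ball v e" by (simp add: dist_norm)
    then show ?thesis using e mn by blast
  qed
  have D1: "DERIV (\<lambda>t. f (v + t *\<^sub>R u)) t :> dirD u f (v + t *\<^sub>R u)" for t
    by (rule smooth_line_derivative[OF sm])
  have D2: "DERIV (\<lambda>t. dirD u f (v + t *\<^sub>R u)) t :> dirD u (dirD u f) (v + t *\<^sub>R u)" for t
    by (rule smooth_line_derivative[OF smooth_dirD[OF sm]])
  have "dirD u f (v + 0 *\<^sub>R u) = 0"
    by (rule DERIV_local_min[OF D1 d]) (use loc in auto)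
  then show z: "dirD u f v = 0" by simp
  show "0 \<le> dirD u (dirD u f) v"
  proof (rule ccontr)
    assume "\<not> 0 \<le> dirD u (dirD u f) v"
    then obtain d' where d': "d' > 0" "\<And>h. 0 < h \<Longrightarrow> h < d' \<Longrightarrow> dirD u f (v + (0 + h) *\<^sub>R u) < dirD u f (v + 0 *\<^sub>R u)"
      using DERIV_neg_dec_right[OF D2[of 0]] by auto
    define h where "h = min d d' / 2"
    have h: "0 < h" "h < d" "h < d'" using d d' by (auto simp: h_def)
    obtain \<xi> where \<xi>: "0 < \<xi>" "\<xi> < h" "f (v + h *\<^sub>R u) - f (v + 0 *\<^sub>R u) = (h - 0) * dirD u f (v + \<xi> *\<^sub>R u)"
      using MVT2[OF h(1) D1] by blast
    have "dirD u f (v + \<xi> *\<^sub>R u) < 0" using d'(2)[of \<xi>] \<xi> h z by simp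
    then have "h * dirD u f (v + \<xi> *\<^sub>R u) < 0" using h by (simp add: mult_pos_neg)
    then have "f (v + h *\<^sub>R u) < f v" using \<xi>(3) by simp
    then show False using loc[of h] h by simp
  qed
qed

lemma hessian_add:
  fixes f g :: "'a::euclidean_space \<Rightarrow> real"
  assumes "smooth f" "smooth g"
  shows "hessian (\<lambda>x. f x + g x) x u = hessian f x u + hessian g x u"
proof -
  have 1: "dirD v (\<lambda>x. f x + g x) = (\<lambda>x. dirD v f x + dirD v g x)" if "smooth f" "smooth g"
    for v and f g :: "'a \<Rightarrow> real"
    by (rule ext, rule dirD_eq) (intro has_derivative_add smooth_has_derivative that)
  show ?thesis
    by (simp add: hessian_eq smooth_add assms 1 smooth_dirD scaleR_add_left sum.distrib)
qed

lemma hessian_square: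
  fixes K :: "'a::euclidean_space \<Rightarrow> 'b::euclidean_space"
  assumes K: "linear K"
  shows "smooth (\<lambda>x. c * (norm (K x - d))\<^sup>2)"
    and "hessian (\<lambda>x. c * (norm (K x - d))\<^sup>2) x u \<bullet> w = 2 * c * (K u \<bullet> K w)"
proof -
  let ?f = "\<lambda>x. c * (norm (K x - d))\<^sup>2"
  show sm: "smooth ?f" unfolding power2_norm_eq_inner
    by (intro smooth_cmult smooth_inner smooth_diff smooth_const smooth_linear K)
  have K': "(K has_derivative K) (at x)" for x
    using K linear_conv_bounded_linear bounded_linear_imp_has_derivative by blast
  have "dirD v ?f = (\<lambda>x. 2 * c * ((K x - d) \<bullet> K v))" for v
    unfolding power2_norm_eq_inner
    by (rule ext, rule dirD_eq) (auto intro!: derivative_eq_intros K' simp: inner_commute algebra_simps)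
  moreover have "dirD u (\<lambda>x. 2 * c * ((K x - d) \<bullet> K v)) x = 2 * c * (K u \<bullet> K v)" for v
    by (rule dirD_eq) (auto intro!: derivative_eq_intros K')
  ultimately have h: "hessian ?f x u = (\<Sum>b\<in>Basis. (2 * c * (K u \<bullet> K b)) *\<^sub>R b)"
    by (simp add: hessian_eq[OF sm])
  have "K u \<bullet> K w = K u \<bullet> K (\<Sum>b\<in>Basis. (w \<bullet> b) *\<^sub>R b)" by (simp add: euclidean_representation)
  also have "\<dots> = (\<Sum>b\<in>Basis. (w \<bullet> b) * (K u \<bullet> K b))"
    by (simp add: linear_sum[OF K] linear_scale[OF K] inner_sum_right)
  finally show "hessian ?f x u \<bullet> w = 2 * c * (K u \<bullet> K w)"
    by (simp add: h inner_sum_left sum_distrib_left inner_commute[of w] mult_ac)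
qed

text \<open>The form in which the information operators are defined: minus the Hessian of minus the cost.\<close>

lemma hessian_const_minus:
  fixes f :: "'a::euclidean_space \<Rightarrow> real"
  assumes f: "smooth f"
  shows "- hessian (\<lambda>x. - f x - k) x u = hessian f x u"
proof -
  have sm: "smooth (\<lambda>x. - f x - k)" using smooth_diff[OF smooth_cmult[OF f, of "-1"] smooth_const[of k]] by simp
  have "hessian (\<lambda>x. (- f x - k) + f x) x u = hessian (\<lambda>x. - f x - k) x u + hessian f x u"
    by (rule hessian_add[OF sm f])
  moreover have "hessian (\<lambda>x. (- f x - k) + f x) x u = 0"
  proof -
    have 1: "dirD w (\<lambda>x::'a. c) = (\<lambda>x. 0)" for w and c :: real by (rule ext) (rule dirD_eq, simp)
    show ?thesis by (simp add: hessian_eq[OF smooth_const] 1)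
  qed
  ultimately show ?thesis by (simp add: eq_neg_iff_add_eq_0 flip: neg_eq_iff_add_eq_0)
qed

text \<open>A function that grows slowly as long as it stays below \<open>2 R\<close> cannot reach \<open>2 R\<close>: apply the mean
value theorem up to the first time at which it would.\<close>

lemma trapped_growth:
  fixes a a' :: "real \<Rightarrow> real"
  assumes der: "\<And>t. DERIV a t :> a' t" and a0: "a 0 \<le> R" and R: "0 < R" and D: "0 \<le> D" "3 * D < R"
    and bound: "\<And>t. 0 \<le> t \<Longrightarrow> t \<le> 1 \<Longrightarrow> a t \<le> 2 * R \<Longrightarrow> \<bar>a' t\<bar> \<le> 3 * D"
    and t: "0 \<le> t" "t \<le> 1"
  shows "a t < 2 * R"
proof (rule ccontr)
  assume "\<not> a t < 2 * R"
  then have tK: "t \<in> {0..1} \<inter> a -` {2 * R..}" using t by auto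
  have cont: "continuous_on {0..1} a" using der DERIV_isCont continuous_at_imp_continuous_on by blast
  have "closed ({0..1} \<inter> a -` {2 * R..})" by (intro continuous_closed_preimage cont) auto
  moreover have "bounded ({0..1} \<inter> a -` {2 * R..})" by (rule bounded_subset[OF bounded_closed_interval]) auto
  ultimately have "compact ({0..1} \<inter> a -` {2 * R..})" by (simp add: compact_eq_bounded_closed)
  then obtain s where s: "s \<in> {0..1} \<inter> a -` {2 * R..}" "\<And>y. y \<in> {0..1} \<inter> a -` {2 * R..} \<Longrightarrow> s \<le> y"
    using compact_attains_inf[of "{0..1} \<inter> a -` {2 * R..}"] tK by blast
  have s0: "s > 0" using s(1) a0 R by (cases "s = 0") auto
  obtain z where z: "0 < z" "z < s" "a s - a 0 = (s - 0) * a' z" using MVT2[OF s0 der] by blast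
  have "a z < 2 * R" using s(2)[of z] z s(1) by force
  then have "\<bar>a' z\<bar> \<le> 3 * D" using bound[of z] z s(1) by auto
  moreover have "s * \<bar>a' z\<bar> \<le> 1 * \<bar>a' z\<bar>" using s(1) by (intro mult_right_mono) auto
  moreover have "s * a' z \<le> s * \<bar>a' z\<bar>" using s0 by simp
  ultimately have "s * a' z \<le> 1 * (3 * D)" by linarith
  then show False using z(3) s(1) a0 D by auto
qed

text \<open>A bound for a form of degree \<open>k\<close> on the ball of radius \<open>r\<close>, carried over to a point where the
quadratic form is at most \<open>2 r\<^sup>2\<close>. The factors 3 and 4 bound \<open>2\<^bsup>k/2\<^esup>\<close>.\<close>

lemma homogeneous_bound:
  fixes c :: "real"
  assumes q: "0 \<le> q" "q \<le> 2 * r\<^sup>2" and r: "0 < r"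
    and hom: "\<And>s::real. s\<^sup>2 * q \<le> r\<^sup>2 \<Longrightarrow> \<bar>s ^ k * c\<bar> \<le> D" and k: "k = 3 \<or> k = (4::nat)"
  shows "\<bar>c\<bar> \<le> (if k = 3 then 3 else 4) * D"
proof -
  \<comment> \<open>shrinking the direction by \<open>1 / sqrt 2\<close> halves the quadratic form\<close>
  define s where "s = 1 / sqrt 2"
  have s2: "s\<^sup>2 = 1 / 2" unfolding s_def by (simp add: power_divide)
  have s: "s > 0" unfolding s_def by simp
  have b: "\<bar>s ^ k * c\<bar> \<le> D" using q by (intro hom) (simp add: s2)
  then have D: "0 \<le> D" by linarith
  have "s ^ 4 = (s\<^sup>2)\<^sup>2" by (simp flip: power_mult)
  then have s4: "s ^ 4 = 1 / 4" by (simp add: s2 power_divide)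
  have "3 * s ^ 3 \<ge> 1"
  proof -
    have "(3 * s ^ 3)\<^sup>2 = 9 * (s\<^sup>2) ^ 3" by (simp add: power_mult_distrib flip: power_mult)
    then have "(3 * s ^ 3)\<^sup>2 \<ge> 1\<^sup>2" by (simp add: s2 power_divide)
    then show ?thesis using s power2_le_imp_le[of 1 "3 * s ^ 3"] by simp
  qed
  then have "1 * \<bar>c\<bar> \<le> (if k = 3 then 3 else 4) * s ^ k * \<bar>c\<bar>"
    using k s4 by (intro mult_right_mono) auto
  also have "\<dots> = (if k = 3 then 3 else 4) * \<bar>s ^ k * c\<bar>" using s by (simp add: abs_mult)
  also have "\<dots> \<le> (if k = 3 then 3 else 4) * D" using b by auto
  finally show ?thesis by simp
qed

lemma funpow_dirD_scale:
  fixes f :: "'a::euclidean_space \<Rightarrow> real"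
  assumes "smooth f"
  shows "(dirD (s *\<^sub>R u) ^^ k) f = (\<lambda>x. s ^ k * (dirD u ^^ k) f x)"
proof (induction k)
  case (Suc k)
  let ?g = "(dirD u ^^ k) f"
  have sm: "smooth ?g" by (rule smooth_funpow_dirD[OF assms])
  show ?case
  proof
    fix x
    have "((\<lambda>x. s ^ k * ?g x) has_derivative (\<lambda>w. s ^ k * dirD w ?g x)) (at x)"
      by (intro has_derivative_mult_right smooth_has_derivative sm)
    then have "dirD (s *\<^sub>R u) (\<lambda>x. s ^ k * ?g x) x = s ^ k * dirD (s *\<^sub>R u) ?g x" by (rule dirD_eq)
    also have "dirD (s *\<^sub>R u) ?g x = s * dirD u ?g x"
      using linear_scale[OF linear_dirD[OF sm, of x]] by simp
    finally show "(dirD (s *\<^sub>R u) ^^ Suc k) f x = s ^ Suc k * (dirD u ^^ Suc k) f x"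
      by (simp add: Suc.IH)
  qed
qed simp

text \<open>The bounds \<open>D3\<close> and \<open>D4\<close> hold in a metric \<open>F \<upsilon>\<close> that moves with the point, whereas Taylor's
formula at \<open>v\<close> needs them along a whole segment for one direction \<open>u\<close>. As \<open>F \<upsilon> u \<bullet> u\<close> differs
from the second derivative of \<open>\<Phi>\<close> by a constant, its speed along the segment is the third
derivative, which is controlled by \<open>D3\<close>; so it is trapped below \<open>2 r\<^sup>2\<close>. In the sum of the remainders at \<open>u\<close> and \<open>- u\<close> the cubic terms cancel.\<close>

theorem taylor_remainders:
  fixes \<Phi> :: "'a::euclidean_space \<Rightarrow> real" and F :: "'a \<Rightarrow> 'a \<Rightarrow> 'a"
  assumes sm: "smooth \<Phi>"
    and F: "\<And>\<upsilon> u. F \<upsilon> u \<bullet> u = dirD u (dirD u \<Phi>) \<upsilon> + s u"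
    and lin: "\<And>\<upsilon>. linear (F \<upsilon>)"
    and pos: "\<And>\<upsilon> u. \<upsilon> \<in> V \<Longrightarrow> 0 \<le> F \<upsilon> u \<bullet> u"
    and sub: "\<And>u. F v u \<bullet> u \<le> r\<^sup>2 \<Longrightarrow> v + u \<in> V"
    and r: "0 < r" and small: "3 * D3 < r\<^sup>2"
    and d3: "\<And>\<upsilon> u. \<upsilon> \<in> V \<Longrightarrow> F \<upsilon> u \<bullet> u \<le> r\<^sup>2 \<Longrightarrow> \<bar>(dirD u ^^ 3) \<Phi> \<upsilon>\<bar> \<le> D3"
    and d4: "\<And>\<upsilon> u. \<upsilon> \<in> V \<Longrightarrow> F \<upsilon> u \<bullet> u \<le> r\<^sup>2 \<Longrightarrow> \<bar>(dirD u ^^ 4) \<Phi> \<upsilon>\<bar> \<le> D4"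
  defines "\<And>u. Rem u \<equiv> \<Phi> (v + u) - \<Phi> v - dirD u \<Phi> v - dirD u (dirD u \<Phi>) v / 2"
  assumes u: "F v u \<bullet> u \<le> r\<^sup>2"
  shows "\<bar>Rem u\<bar> \<le> D3 / 2" and "\<bar>Rem u + Rem (- u)\<bar> \<le> D4 / 3"
proof -
  have bounds: "\<bar>(dirD w ^^ 3) \<Phi> (v + t *\<^sub>R w)\<bar> \<le> 3 * D3 \<and> \<bar>(dirD w ^^ 4) \<Phi> (v + t *\<^sub>R w)\<bar> \<le> 4 * D4"
    if w: "F v w \<bullet> w \<le> r\<^sup>2" and t: "0 \<le> t" "t \<le> 1" for w t
  proof -
    have hom: "F \<upsilon> (c *\<^sub>R w) \<bullet> (c *\<^sub>R w) = c\<^sup>2 * (F \<upsilon> w \<bullet> w)" for \<upsilon> c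
      using linear_scale[OF lin[of \<upsilon>]] by (simp add: power2_eq_square)
    have v: "v \<in> V" using sub[of 0] linear_0[OF lin[of v]] r by simp
    have V: "v + t *\<^sub>R w \<in> V" if "0 \<le> t" "t \<le> 1" for t
    proof (rule sub)
      have "t\<^sup>2 * (F v w \<bullet> w) \<le> 1 * (F v w \<bullet> w)"
        using that pos[OF v, of w] by (intro mult_right_mono) (auto simp: power_le_one)
      then show "F v (t *\<^sub>R w) \<bullet> (t *\<^sub>R w) \<le> r\<^sup>2" using w hom[of v t] by simp
    qed
    have D3: "0 \<le> D3" using d3[OF v, of 0] linear_0[OF lin[of v]] r by force
    have b: "\<bar>(dirD w ^^ k) \<Phi> (v + t *\<^sub>R w)\<bar> \<le> (if k = 3 then 3 else 4) * D"
      if t: "0 \<le> t" "t \<le> 1" and q: "F (v + t *\<^sub>R w) w \<bullet> w \<le> 2 * r\<^sup>2" and k: "k = 3 \<and> D = D3 \<or> k = 4 \<and> D = D4"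
      for t k D
    proof (rule homogeneous_bound[OF pos[OF V[OF t]] q r])
      show "k = 3 \<or> k = 4" using k by auto
      fix c :: real assume "c\<^sup>2 * (F (v + t *\<^sub>R w) w \<bullet> w) \<le> r\<^sup>2"
      then have "F (v + t *\<^sub>R w) (c *\<^sub>R w) \<bullet> (c *\<^sub>R w) \<le> r\<^sup>2" by (simp only: hom)
      from d3[OF V[OF t] this] d4[OF V[OF t] this] k
      show "\<bar>c ^ k * (dirD w ^^ k) \<Phi> (v + t *\<^sub>R w)\<bar> \<le> D"
        by (auto simp: funpow_dirD_scale[OF sm])
    qed
    have "F (v + t *\<^sub>R w) w \<bullet> w < 2 * r\<^sup>2"
    proof (rule trapped_growth[OF _ _ _ D3 small _ t, where a' = "\<lambda>t. (dirD w ^^ 3) \<Phi> (v + t *\<^sub>R w)"])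
      show "DERIV (\<lambda>t. F (v + t *\<^sub>R w) w \<bullet> w) t :> (dirD w ^^ 3) \<Phi> (v + t *\<^sub>R w)" for t
        unfolding F using smooth_line_derivative[OF smooth_funpow_dirD[OF sm, of 2 w], of v w t]
        by (auto simp: numeral_3_eq_3 numeral_2_eq_2 intro!: derivative_eq_intros)
      show "\<bar>(dirD w ^^ 3) \<Phi> (v + t *\<^sub>R w)\<bar> \<le> 3 * D3"
        if "0 \<le> t" "t \<le> 1" "F (v + t *\<^sub>R w) w \<bullet> w \<le> 2 * r\<^sup>2" for t
        using b[OF that, of 3 D3] by simp
    qed (use w r in auto)
    then show ?thesis using b[OF t, of 3 D3] b[OF t, of 4 D4] by simp
  qed
  have um: "F v (- u) \<bullet> (- u) \<le> r\<^sup>2" using u linear_neg[OF lin[of v]] by simp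
  have taylor: "\<exists>t. 0 \<le> t \<and> t \<le> 1 \<and> \<Phi> (v + w) =
      (\<Sum>k<n. (dirD w ^^ k) \<Phi> v / fact k) + (dirD w ^^ n) \<Phi> (v + t *\<^sub>R w) / fact n"
    if "n > 0" for w n
  proof -
    have "\<exists>t. 0 < t \<and> t < 1 \<and> \<Phi> (v + 1 *\<^sub>R w) =
      (\<Sum>k<n. (\<lambda>k t. (dirD w ^^ k) \<Phi> (v + t *\<^sub>R w)) k 0 / fact k * 1 ^ k)
       + (\<lambda>k t. (dirD w ^^ k) \<Phi> (v + t *\<^sub>R w)) n t / fact n * 1 ^ n"
      by (rule Maclaurin[OF _ that]) (auto intro: smooth_line_derivative smooth_funpow_dirD sm)
    then show ?thesis by (auto intro: less_imp_le)
  qed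
  obtain t where t: "0 \<le> t" "t \<le> 1" "\<Phi> (v + u) =
      (\<Sum>k<3. (dirD u ^^ k) \<Phi> v / fact k) + (dirD u ^^ 3) \<Phi> (v + t *\<^sub>R u) / fact 3"
    using taylor[of 3 u] by auto
  have "Rem u = (dirD u ^^ 3) \<Phi> (v + t *\<^sub>R u) / 6"
    unfolding Rem_def t(3) by (simp add: numeral_3_eq_3 fact_numeral lessThan_Suc)
  then show "\<bar>Rem u\<bar> \<le> D3 / 2" using bounds[OF u t(1,2)] by linarith
  have four: "\<exists>t. 0 \<le> t \<and> t \<le> 1 \<and> Rem w = (dirD w ^^ 3) \<Phi> v / 6 + (dirD w ^^ 4) \<Phi> (v + t *\<^sub>R w) / 24" for w
  proof -
    obtain t where t: "0 \<le> t" "t \<le> 1" "\<Phi> (v + w) =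
        (\<Sum>k<4. (dirD w ^^ k) \<Phi> v / fact k) + (dirD w ^^ 4) \<Phi> (v + t *\<^sub>R w) / fact 4"
      using taylor[of 4 w] by auto
    have "{..<4::nat} = {0, 1, 2, 3}" by auto
    then have "Rem w = (dirD w ^^ 3) \<Phi> v / 6 + (dirD w ^^ 4) \<Phi> (v + t *\<^sub>R w) / 24"
      unfolding Rem_def t(3) by (simp add: numeral_2_eq_2 fact_numeral)
    then show ?thesis using t by blast
  qed
  obtain t1 where t1: "0 \<le> t1" "t1 \<le> 1" "Rem u = (dirD u ^^ 3) \<Phi> v / 6 + (dirD u ^^ 4) \<Phi> (v + t1 *\<^sub>R u) / 24"
    using four by blast
  obtain t2 where t2: "0 \<le> t2" "t2 \<le> 1"
    "Rem (- u) = (dirD (- u) ^^ 3) \<Phi> v / 6 + (dirD (- u) ^^ 4) \<Phi> (v + t2 *\<^sub>R (- u)) / 24"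
    using four by blast
  have odd: "(dirD (- u) ^^ 3) \<Phi> v = - (dirD u ^^ 3) \<Phi> v"
    using funpow_dirD_scale[OF sm, of 3 "-1" u] by simp
  show "\<bar>Rem u + Rem (- u)\<bar> \<le> D4 / 3"
    using bounds[OF u t1(1,2)] bounds[OF um t2(1,2)] unfolding t1(3) t2(3) odd by linarith
qed

section \<open>Gaussian measures and linear maps\<close>

lemma nn_integral_lborel_translate:
  fixes f :: "'a::euclidean_space \<Rightarrow> ennreal"
  assumes [measurable]: "f \<in> borel_measurable borel"
  shows "(\<integral>\<^sup>+x. f (a + x) \<partial>lborel) = (\<integral>\<^sup>+x. f x \<partial>lborel)"
  by (subst (2) lborel_affine[of 1 a]) (simp_all add: nn_integral_density nn_integral_distr)

lemma nn_integral_lborel_uminus: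
  fixes f :: "'a::euclidean_space \<Rightarrow> ennreal"
  assumes [measurable]: "f \<in> borel_measurable borel"
  shows "(\<integral>\<^sup>+x. f (- x) \<partial>lborel) = (\<integral>\<^sup>+x. f x \<partial>lborel)"
  by (subst (2) lborel_affine[of "-1" 0]) (simp_all add: nn_integral_density nn_integral_distr)

lemma borel_measurable_linear:
  fixes T :: "'a::euclidean_space \<Rightarrow> 'b::euclidean_space"
  assumes "linear T" shows "T \<in> borel_measurable borel"
  using assms by (simp add: borel_measurable_continuous_onI linear_conv_bounded_linear linear_continuous_on)

text \<open>The image of Lebesgue measure under a linear bijection is translation invariant, and a
translation invariant measure is a multiple of Lebesgue measure by Fubini's theorem: for all
\<open>f\<close> and \<open>g\<close> the product of the \<open>\<mu>\<close>-integral of \<open>f\<close> and the Lebesgue integral of \<open>g\<close> is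
symmetric in \<open>f\<close> and \<open>g\<close>. The constant is left abstract because only ratios of integrals
matter.\<close>

theorem nn_integral_linear_bij:
  fixes T :: "'a::euclidean_space \<Rightarrow> 'a"
  assumes T: "linear T" "bij T"
  obtains c where "0 < c" "c < \<infinity>"
    and "\<And>f. f \<in> borel_measurable borel \<Longrightarrow>
      (\<integral>\<^sup>+x. f (T x) \<partial>lborel) = c * (\<integral>\<^sup>+x. f x \<partial>lborel :: ennreal)"
proof -
  note mT[measurable] = borel_measurable_linear[OF T(1)]
  have shift: "(\<integral>\<^sup>+x. h (a + T x) \<partial>lborel) = (\<integral>\<^sup>+x. h (T x) \<partial>lborel)"
    if [measurable]: "h \<in> borel_measurable borel" for h :: "'a \<Rightarrow> ennreal" and a
  proof -
    have "a + T x = T (inv T a + x)" for x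
      using T by (simp add: linear_add bij_def surj_f_inv_f)
    then show ?thesis using nn_integral_lborel_translate[of "\<lambda>x. h (T x)" "inv T a"] by simp
  qed
  \<comment> \<open>the exchange formula that characterizes multiples of Lebesgue measure\<close>
  have swap: "(\<integral>\<^sup>+x. f (T x) \<partial>lborel) * (\<integral>\<^sup>+y. g y \<partial>lborel) = (\<integral>\<^sup>+x. g (T x) \<partial>lborel) * (\<integral>\<^sup>+y. f y \<partial>lborel)"
    if [measurable]: "f \<in> borel_measurable borel" "g \<in> borel_measurable borel" for f g :: "'a \<Rightarrow> ennreal"
  proof -
    have "(\<integral>\<^sup>+x. f (T x) \<partial>lborel) * (\<integral>\<^sup>+y. g y \<partial>lborel) =
        (\<integral>\<^sup>+x. (\<integral>\<^sup>+y. f (T x) * g (T x + y) \<partial>lborel) \<partial>lborel)"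
      by (simp add: nn_integral_cmult nn_integral_multc nn_integral_lborel_translate)
    also have "\<dots> = (\<integral>\<^sup>+y. (\<integral>\<^sup>+x. f (T x) * g (T x + y) \<partial>lborel) \<partial>lborel)"
      by (rule lborel_pair.Fubini') measurable
    also have "\<dots> = (\<integral>\<^sup>+y. (\<integral>\<^sup>+x. f (T x - y) * g (T x) \<partial>lborel) \<partial>lborel)"
    proof (rule nn_integral_cong)
      fix y
      have "(\<integral>\<^sup>+x. f (y + T x - y) * g (y + T x) \<partial>lborel) = (\<integral>\<^sup>+x. f (T x - y) * g (T x) \<partial>lborel)"
        by (rule shift[of "\<lambda>w. f (w - y) * g w" y]) measurable
      then show "(\<integral>\<^sup>+x. f (T x) * g (T x + y) \<partial>lborel) = (\<integral>\<^sup>+x. f (T x - y) * g (T x) \<partial>lborel)"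
        by (simp add: add.commute)
    qed
    also have "\<dots> = (\<integral>\<^sup>+x. (\<integral>\<^sup>+y. f (T x - y) * g (T x) \<partial>lborel) \<partial>lborel)"
      by (rule lborel_pair.Fubini') measurable
    also have "\<dots> = (\<integral>\<^sup>+x. (\<integral>\<^sup>+y. f y \<partial>lborel) * g (T x) \<partial>lborel)"
    proof (rule nn_integral_cong)
      fix x
      have "(\<integral>\<^sup>+y. f (T x - y) \<partial>lborel) = (\<integral>\<^sup>+y. f (T x + y) \<partial>lborel)"
        using nn_integral_lborel_uminus[of "\<lambda>y. f (T x + y)"] by simp
      then show "(\<integral>\<^sup>+y. f (T x - y) * g (T x) \<partial>lborel) = (\<integral>\<^sup>+y. f y \<partial>lborel) * g (T x)"
        by (simp add: nn_integral_multc nn_integral_lborel_translate)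
    qed
    also have "\<dots> = (\<integral>\<^sup>+x. g (T x) \<partial>lborel) * (\<integral>\<^sup>+y. f y \<partial>lborel)"
      by (simp add: nn_integral_cmult mult.commute)
    finally show ?thesis .
  qed
  let ?B = "box 0 One :: 'a set"
  define c where "c = (\<integral>\<^sup>+x. indicator ?B (T x) \<partial>lborel :: ennreal)"
  have c_eq: "c = emeasure lborel (T -` ?B)"
  proof -
    have "T -` ?B \<in> sets lborel"
      using measurable_sets_borel[OF mT, of ?B] by simp
    then have "emeasure lborel (T -` ?B) = (\<integral>\<^sup>+x. indicator (T -` ?B) x \<partial>lborel)" by simp
    then show ?thesis unfolding c_def by (simp add: indicator_vimage)
  qed
  have lin_inv: "linear (inv T)" using T by (metis bij_def inj_linear_imp_inv_linear)
  have "c > 0"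
  proof -
    have "continuous_on UNIV T" using T(1) by (simp add: linear_conv_bounded_linear linear_continuous_on)
    then have "open (T -` ?B)" by (rule open_vimage[OF open_box])
    moreover have "T -` ?B \<noteq> {}"
    proof -
      have "?B \<noteq> {}" by (simp add: box_ne_empty)
      then obtain y where "y \<in> ?B" by blast
      then have "inv T y \<in> T -` ?B" using T by (simp add: bij_def surj_f_inv_f)
      then show ?thesis by blast
    qed
    ultimately have "emeasure lborel (T -` ?B) \<noteq> 0"
      using open_not_negligible[of "T -` ?B"] by (auto simp: negligible_iff_emeasure0 emeasure_completion)
    then show ?thesis using c_eq by (simp add: zero_less_iff_neq_zero)
  qed
  moreover have "c < \<infinity>"
  proof -
    have "T -` ?B = inv T ` ?B" using T(2) by (rule bij_vimage_eq_inv_image)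
    moreover have "bounded (inv T ` ?B)"
      using bounded_linear_image[of ?B "inv T"] lin_inv by (simp add: linear_conv_bounded_linear)
    ultimately show ?thesis using c_eq emeasure_bounded_finite by (metis)
  qed
  moreover have "(\<integral>\<^sup>+x. f (T x) \<partial>lborel) = c * (\<integral>\<^sup>+x. f x \<partial>lborel)"
    if "f \<in> borel_measurable borel" for f :: "'a \<Rightarrow> ennreal"
    using swap[OF that, of "indicator ?B"] unfolding c_def by simp
  ultimately show ?thesis using that by blast
qed

lemma std_gaussian_density:
  fixes x :: "'a::euclidean_space"
  shows "(\<Prod>b\<in>Basis. std_normal_density (x \<bullet> b)) = (1 / sqrt (2 * pi)) ^ DIM('a) * exp (- (norm x)\<^sup>2 / 2)"
proof -
  have "(\<Prod>b\<in>Basis. std_normal_density (x \<bullet> b)) =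
      (\<Prod>b\<in>(Basis :: 'a set). 1 / sqrt (2 * pi)) * (\<Prod>b\<in>Basis. exp (- (x \<bullet> b)\<^sup>2 / 2))"
    unfolding std_normal_density_def by (rule prod.distrib)
  also have "(\<Prod>b\<in>Basis. exp (- (x \<bullet> b)\<^sup>2 / 2)) = exp (\<Sum>b\<in>Basis. - (x \<bullet> b)\<^sup>2 / 2)"
    by (rule exp_sum[symmetric]) simp
  also have "(\<Sum>b\<in>Basis. - (x \<bullet> b)\<^sup>2 / 2) = - (norm x)\<^sup>2 / 2"
    unfolding sum_squared_coordinates[symmetric] by (simp add: sum_negf sum_divide_distrib)
  finally show ?thesis by simp
qed

lemma nn_integral_std_gaussian:
  fixes f :: "'a::euclidean_space \<Rightarrow> ennreal"
  assumes [measurable]: "f \<in> borel_measurable borel"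
  shows "(\<integral>\<^sup>+x. f x \<partial>std_gaussian) =
    ennreal ((1 / sqrt (2 * pi)) ^ DIM('a)) * (\<integral>\<^sup>+x. f x * ennreal (exp (- (norm x)\<^sup>2 / 2)) \<partial>lborel)"
proof -
  have "(\<integral>\<^sup>+x. f x \<partial>std_gaussian) =
      (\<integral>\<^sup>+x. ennreal ((1 / sqrt (2 * pi)) ^ DIM('a)) * (f x * ennreal (exp (- (norm x)\<^sup>2 / 2))) \<partial>lborel)"
    unfolding std_gaussian_def std_gaussian_density
    by (subst nn_integral_density) (auto simp: ennreal_mult mult_ac intro!: nn_integral_cong)
  also have "\<dots> = ennreal ((1 / sqrt (2 * pi)) ^ DIM('a)) *
      (\<integral>\<^sup>+x. f x * ennreal (exp (- (norm x)\<^sup>2 / 2)) \<partial>lborel)"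
    by (rule nn_integral_cmult) measurable
  finally show ?thesis .
qed

lemma nn_integral_scaled_normal:
  assumes "a < 1"
  shows "(\<integral>\<^sup>+t. ennreal (std_normal_density t * exp (a * t\<^sup>2 / 2)) \<partial>lborel) = ennreal (1 / sqrt (1 - a))"
proof -
  define \<sigma> where "\<sigma> = 1 / sqrt (1 - a)"
  have \<sigma>: "\<sigma> > 0" "\<sigma>\<^sup>2 = 1 / (1 - a)" using assms by (simp_all add: \<sigma>_def power_divide)
  have "std_normal_density t * exp (a * t\<^sup>2 / 2) = \<sigma> * normal_density 0 \<sigma> t" for t
  proof -
    have "- t\<^sup>2 / 2 + a * t\<^sup>2 / 2 = - t\<^sup>2 / (2 * \<sigma>\<^sup>2)"
      using assms by (simp add: \<sigma> field_simps)
    moreover have "sqrt (2 * pi * \<sigma>\<^sup>2) = sqrt (2 * pi) * \<sigma>" using \<sigma>(1) by (simp add: real_sqrt_mult)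
    ultimately show ?thesis using \<sigma>(1)
      by (simp add: std_normal_density_def normal_density_def flip: exp_add)
  qed
  then have "(\<integral>\<^sup>+t. ennreal (std_normal_density t * exp (a * t\<^sup>2 / 2)) \<partial>lborel) =
      ennreal \<sigma> * (\<integral>\<^sup>+t. ennreal (normal_density 0 \<sigma> t) \<partial>lborel)"
    using \<sigma>(1) by (simp add: ennreal_mult nn_integral_cmult)
  also have "(\<integral>\<^sup>+t. ennreal (normal_density 0 \<sigma> t) \<partial>lborel) = 1"
    using \<sigma>(1) by (subst nn_integral_eq_integral) auto
  finally show ?thesis by (simp add: \<sigma>_def)
qed

text \<open>The integral factorizes over the coordinates, and each factor is a rescaled normal density.\<close>

theorem gaussian_exp_quadratic:
  fixes a :: "'a::euclidean_space \<Rightarrow> real"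
  assumes "\<And>b. b \<in> Basis \<Longrightarrow> a b < 1"
  shows "(\<integral>\<^sup>+z. ennreal (exp (diag_form a z / 2)) \<partial>std_gaussian)
    = ennreal (\<Prod>b\<in>Basis. 1 / sqrt (1 - a b))"
proof -
  have "(\<integral>\<^sup>+z. ennreal (exp (diag_form a z / 2)) \<partial>std_gaussian) =
    (\<integral>\<^sup>+z. (\<Prod>b\<in>Basis. ennreal (std_normal_density (z \<bullet> b) * exp (a b * (z \<bullet> b)\<^sup>2 / 2))) \<partial>lborel)"
    unfolding std_gaussian_def diag_form_def
    by (subst nn_integral_density)
       (auto intro!: nn_integral_cong simp: prod_ennreal prod.distrib exp_sum sum_divide_distrib
         ennreal_mult[symmetric] prod_nonneg)
  also have "\<dots> = (\<Prod>b\<in>Basis. \<integral>\<^sup>+t. ennreal (std_normal_density t * exp (a b * t\<^sup>2 / 2)) \<partial>lborel)"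
    by (rule nn_integral_lborel_prod) auto
  also have "\<dots> = (\<Prod>b\<in>Basis. ennreal (1 / sqrt (1 - a b)))"
    using assms by (intro prod.cong refl nn_integral_scaled_normal) auto
  also have "\<dots> = ennreal (\<Prod>b\<in>Basis. 1 / sqrt (1 - a b))"
    using assms by (intro prod_ennreal) (auto intro: less_imp_le)
  finally show ?thesis .
qed

lemma prob_space_std_gaussian: "prob_space (std_gaussian :: 'a::euclidean_space measure)"
proof (rule prob_spaceI)
  have "emeasure (std_gaussian :: 'a measure) (space std_gaussian) = (\<integral>\<^sup>+z. 1 \<partial>(std_gaussian :: 'a measure))"
    by simp
  also have "\<dots> = 1" using gaussian_exp_quadratic[of "\<lambda>b::'a. 0"] by (simp add: diag_form_def ennreal_1[symmetric] del: ennreal_1)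
  finally show "emeasure (std_gaussian :: 'a measure) (space std_gaussian) = 1" .
qed

lemma sets_std_gaussian [measurable_cong, simp]: "sets std_gaussian = sets borel"
  by (simp add: std_gaussian_def)

lemma space_std_gaussian [simp]: "space std_gaussian = UNIV"
  by (simp add: std_gaussian_def)

lemma gaussian_reflection:
  fixes f :: "'a::euclidean_space \<Rightarrow> ennreal"
  assumes [measurable]: "f \<in> borel_measurable borel"
  shows "(\<integral>\<^sup>+x. f (- x) \<partial>std_gaussian) = (\<integral>\<^sup>+x. f x \<partial>std_gaussian)"
  using nn_integral_lborel_uminus[of "\<lambda>x. f x * ennreal (exp (- (norm x)\<^sup>2 / 2))"]
  by (simp add: nn_integral_std_gaussian)

text \<open>Completing the square in the second component. For given \<open>f\<close>, the minimizer over \<open>g\<close> of the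
quadratic form is \<open>L f\<close>, where \<open>(f, L f) = M\<^sup>-\<^sup>1 (S f, 0)\<close>; the cross term vanishes because
\<open>M (f, L f)\<close> has second component 0.\<close>

lemma schur_complement:
  fixes M :: "'x::euclidean_space \<times> 'y::euclidean_space \<Rightarrow> 'x \<times> 'y"
  assumes M: "op_pd M"
  defines "S \<equiv> inv (ff_block (inv M))"
  obtains L where "op_pd S" "linear L"
    "\<And>f g. M (f, L f + g) \<bullet> (f, L f + g) = S f \<bullet> f + M (0, g) \<bullet> (0, g)"
proof -
  note iM = op_pd_inv[OF M]
  have Ms: "op_symmetric M" using M unfolding op_pd_def by auto
  note linM = op_symmetricD(1)[OF Ms]
  have isym: "op_symmetric (inv M)" using iM(1) unfolding op_pd_def by auto
  note lini = op_symmetricD(1)[OF isym]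
  let ?K = "ff_block (inv M)"
  have lin0: "linear (\<lambda>f::'x. (f, 0::'y))" by (rule linearI) auto
  have linK: "linear ?K" unfolding ff_block_def
    using linear_compose[OF linear_compose[OF lin0 lini] linear_fst] by (simp add: o_def)
  have K: "op_pd ?K"
    unfolding op_pd_def op_symmetric_def
  proof (intro conjI allI impI linK)
    show "?K u \<bullet> v = u \<bullet> ?K v" for u v
      using op_symmetricD(2)[OF isym, of "(u, 0)" "(v, 0)"] by (simp add: ff_block_def inner_prod_def)
    show "0 < ?K u \<bullet> u" if "u \<noteq> 0" for u
    proof -
      have "0 < inv M (u, 0) \<bullet> (u, 0)" using iM(1) that unfolding op_pd_def by (auto simp: zero_prod_def)
      then show ?thesis by (simp add: ff_block_def inner_prod_def)
    qed
  qed
  have S: "op_pd S" unfolding S_def by (rule op_pd_inv(1)[OF K])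
  then have linS: "linear S" unfolding op_pd_def op_symmetric_def by auto
  define L where "L f = snd (inv M (S f, 0))" for f
  have linL: "linear L" unfolding L_def
    using linear_compose[OF linear_compose[OF linear_compose[OF linS lin0] lini] linear_snd] by (simp add: o_def)
  have u: "(f, L f) = inv M (S f, 0)" for f
  proof -
    have "fst (inv M (S f, 0)) = f" using op_pd_inv(2)[OF K, of f] by (simp add: S_def ff_block_def)
    then show ?thesis unfolding L_def by (metis prod.collapse)
  qed
  have "M (f, L f + g) \<bullet> (f, L f + g) = S f \<bullet> f + M (0, g) \<bullet> (0, g)" for f g
  proof -
    have Mu: "M (f, L f) = (S f, 0)" unfolding u by (rule iM(2))
    have 1: "M (f, L f + g) = (S f, 0) + M (0, g)"
      using linear_add[OF linM, of "(f, L f)" "(0, g)"] by (simp add: Mu)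
    have 2: "M (0, g) \<bullet> (f, L f) = 0"
      using op_symmetricD(2)[OF Ms, of "(0, g)" "(f, L f)"] by (simp add: Mu inner_prod_def)
    have 3: "M (0, g) \<bullet> (f, L f + g) = M (0, g) \<bullet> (f, L f) + M (0, g) \<bullet> (0, g)"
      by (subst inner_add_right[symmetric]) simp
    show ?thesis unfolding 1 inner_add_left 3 2 by (simp add: inner_prod_def)
  qed
  then show ?thesis using that S linL by blast
qed

text \<open>After completing the square, the inner integral does not depend on \<open>f\<close> by translation
invariance.\<close>

lemma nn_integral_marginal:
  fixes M :: "'x::euclidean_space \<times> 'y::euclidean_space \<Rightarrow> 'x \<times> 'y"
  assumes M: "op_pd M"
  obtains C :: ennreal where "\<And>B. B \<in> sets borel \<Longrightarrow>
     (\<integral>\<^sup>+u. indicator B (fst u) * ennreal (exp (- (M u \<bullet> u) / 2)) \<partial>lborel)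
      = C * (\<integral>\<^sup>+f. indicator B f * ennreal (exp (- (inv (ff_block (inv M)) f \<bullet> f) / 2)) \<partial>lborel)"
proof -
  let ?S = "inv (ff_block (inv M))"
  obtain L where S: "op_pd ?S" and L: "linear L"
    and eq: "\<And>f g. M (f, L f + g) \<bullet> (f, L f + g) = ?S f \<bullet> f + M (0, g) \<bullet> (0, g)"
    using schur_complement[OF M] by blast
  have [measurable]: "M \<in> borel_measurable borel" "?S \<in> borel_measurable borel"
    using M S by (auto intro!: borel_measurable_linear simp: op_pd_def op_symmetric_def)
  have [measurable]: "(fst :: 'x \<times> 'y \<Rightarrow> 'x) \<in> borel_measurable borel"
    by (rule borel_measurable_linear[OF linear_fst])
  define C :: ennreal where "C = (\<integral>\<^sup>+g. ennreal (exp (- (M (0, g) \<bullet> (0, g)) / 2)) \<partial>lborel)"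
  show ?thesis
  proof (rule that[of C])
    fix B :: "'x set" assume [measurable]: "B \<in> sets borel"
    have "(\<integral>\<^sup>+u. indicator B (fst u) * ennreal (exp (- (M u \<bullet> u) / 2)) \<partial>lborel)
      = (\<integral>\<^sup>+f. (\<integral>\<^sup>+g. indicator B f * ennreal (exp (- (M (f, g) \<bullet> (f, g)) / 2)) \<partial>lborel) \<partial>lborel)"
      unfolding lborel_prod[symmetric]
      by (subst lborel.nn_integral_fst[symmetric]) (auto simp: lborel_prod)
    also have "\<dots> = (\<integral>\<^sup>+f. C * (indicator B f * ennreal (exp (- (?S f \<bullet> f) / 2))) \<partial>lborel)"
    proof (rule nn_integral_cong)
      fix f
      have "(\<integral>\<^sup>+g. indicator B f * ennreal (exp (- (M (f, g) \<bullet> (f, g)) / 2)) \<partial>lborel)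
        = (\<integral>\<^sup>+g. indicator B f * ennreal (exp (- (M (f, L f + g) \<bullet> (f, L f + g)) / 2)) \<partial>lborel)"
        by (rule nn_integral_lborel_translate[symmetric]) measurable
      also have "\<dots> = (\<integral>\<^sup>+g. indicator B f * ennreal (exp (- (?S f \<bullet> f) / 2)) * ennreal (exp (- (M (0, g) \<bullet> (0, g)) / 2)) \<partial>lborel)"
        unfolding eq by (intro nn_integral_cong)
          (simp add: ennreal_mult[symmetric] mult.assoc diff_divide_distrib flip: exp_add)
      also have "\<dots> = C * (indicator B f * ennreal (exp (- (?S f \<bullet> f) / 2)))"
        unfolding C_def by (subst nn_integral_cmult) (auto simp: mult.commute)
      finally show "(\<integral>\<^sup>+g. indicator B f * ennreal (exp (- (M (f, g) \<bullet> (f, g)) / 2)) \<partial>lborel)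
        = C * (indicator B f * ennreal (exp (- (?S f \<bullet> f) / 2)))" .
    qed
    also have "\<dots> = C * (\<integral>\<^sup>+f. indicator B f * ennreal (exp (- (?S f \<bullet> f) / 2)) \<partial>lborel)"
      by (rule nn_integral_cmult) measurable
    finally show "(\<integral>\<^sup>+u. indicator B (fst u) * ennreal (exp (- (M u \<bullet> u) / 2)) \<partial>lborel)
      = C * (\<integral>\<^sup>+f. indicator B f * ennreal (exp (- (?S f \<bullet> f) / 2)) \<partial>lborel)" .
  qed
qed

text \<open>Both sides are, up to constants, the integral over \<open>B\<close> of \<open>exp (- (S f \<bullet> f) / 2)\<close> with \<open>S\<close> the
Schur complement; \<open>B = UNIV\<close> shows that the constants agree.\<close>

theorem gaussian_marginal:
  fixes M T :: "'x::euclidean_space \<times> 'y::euclidean_space \<Rightarrow> 'x \<times> 'y"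
  assumes M: "op_pd M" and T: "linear T" "bij T" and MT: "\<And>z. M (T z) \<bullet> T z = (norm z)\<^sup>2"
    and B: "B \<in> sets borel"
  shows "measure std_gaussian {z. fst (T z) \<in> B}
    = measure std_gaussian {\<gamma>. inv (op_sqrt (inv (ff_block (inv M)))) \<gamma> \<in> B}"
proof -
  let ?S = "inv (ff_block (inv M))"
  let ?R = "op_sqrt ?S"
  have S: "op_pd ?S" by (rule schur_complement[OF M])
  note R = op_sqrt_props[OF op_pd_imp_psd[OF S]]
  have Sb: "bij ?S" by (rule op_pd_bij[OF S])
  have linR: "linear ?R" using R(1) unfolding op_psd_def op_symmetric_def by auto
  have bR: "bij ?R"
  proof -
    have "inj ?R"
    proof (subst linear_injective_0[OF linR], intro allI impI)
      fix a assume "?R a = 0"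
      then have "?S a = ?S 0" using R(2)[of a] R(2)[of 0] linear_0[OF linR] by simp
      then show "a = 0" using Sb by (simp only: bij_def inj_eq)
    qed
    then show ?thesis using linear_injective_imp_surjective[OF linR] by (auto simp: bij_def)
  qed
  have linRi: "linear (inv ?R)" using bR linR by (metis bij_def inj_linear_imp_inv_linear)
  have [measurable]: "T \<in> borel_measurable borel" "inv ?R \<in> borel_measurable borel"
      "M \<in> borel_measurable borel" "(fst :: 'x \<times> 'y \<Rightarrow> 'x) \<in> borel_measurable borel"
      "?S \<in> borel_measurable borel"
    using T linRi M S by (auto intro: borel_measurable_linear linear_fst simp: op_pd_def op_symmetric_def)
  define K :: "'x set \<Rightarrow> ennreal" where "K B = (\<integral>\<^sup>+f. indicator B f * ennreal (exp (- (?S f \<bullet> f) / 2)) \<partial>lborel)" for B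
  obtain C where C: "\<And>B. B \<in> sets borel \<Longrightarrow>
     (\<integral>\<^sup>+u. indicator B (fst u) * ennreal (exp (- (M u \<bullet> u) / 2)) \<partial>lborel) = C * K B"
    unfolding K_def by (rule nn_integral_marginal[OF M]) blast
  obtain c1 where c1: "\<And>f. f \<in> borel_measurable borel \<Longrightarrow>
      (\<integral>\<^sup>+x. f (T x) \<partial>lborel) = c1 * (\<integral>\<^sup>+x. f x \<partial>lborel :: ennreal)"
    by (rule nn_integral_linear_bij[OF T]) blast
  obtain c2 where c2: "\<And>f. f \<in> borel_measurable borel \<Longrightarrow>
      (\<integral>\<^sup>+x. f (inv ?R x) \<partial>lborel) = c2 * (\<integral>\<^sup>+x. f x \<partial>lborel :: ennreal)"
    by (rule nn_integral_linear_bij[OF linRi bij_imp_bij_inv[OF bR]]) blast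
  have left: "\<exists>a. \<forall>B\<in>sets borel. emeasure std_gaussian {z. fst (T z) \<in> B} = a * K B"
  proof (intro exI ballI)
    fix B :: "'x set" assume [measurable]: "B \<in> sets borel"
    have "emeasure std_gaussian {z. fst (T z) \<in> B} = (\<integral>\<^sup>+z. indicator {z. fst (T z) \<in> B} z \<partial>std_gaussian)"
      by (rule nn_integral_indicator[symmetric]) simp
    also have "\<dots> = (\<integral>\<^sup>+z. indicator B (fst (T z)) \<partial>std_gaussian)"
      by (intro nn_integral_cong) (auto simp: indicator_def)
    also have "\<dots> = ennreal ((1 / sqrt (2 * pi)) ^ DIM('x \<times> 'y)) *
        (\<integral>\<^sup>+z. indicator B (fst (T z)) * ennreal (exp (- (M (T z) \<bullet> T z) / 2)) \<partial>lborel)"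
      unfolding MT by (rule nn_integral_std_gaussian) measurable
    also have "\<dots> = ennreal ((1 / sqrt (2 * pi)) ^ DIM('x \<times> 'y)) * (c1 * (C * K B))"
      by (subst C[symmetric], simp, subst c1[symmetric]) simp_all
    finally show "emeasure std_gaussian {z. fst (T z) \<in> B} =
        (ennreal ((1 / sqrt (2 * pi)) ^ DIM('x \<times> 'y)) * c1 * C) * K B"
      by (simp add: mult.assoc)
  qed
  have right: "\<exists>a. \<forall>B\<in>sets borel. emeasure std_gaussian {\<gamma>. inv ?R \<gamma> \<in> B} = a * K B"
  proof (intro exI ballI)
    fix B :: "'x set" assume [measurable]: "B \<in> sets borel"
    have nR: "(norm x)\<^sup>2 = ?S (inv ?R x) \<bullet> inv ?R x" for x
      using norm_op_sqrt[OF op_pd_imp_psd[OF S], of "inv ?R x"] bR by (simp add: bij_def surj_f_inv_f)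
    have "emeasure std_gaussian {\<gamma>. inv ?R \<gamma> \<in> B} = (\<integral>\<^sup>+z. indicator {\<gamma>. inv ?R \<gamma> \<in> B} z \<partial>std_gaussian)"
      by (rule nn_integral_indicator[symmetric]) simp
    also have "\<dots> = (\<integral>\<^sup>+z. indicator B (inv ?R z) \<partial>std_gaussian)"
      by (intro nn_integral_cong) (auto simp: indicator_def)
    also have "\<dots> = ennreal ((1 / sqrt (2 * pi)) ^ DIM('x)) *
        (\<integral>\<^sup>+z. indicator B (inv ?R z) * ennreal (exp (- (?S (inv ?R z) \<bullet> inv ?R z) / 2)) \<partial>lborel)"
      unfolding nR[symmetric] by (rule nn_integral_std_gaussian) measurable
    also have "\<dots> = ennreal ((1 / sqrt (2 * pi)) ^ DIM('x)) * (c2 * K B)"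
      unfolding K_def by (subst c2[symmetric]) simp_all
    finally show "emeasure std_gaussian {\<gamma>. inv ?R \<gamma> \<in> B} =
        (ennreal ((1 / sqrt (2 * pi)) ^ DIM('x)) * c2) * K B"
      by (simp add: mult.assoc)
  qed
  obtain a where a: "\<And>B. B \<in> sets borel \<Longrightarrow> emeasure std_gaussian {z. fst (T z) \<in> B} = a * K B"
    using left by blast
  obtain b where b: "\<And>B. B \<in> sets borel \<Longrightarrow> emeasure std_gaussian {\<gamma>. inv ?R \<gamma> \<in> B} = b * K B"
    using right by blast
  have 1: "a * K UNIV = 1" "b * K UNIV = 1"
    using a[of UNIV] b[of UNIV]
      prob_space.emeasure_space_1[OF prob_space_std_gaussian[where 'a = "'x \<times> 'y"]]
      prob_space.emeasure_space_1[OF prob_space_std_gaussian[where 'a = 'x]] by simp_all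
  have "a * K B = a * K B * (b * K UNIV)" using 1 by simp
  also have "\<dots> = b * K B * (a * K UNIV)" by (simp add: mult_ac)
  also have "\<dots> = b * K B" using 1 by simp
  finally show ?thesis using a[OF B] b[OF B] by (simp add: measure_def)
qed

section \<open>Concave functions that are nearly quadratic on an ellipsoid\<close>

lemma exp_quadratic_bound:
  fixes y :: real
  assumes "\<bar>y\<bar> \<le> 1"
  shows "\<bar>exp y - 1 - y\<bar> \<le> y\<^sup>2"
proof -
  have "exp y \<le> 1 + y + y\<^sup>2"
  proof (cases "y \<ge> 0")
    case True
    then show ?thesis using exp_bound[of y] assms by simp
  next
    case False
    define s where "s = - y"
    have s: "0 \<le> s" using False by (simp add: s_def)
    have "1 \<le> 1 + s\<^sup>2 / 2 + s ^ 3 / 2 + s ^ 4 / 2" using s by simp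
    also have "\<dots> = (1 - s + s\<^sup>2) * (1 + s + s\<^sup>2 / 2)"
      by (simp add: field_simps power2_eq_square power3_eq_cube power4_eq_xxxx)
    also have "\<dots> \<le> (1 - s + s\<^sup>2) * exp s"
    proof (intro mult_left_mono)
      show "1 + s + s\<^sup>2 / 2 \<le> exp s" using exp_lower_Taylor_quadratic[OF s] by simp
      have "1 - s + s\<^sup>2 = (1 - s / 2)\<^sup>2 + 3 / 4 * s\<^sup>2"
        by (simp add: algebra_simps power2_eq_square)
      then show "0 \<le> 1 - s + s\<^sup>2" by simp
    qed
    finally have "exp (- s) \<le> 1 - s + s\<^sup>2" by (simp add: exp_minus field_simps)
    then show ?thesis by (simp add: s_def)
  qed
  moreover have "1 + y \<le> exp y" by (rule exp_ge_add_one_self)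
  ultimately show ?thesis unfolding abs_le_iff using zero_le_power2[of y] by linarith
qed

text \<open>The intermediate value theorem in \<open>\<kappa>\<close>: the form of the shrunk point is continuous in \<open>\<kappa>\<close>, exceeds
\<open>r\<^sup>2\<close> at 0 and is at most \<open>(norm z)\<^sup>2 / (4 \<kappa>)\<close> because \<open>(1 + \<kappa> \<beta>)\<^sup>2 \<ge> 4 \<kappa> \<beta>\<close>.\<close>

lemma shrinkage_exists:
  fixes z :: "'a::euclidean_space"
  assumes \<beta>: "\<And>b. b \<in> Basis \<Longrightarrow> 0 \<le> \<beta> b"
    and r: "0 < r" and q: "r\<^sup>2 < diag_form \<beta> z"
  obtains \<kappa> where "0 < \<kappa>" "(\<Sum>b\<in>Basis. \<beta> b * ((z \<bullet> b) / (1 + \<kappa> * \<beta> b))\<^sup>2) = r\<^sup>2"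
proof -
  let ?f = "\<lambda>\<kappa>. \<Sum>b\<in>Basis. \<beta> b * ((z \<bullet> b) / (1 + \<kappa> * \<beta> b))\<^sup>2"
  have z: "z \<noteq> 0"
  proof
    assume "z = 0"
    then show False using q by (simp add: diag_form_def not_less[symmetric])
  qed
  define K where "K = (norm z)\<^sup>2 / (4 * r\<^sup>2)"
  have K: "0 < K" using z r by (simp add: K_def)
  have den: "1 + \<kappa> * \<beta> b \<noteq> 0" if "0 \<le> \<kappa>" "b \<in> Basis" for \<kappa> b
    using mult_nonneg_nonneg[OF that(1) \<beta>[OF that(2)]] by linarith
  have fK: "?f K \<le> r\<^sup>2"
  proof -
    have "?f K \<le> (\<Sum>b\<in>Basis. (z \<bullet> b)\<^sup>2 / (4 * K))"
    proof (rule sum_mono)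
      fix b :: 'a assume b: "b \<in> Basis"
      have "4 * (K * \<beta> b) \<le> (1 + K * \<beta> b)\<^sup>2"
        using sum_squares_ge_zero[of "1 - K * \<beta> b" 0] by (simp add: power2_eq_square algebra_simps)
      moreover have "0 < (1 + K * \<beta> b)\<^sup>2" using den[of K b] K b by simp
      ultimately have "\<beta> b / (1 + K * \<beta> b)\<^sup>2 \<le> 1 / (4 * K)" using K by (simp add: field_simps)
      then have "\<beta> b / (1 + K * \<beta> b)\<^sup>2 * (z \<bullet> b)\<^sup>2 \<le> 1 / (4 * K) * (z \<bullet> b)\<^sup>2"
        by (intro mult_right_mono) auto
      then show "\<beta> b * ((z \<bullet> b) / (1 + K * \<beta> b))\<^sup>2 \<le> (z \<bullet> b)\<^sup>2 / (4 * K)"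
        by (simp add: power_divide)
    qed
    also have "\<dots> = (norm z)\<^sup>2 / (4 * K)" by (simp add: sum_squared_coordinates flip: sum_divide_distrib)
    also have "\<dots> = r\<^sup>2" using z r by (simp add: K_def)
    finally show ?thesis .
  qed
  have "continuous_on {0..K} ?f" using den by (intro continuous_intros) auto
  moreover have "r\<^sup>2 \<le> ?f 0" using q by (simp add: diag_form_def)
  ultimately obtain \<kappa> where \<kappa>: "0 \<le> \<kappa>" "?f \<kappa> = r\<^sup>2"
    using IVT2'[of ?f K "r\<^sup>2" 0] fK K by auto
  then have "\<kappa> \<noteq> 0" using q by (auto simp: diag_form_def)
  then show ?thesis using that[OF _ \<kappa>(2)] \<kappa>(1) by simp
qed

text \<open>Let \<open>p = (1 + \<kappa> B)\<^sup>-\<^sup>1 z\<close> have form value \<open>(r + 1/4)\<^sup>2\<close> and let \<open>h = z - p\<close>. A point \<open>w\<close> on the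
segment from \<open>p\<close> to \<open>z\<close>, close enough to \<open>p\<close> to stay in the larger ellipsoid, determines the slope
of a chord that bounds the concave function at \<open>z\<close>. For the exact quadratic this gives
\<open>- (norm z)\<^sup>2 / 2 + (norm h)\<^sup>2 / 2\<close>, and \<open>(norm h)\<^sup>2\<close> is the form in the claim, with
\<open>(r + 1/4)\<^sup>2\<close> in place of \<open>r\<^sup>2\<close>. The error \<open>d\<close> is amplified by \<open>1 / \<theta> = 1 + 4 \<kappa> (r + 1/4)\<close>, which
is linear in \<open>\<kappa>\<close> and is absorbed by decreasing the radius to \<open>r\<close>. A chord, unlike a tangent,
requires bounds on values only, and these follow from Taylor's formula on lines through 0.\<close>

lemma chord_bound:
  fixes z :: "'a::euclidean_space" and \<ll> :: "'a \<Rightarrow> real"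
  assumes \<beta>: "\<And>b. b \<in> Basis \<Longrightarrow> 0 \<le> \<beta> b" "\<And>b. b \<in> Basis \<Longrightarrow> \<beta> b \<le> 1"
    and conc: "concave_on W \<ll>" and zW: "z \<in> W"
    and loc: "\<And>u. diag_form \<beta> u \<le> (r + 1/2)\<^sup>2 \<Longrightarrow> u \<in> W \<and> \<bar>\<ll> u + (norm u)\<^sup>2 / 2\<bar> \<le> d"
    and d: "0 \<le> d" "d \<le> 1/64" and r: "0 \<le> r"
    and out: "(r + 1/4)\<^sup>2 < diag_form \<beta> z"
  obtains \<kappa> where "0 < \<kappa>"
    "\<ll> z + (norm z)\<^sup>2 / 2 \<le> (diag_form (\<lambda>b. \<kappa> * \<beta> b / (1 + \<kappa> * \<beta> b)) z - \<kappa> * r\<^sup>2) / 2 + 2 * d"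
proof -
  let ?r1 = "r + 1/4"
  obtain \<kappa> where \<kappa>: "0 < \<kappa>" and qp: "(\<Sum>b\<in>Basis. \<beta> b * ((z \<bullet> b) / (1 + \<kappa> * \<beta> b))\<^sup>2) = ?r1\<^sup>2"
    by (rule shrinkage_exists[of \<beta> ?r1 z, OF \<beta>(1)]) (use r out in \<open>auto simp: diag_form_def\<close>)
  have den: "1 + \<kappa> * \<beta> b > 0" if "b \<in> Basis" for b
    using \<beta>(1)[OF that] \<kappa> by (simp add: add_pos_nonneg)
  define p where "p = (\<Sum>b\<in>Basis. ((z \<bullet> b) / (1 + \<kappa> * \<beta> b)) *\<^sub>R b)"
  define h where "h = z - p"
  \<comment> \<open>\<open>\<theta>\<close> is small enough for \<open>w\<close> to stay in the ellipsoid of radius \<open>r + 1/2\<close>, as \<open>h = \<kappa> B p\<close> with \<open>B \<le> 1\<close>\<close>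
  define \<theta> where "\<theta> = 1 / (1 + 4 * \<kappa> * ?r1)"
  define w where "w = (1 - \<theta>) *\<^sub>R p + \<theta> *\<^sub>R z"
  have \<theta>: "0 < \<theta>" "\<theta> \<le> 1"
    using \<kappa> r by (auto simp: \<theta>_def divide_le_eq intro!: add_pos_nonneg mult_nonneg_nonneg)
  have pb: "p \<bullet> b = (z \<bullet> b) / (1 + \<kappa> * \<beta> b)" if "b \<in> Basis" for b
    using that by (simp add: p_def)
  have zb: "z \<bullet> b = (p \<bullet> b) * (1 + \<kappa> * \<beta> b)" if "b \<in> Basis" for b
    using den[OF that] by (simp add: pb[OF that])
  have hb: "h \<bullet> b = (p \<bullet> b) * (\<kappa> * \<beta> b)" if "b \<in> Basis" for b
    unfolding h_def inner_diff_left zb[OF that] by (simp add: algebra_simps)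
  have q_p: "diag_form \<beta> p = ?r1\<^sup>2" using qp by (simp add: diag_form_def pb cong: sum.cong)
  have r1pos: "0 < ?r1" using r by simp
  have pin: "diag_form \<beta> p \<le> (r + 1/2)\<^sup>2" unfolding q_p using r by (intro power_mono) auto
  have win: "diag_form \<beta> w \<le> (r + 1/2)\<^sup>2"
  proof -
    have wb: "(w \<bullet> b)\<^sup>2 \<le> (1 + \<theta> * \<kappa>)\<^sup>2 * (p \<bullet> b)\<^sup>2" if b: "b \<in> Basis" for b
    proof -
      have "w \<bullet> b = (p \<bullet> b) * (1 + \<theta> * \<kappa> * \<beta> b)"
        unfolding w_def by (simp add: inner_add_left zb[OF b] algebra_simps)
      then have "(w \<bullet> b)\<^sup>2 = (1 + \<theta> * \<kappa> * \<beta> b)\<^sup>2 * (p \<bullet> b)\<^sup>2" by (simp add: power_mult_distrib)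
      moreover have "\<theta> * \<kappa> * \<beta> b \<le> \<theta> * \<kappa> * 1" using \<beta>(2)[OF b] \<theta> \<kappa> by (intro mult_left_mono) auto
      moreover have "0 \<le> \<theta> * \<kappa> * \<beta> b" using \<beta>(1)[OF b] \<theta> \<kappa> by simp
      ultimately show ?thesis by (auto intro!: mult_right_mono power_mono)
    qed
    have "diag_form \<beta> w \<le> (\<Sum>b\<in>Basis. \<beta> b * ((1 + \<theta> * \<kappa>)\<^sup>2 * (p \<bullet> b)\<^sup>2))"
      unfolding diag_form_def using \<beta>(1) wb by (intro sum_mono mult_left_mono) auto
    also have "\<dots> = (1 + \<theta> * \<kappa>)\<^sup>2 * diag_form \<beta> p"
      by (simp add: diag_form_def sum_distrib_left mult_ac)
    also have "\<dots> = ((1 + \<theta> * \<kappa>) * ?r1)\<^sup>2" by (simp only: q_p power_mult_distrib)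
    also have "\<dots> \<le> (r + 1/2)\<^sup>2"
    proof (rule power_mono)
      have "\<theta> * (4 * \<kappa> * ?r1) \<le> 1"
      proof -
        have "0 < 1 + 4 * \<kappa> * ?r1" using \<kappa> r1pos by (simp add: add_pos_nonneg)
        then show ?thesis unfolding \<theta>_def by (simp add: divide_le_eq)
      qed
      then show "(1 + \<theta> * \<kappa>) * ?r1 \<le> r + 1/2"
      proof -
        have "(1 + \<theta> * \<kappa>) * ?r1 = ?r1 + \<theta> * (4 * \<kappa> * ?r1) / 4" by (simp only: distrib_right) simp
        then show ?thesis using \<open>\<theta> * (4 * \<kappa> * ?r1) \<le> 1\<close> by linarith
      qed
      show "0 \<le> (1 + \<theta> * \<kappa>) * ?r1" using \<theta> \<kappa> r1pos by simp
    qed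
    finally show ?thesis .
  qed
  have pW: "p \<in> W" and lp: "\<bar>\<ll> p + (norm p)\<^sup>2 / 2\<bar> \<le> d" using loc[OF pin] by auto
  have lw: "\<bar>\<ll> w + (norm w)\<^sup>2 / 2\<bar> \<le> d" using loc[OF win] by auto
  have "(1 - \<theta>) * \<ll> p + \<theta> * \<ll> z \<le> \<ll> w"
    using concave_onD[OF conc _ _ pW zW, of \<theta>] \<theta> unfolding w_def by simp
  moreover have "(1 - \<theta>) * \<ll> p \<ge> (1 - \<theta>) * (- (norm p)\<^sup>2 / 2 - d)"
    using lp \<theta> by (intro mult_left_mono) auto
  ultimately have 1: "\<theta> * \<ll> z \<le> - (norm w)\<^sup>2 / 2 + d + (1 - \<theta>) * ((norm p)\<^sup>2 / 2 + d)"
    using lw by (simp add: algebra_simps)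
  have "w = p + \<theta> *\<^sub>R h" by (simp add: w_def h_def algebra_simps)
  then have nw: "(norm w)\<^sup>2 = (norm p)\<^sup>2 + 2 * \<theta> * (p \<bullet> h) + \<theta>\<^sup>2 * (norm h)\<^sup>2"
    unfolding power2_norm_eq_inner by (simp add: inner_add_left inner_add_right inner_commute power2_eq_square algebra_simps)
  have "z = p + h" by (simp add: h_def)
  then have nz: "(norm z)\<^sup>2 = (norm p)\<^sup>2 + 2 * (p \<bullet> h) + (norm h)\<^sup>2"
    unfolding power2_norm_eq_inner by (simp add: inner_add_left inner_add_right inner_commute)
  have "(1 - \<theta>) * d \<le> d" using \<theta> d by (simp add: mult_left_le_one_le)
  moreover have "0 \<le> \<theta>\<^sup>2 * (norm h)\<^sup>2" by simp
  moreover have "\<theta> * L \<le> \<theta> * (- a / 2 - c) + 2 * d"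
    if "\<theta> * L \<le> - (a + 2 * \<theta> * c + e) / 2 + d + (1 - \<theta>) * (a / 2 + d)" "0 \<le> e" "(1 - \<theta>) * d \<le> d"
    for L a c e :: real
    using that by (simp add: field_simps)
  ultimately have "\<theta> * \<ll> z \<le> \<theta> * (- (norm p)\<^sup>2 / 2 - p \<bullet> h) + 2 * d"
    using 1 unfolding nw by blast
  then have "\<theta> * \<ll> z \<le> \<theta> * (- (norm z)\<^sup>2 / 2 + (norm h)\<^sup>2 / 2) + 2 * d"
    unfolding nz by (simp add: field_simps)
  also have "\<dots> = \<theta> * (- (norm z)\<^sup>2 / 2 + (norm h)\<^sup>2 / 2 + 2 * d * (1 + 4 * \<kappa> * ?r1))"
  proof -
    have "\<theta> * (1 + 4 * \<kappa> * ?r1) = 1" using \<theta> by (simp add: \<theta>_def)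
    then have "2 * d = \<theta> * (2 * d * (1 + 4 * \<kappa> * ?r1))" by (metis mult.assoc mult.commute mult.right_neutral)
    then show ?thesis by (simp only: distrib_left)
  qed
  finally have lz: "\<ll> z \<le> - (norm z)\<^sup>2 / 2 + (norm h)\<^sup>2 / 2 + 2 * d * (1 + 4 * \<kappa> * ?r1)"
    using \<theta>(1) by (rule mult_left_le_imp_le)
  have nh: "(norm h)\<^sup>2 = diag_form (\<lambda>b. \<kappa> * \<beta> b / (1 + \<kappa> * \<beta> b)) z - \<kappa> * ?r1\<^sup>2"
  proof -
    have "(h \<bullet> b)\<^sup>2 = \<kappa> * \<beta> b / (1 + \<kappa> * \<beta> b) * (z \<bullet> b)\<^sup>2 - \<kappa> * (\<beta> b * (p \<bullet> b)\<^sup>2)" if b: "b \<in> Basis" for b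
    proof -
      have "\<kappa> * \<beta> b / (1 + \<kappa> * \<beta> b) * (z \<bullet> b)\<^sup>2 = \<kappa> * \<beta> b * (1 + \<kappa> * \<beta> b) * (p \<bullet> b)\<^sup>2"
        unfolding zb[OF b] using den[OF b] by (simp add: power_mult_distrib) (simp add: power2_eq_square)
      then show ?thesis unfolding hb[OF b] by (simp add: power2_eq_square algebra_simps)
    qed
    then show ?thesis
      unfolding sum_squared_coordinates[symmetric] q_p[symmetric]
      by (simp add: diag_form_def sum_subtractf sum_distrib_left)
  qed
  \<comment> \<open>the amplified error is paid for by the difference of the squared radii \<open>r + 1/4\<close> and \<open>r\<close>\<close>
  have "8 * d * \<kappa> * ?r1 - \<kappa> * ?r1\<^sup>2 / 2 \<le> - (\<kappa> * r\<^sup>2 / 2)"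
  proof -
    have "8 * d * ?r1 \<le> 8 * (1/64) * ?r1" using d r1pos by (intro mult_right_mono) auto
    also have "\<dots> \<le> (?r1\<^sup>2 - r\<^sup>2) / 2" using r by (simp add: power2_eq_square algebra_simps)
    finally have "\<kappa> * (8 * d * ?r1) \<le> \<kappa> * ((?r1\<^sup>2 - r\<^sup>2) / 2)" using \<kappa> by (intro mult_left_mono) auto
    moreover have "\<kappa> * (8 * d * ?r1) = 8 * d * \<kappa> * ?r1" by simp
    moreover have "\<kappa> * ((?r1\<^sup>2 - r\<^sup>2) / 2) = \<kappa> * ?r1\<^sup>2 / 2 - \<kappa> * r\<^sup>2 / 2" by (simp add: right_diff_distrib diff_divide_distrib)
    ultimately show ?thesis by linarith
  qed
  moreover have "2 * d * (1 + 4 * \<kappa> * ?r1) = 2 * d + 8 * d * \<kappa> * ?r1" by (simp add: distrib_left)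
  ultimately have "\<ll> z + (norm z)\<^sup>2 / 2 \<le> (diag_form (\<lambda>b. \<kappa> * \<beta> b / (1 + \<kappa> * \<beta> b)) z - \<kappa> * r\<^sup>2) / 2 + 2 * d"
    using lz unfolding nh diff_divide_distrib by linarith
  then show ?thesis using that \<kappa> by blast
qed

lemma inverse_sqrt_bound:
  fixes y :: real
  assumes "0 \<le> y" "y \<le> c" "c < 1"
  shows "1 / sqrt (1 - y) \<le> exp (y / (2 * (1 - c)))"
proof -
  have y1: "y < 1" using assms by simp
  have "1 / (1 - y) = 1 + y / (1 - y)" using y1 by (simp add: field_simps)
  also have "\<dots> \<le> exp (y / (1 - y))" by (rule exp_ge_add_one_self)
  also have "\<dots> \<le> exp (y / (1 - c))" using assms by (auto intro!: divide_left_mono)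
  also have "exp (y / (1 - c)) = (exp (y / (2 * (1 - c))))\<^sup>2"
  proof -
    have "y / (1 - c) = 2 * (y / (2 * (1 - c)))" using assms(3) by (simp add: field_simps)
    then show ?thesis by (simp only: exp_double)
  qed
  finally have "1 / (1 - y) \<le> (exp (y / (2 * (1 - c))))\<^sup>2" .
  then have "sqrt (1 / (1 - y)) \<le> exp (y / (2 * (1 - c)))" by (rule real_le_lsqrt[rotated]) simp
  then show ?thesis by (simp add: real_sqrt_divide)
qed

lemma prod_inverse_sqrt_bound:
  fixes \<beta> :: "'a::euclidean_space \<Rightarrow> real"
  assumes "\<And>b. b \<in> Basis \<Longrightarrow> 0 \<le> \<beta> b" "\<And>b. b \<in> Basis \<Longrightarrow> \<kappa> * \<beta> b \<le> c" "c < 1" "0 \<le> \<kappa>"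
  shows "(\<Prod>b\<in>Basis. 1 / sqrt (1 - \<kappa> * \<beta> b)) \<le> exp (\<kappa> * (\<Sum>b\<in>Basis. \<beta> b) / (2 * (1 - c)))"
proof -
  have "(\<Prod>b\<in>Basis. 1 / sqrt (1 - \<kappa> * \<beta> b)) \<le> (\<Prod>b\<in>Basis. exp (\<kappa> * \<beta> b / (2 * (1 - c))))"
  proof (intro prod_mono conjI inverse_sqrt_bound)
    fix b :: 'a assume b: "b \<in> Basis"
    show "0 \<le> 1 / sqrt (1 - \<kappa> * \<beta> b)" using assms(2)[OF b] assms(3) by simp
  qed (use assms in auto)
  also have "\<dots> = exp (\<Sum>b\<in>Basis. \<kappa> * \<beta> b / (2 * (1 - c)))" by (simp add: exp_sum)
  also have "(\<Sum>b\<in>Basis. \<kappa> * \<beta> b / (2 * (1 - c))) = \<kappa> * (\<Sum>b\<in>Basis. \<beta> b) / (2 * (1 - c))"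
    by (simp add: sum_distrib_left flip: sum_divide_distrib)
  finally show ?thesis .
qed

text \<open>The exponent \<open>\<kappa>\<close> from which on the union bound in the tail estimate starts. It must be small
enough for \<open>exp (\<kappa> \<Sum> \<beta>\<^sub>b z\<^sub>b\<^sup>2 / 2)\<close> to be integrable, with a moderate integral, and large enough
for \<open>\<kappa> (r\<^sup>2 - p) \<ge> x\<close>. For \<open>p < 1/4\<close> all \<open>\<beta>\<^sub>b\<close> are below \<open>1/4\<close> and \<open>\<kappa> = 2\<close> does. Otherwise
\<open>r \<ge> sqrt p + sqrt x\<close>, and \<open>\<kappa> = sqrt x / (sqrt p + sqrt x)\<close> balances the two requirements.\<close>

lemma tilt_choice:
  fixes \<beta> :: "'a::euclidean_space \<Rightarrow> real"
  assumes \<beta>: "\<And>b. b \<in> Basis \<Longrightarrow> 0 \<le> \<beta> b" "\<And>b. b \<in> Basis \<Longrightarrow> \<beta> b \<le> 1"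
    and x: "4 \<le> x" and r: "2 * sqrt (\<Sum>b\<in>Basis. \<beta> b) + sqrt x - 1/2 \<le> r"
  obtains \<kappa> where "0 < \<kappa>" "\<And>b. b \<in> Basis \<Longrightarrow> \<kappa> * \<beta> b < 1"
    "(\<Prod>b\<in>Basis. 1 / sqrt (1 - \<kappa> * \<beta> b)) * exp (- (\<kappa> * r\<^sup>2 / 2)) \<le> 2 * exp (- x / 2)"
    "x \<le> \<kappa> * (r\<^sup>2 - (\<Sum>b\<in>Basis. \<beta> b))"
proof -
  define p where "p = (\<Sum>b\<in>Basis. \<beta> b)"
  define s where "s = sqrt x"
  define m where "m = sqrt p"
  have p0: "0 \<le> p" unfolding p_def using \<beta>(1) by (rule sum_nonneg)
  have m0: "0 \<le> m" "m\<^sup>2 = p" using p0 by (simp_all add: m_def)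
  have s2: "2 \<le> s" unfolding s_def using x real_sqrt_le_mono[OF x] by simp
  have sx: "s\<^sup>2 = x" unfolding s_def using x by simp
  have bp: "\<beta> b \<le> p" if "b \<in> Basis" for b
    unfolding p_def using \<beta>(1) that by (intro member_le_sum) auto
  have rms: "2 * m + s - 1/2 \<le> r" using r by (simp add: m_def s_def p_def)
  show ?thesis
  proof (cases "p < 1/4")
    case True
    have rs: "(s - 1/2)\<^sup>2 \<le> r\<^sup>2" using rms m0 s2 by (intro power_mono) auto
    have "2 * s \<le> s * s" using s2 by (intro mult_right_mono) auto
    then have e1: "x / 2 \<le> r\<^sup>2" and e2: "x \<le> 2 * r\<^sup>2 - 1/2"
      using rs sx by (auto simp: power2_eq_square algebra_simps)
    show ?thesis
    proof (rule that[of 2])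
      show "2 * \<beta> b < 1" if "b \<in> Basis" for b using bp[OF that] True by simp
      have "(\<Prod>b\<in>Basis. 1 / sqrt (1 - 2 * \<beta> b)) \<le> exp (2 * (\<Sum>b\<in>Basis. \<beta> b) / (2 * (1 - 1/2)))"
      proof (rule prod_inverse_sqrt_bound)
        show "2 * \<beta> b \<le> 1/2" if "b \<in> Basis" for b using bp[OF that] True by simp
      qed (use \<beta> in auto)
      also have "\<dots> \<le> exp (1/2)" using True by (simp add: p_def)
      also have "\<dots> \<le> 2" using exp_bound_half[of "1/2::real"] by simp
      finally have "(\<Prod>b\<in>Basis. 1 / sqrt (1 - 2 * \<beta> b)) \<le> 2" .
      moreover have "exp (- (2 * r\<^sup>2 / 2)) \<le> exp (- x / 2)" using e1 by simp
      ultimately show "(\<Prod>b\<in>Basis. 1 / sqrt (1 - 2 * \<beta> b)) * exp (- (2 * r\<^sup>2 / 2)) \<le> 2 * exp (- x / 2)"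
        by (intro mult_mono) auto
      show "x \<le> 2 * (r\<^sup>2 - (\<Sum>b\<in>Basis. \<beta> b))" using e2 True by (simp add: p_def)
    qed simp
  next
    case False
    then have "sqrt (1/4) \<le> m" unfolding m_def by (intro real_sqrt_le_mono) simp
    then have mh: "1/2 \<le> m" by (simp add: real_sqrt_divide)
    define \<kappa> where "\<kappa> = s / (m + s)"
    have ms: "m + s > 0" using mh s2 by simp
    have \<kappa>: "0 < \<kappa>" "\<kappa> < 1" using mh s2 by (auto simp: \<kappa>_def)
    have rr: "(m + s)\<^sup>2 \<le> r\<^sup>2" using rms mh s2 by (intro power_mono) auto
    have "\<kappa> * (m + s)\<^sup>2 \<le> \<kappa> * r\<^sup>2" using rr \<kappa> by (intro mult_left_mono) auto
    moreover have "\<kappa> * (m + s)\<^sup>2 = s * (m + s)" using ms by (simp add: \<kappa>_def power2_eq_square)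
    ultimately have kr: "s * (m + s) \<le> \<kappa> * r\<^sup>2" by simp
    have k1: "1 - \<kappa> = m / (m + s)" using ms by (simp add: \<kappa>_def field_simps)
    show ?thesis
    proof (rule that[of \<kappa>])
      show "\<kappa> * \<beta> b < 1" if "b \<in> Basis" for b
        using \<kappa> \<beta>(2)[OF that] mult_left_mono[of "\<beta> b" 1 \<kappa>] by linarith
      have "(\<Prod>b\<in>Basis. 1 / sqrt (1 - \<kappa> * \<beta> b)) \<le> exp (\<kappa> * (\<Sum>b\<in>Basis. \<beta> b) / (2 * (1 - \<kappa>)))"
      proof (rule prod_inverse_sqrt_bound)
        show "\<kappa> * \<beta> b \<le> \<kappa>" if "b \<in> Basis" for b
          using \<kappa> \<beta>(2)[OF that] mult_left_mono[of "\<beta> b" 1 \<kappa>] by simp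
      qed (use \<beta> \<kappa> in auto)
      also have "\<kappa> * (\<Sum>b\<in>Basis. \<beta> b) / (2 * (1 - \<kappa>)) = s * m / 2"
        unfolding p_def[symmetric] k1 m0(2)[symmetric] using ms mh by (simp add: \<kappa>_def power2_eq_square)
      finally have "(\<Prod>b\<in>Basis. 1 / sqrt (1 - \<kappa> * \<beta> b)) * exp (- (\<kappa> * r\<^sup>2 / 2))
        \<le> exp (s * m / 2) * exp (- (s * (m + s) / 2))"
        using kr by (intro mult_mono) auto
      also have "\<dots> = exp (- x / 2)"
        unfolding sx[symmetric] by (simp add: power2_eq_square algebra_simps add_divide_distrib flip: exp_add)
      also have "\<dots> \<le> 2 * exp (- x / 2)" by simp
      finally show "(\<Prod>b\<in>Basis. 1 / sqrt (1 - \<kappa> * \<beta> b)) * exp (- (\<kappa> * r\<^sup>2 / 2)) \<le> 2 * exp (- x / 2)" .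
      have "\<kappa> * p \<le> s * m"
      proof -
        have "\<kappa> * p = s * m * (m / (m + s))" by (simp add: \<kappa>_def m0(2)[symmetric] power2_eq_square)
        also have "\<dots> \<le> s * m * 1" using mh s2 by (intro mult_left_mono) auto
        finally show ?thesis by simp
      qed
      then have "s * s \<le> \<kappa> * r\<^sup>2 - \<kappa> * p" using kr by (simp add: algebra_simps)
      then show "x \<le> \<kappa> * (r\<^sup>2 - (\<Sum>b\<in>Basis. \<beta> b))"
        by (simp add: sx[symmetric] p_def[symmetric] power2_eq_square algebra_simps)
    qed (rule \<kappa>(1))
  qed
qed

section \<open>Comparison with the Gaussian measure\<close>

text \<open>By \<open>chord_bound\<close> the density ratio at a point outside the ellipsoid is bounded, for some \<open>\<kappa> > 0\<close>
depending on the point, by \<open>exp ((\<Sum> A\<^sub>b z\<^sub>b\<^sup>2 - \<kappa> r\<^sup>2) / 2)\<close> up to the factor \<open>exp (2 d)\<close>. For \<open>\<kappa> \<le> \<kappa>0\<close> the bound increases to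
\<open>E0\<close>, since \<open>A\<^sub>b \<le> \<kappa> \<beta>\<^sub>b\<close> and the form exceeds \<open>r\<^sup>2\<close>; larger \<open>\<kappa>\<close> are rounded to a grid of width
\<open>h\<close>, which gives the terms \<open>E k\<close>. The expectations of the \<open>E k\<close> decay geometrically.\<close>

theorem posterior_tail:
  fixes \<beta> :: "'a::euclidean_space \<Rightarrow> real" and \<ll> :: "'a \<Rightarrow> real"
  assumes \<beta>: "\<And>b. b \<in> Basis \<Longrightarrow> 0 \<le> \<beta> b" "\<And>b. b \<in> Basis \<Longrightarrow> \<beta> b \<le> 1"
    and conc: "concave_on W \<ll>"
    and loc: "\<And>u. diag_form \<beta> u \<le> (r + 1/2)\<^sup>2 \<Longrightarrow> u \<in> W \<and> \<bar>\<ll> u + (norm u)\<^sup>2 / 2\<bar> \<le> d"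
    and d: "0 \<le> d" "d \<le> 1/64"
    and x: "4 \<le> x" and r: "2 * sqrt (\<Sum>b\<in>Basis. \<beta> b) + sqrt x - 1/2 \<le> r"
  shows "(\<integral>\<^sup>+z. indicator {z \<in> W. (r + 1/4)\<^sup>2 < diag_form \<beta> z} z * ennreal (exp (\<ll> z + (norm z)\<^sup>2 / 2)) \<partial>std_gaussian)
      \<le> ennreal (6 * exp (- x / 2))" (is ?post)
    and "emeasure std_gaussian {z. (r + 1/4)\<^sup>2 < diag_form \<beta> z} \<le> ennreal (2 * exp (- x / 2))" (is ?gauss)
proof -
  define p where "p = (\<Sum>b\<in>Basis. \<beta> b)"
  have p0: "0 \<le> p" unfolding p_def using \<beta>(1) by (rule sum_nonneg)
  have sx: "2 \<le> sqrt x" using real_sqrt_le_mono[OF x] by simp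
  have r2: "2 * sqrt p + 1 \<le> r" using r sx unfolding p_def by linarith
  have r1: "1 \<le> r" using r2 real_sqrt_ge_zero[OF p0] by linarith
  have "(2 * sqrt p)\<^sup>2 \<le> r\<^sup>2" using r2 p0 by (intro power_mono) auto
  then have rp: "4 * p \<le> r\<^sup>2" using p0 by (simp add: power_mult_distrib)
  have rr: "1 \<le> r\<^sup>2" using r1 by (simp add: one_le_power)
  obtain \<kappa>0 where \<kappa>0: "0 < \<kappa>0" "\<And>b. b \<in> Basis \<Longrightarrow> \<kappa>0 * \<beta> b < 1"
    "(\<Prod>b\<in>Basis. 1 / sqrt (1 - \<kappa>0 * \<beta> b)) * exp (- (\<kappa>0 * r\<^sup>2 / 2)) \<le> 2 * exp (- x / 2)"
    "x \<le> \<kappa>0 * (r\<^sup>2 - p)"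
    using tilt_choice[OF \<beta> x r] unfolding p_def by blast
  \<comment> \<open>the grid width for which one step gains the factor \<open>exp (- h (r\<^sup>2 - p) / 2) = exp (- 1) \<le> 1/2\<close>\<close>
  define h where "h = 2 / (r\<^sup>2 - p)"
  have rmp: "0 < r\<^sup>2 - p" using rp rr by linarith
  have h: "0 < h" using rmp by (simp add: h_def)
  define \<kappa> where "\<kappa> k = \<kappa>0 + real k * h" for k
  define A where "A \<kappa> b = \<kappa> * \<beta> b / (1 + \<kappa> * \<beta> b)" for \<kappa> b
  have [measurable]: "(\<lambda>z. diag_form a z) \<in> borel_measurable borel" for a unfolding diag_form_def by measurable
  define E0 where "E0 z = ennreal (exp (\<kappa>0 * (diag_form \<beta> z - r\<^sup>2) / 2))" for z
  define E where "E k z = ennreal (exp ((diag_form (A (\<kappa> (Suc k))) z - \<kappa> k * r\<^sup>2) / 2))" for k z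
  have [measurable]: "E0 \<in> borel_measurable borel" "E k \<in> borel_measurable borel" for k
    unfolding E0_def E_def by measurable
  have Apos: "0 \<le> A \<kappa> b" "A \<kappa> b \<le> A \<kappa>' b" "A \<kappa> b \<le> \<kappa> * \<beta> b" "A \<kappa> b < 1" "1 - A \<kappa> b = 1 / (1 + \<kappa> * \<beta> b)"
    if "0 < \<kappa>" "\<kappa> \<le> \<kappa>'" "b \<in> Basis" for \<kappa> \<kappa>' b
  proof -
    have 0: "0 \<le> \<kappa> * \<beta> b" "\<kappa> * \<beta> b \<le> \<kappa>' * \<beta> b"
      using that \<beta>(1) by (auto intro: mult_right_mono)
    show "0 \<le> A \<kappa> b" "A \<kappa> b < 1" "1 - A \<kappa> b = 1 / (1 + \<kappa> * \<beta> b)" "A \<kappa> b \<le> A \<kappa>' b"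
      using 0 by (auto simp: A_def field_simps)
    have "\<kappa> * \<beta> b * 1 \<le> \<kappa> * \<beta> b * (1 + \<kappa> * \<beta> b)" using 0 by (intro mult_left_mono) auto
    then show "A \<kappa> b \<le> \<kappa> * \<beta> b" using 0 by (simp add: A_def divide_le_eq)
  qed
  have qmono: "diag_form a z \<le> diag_form a' z" if "\<And>b. b \<in> Basis \<Longrightarrow> a b \<le> a' b" for a a' z
    unfolding diag_form_def using that by (intro sum_mono mult_right_mono) auto
  have major: "ennreal (exp (\<ll> z + (norm z)\<^sup>2 / 2)) \<le> ennreal (exp (2 * d)) * (E0 z + (\<Sum>k. E k z))"
    if zW: "z \<in> W" and out: "(r + 1/4)\<^sup>2 < diag_form \<beta> z" for z
  proof -
    obtain \<kappa>' where k: "0 < \<kappa>'"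
      and b: "\<ll> z + (norm z)\<^sup>2 / 2 \<le> (diag_form (A \<kappa>') z - \<kappa>' * r\<^sup>2) / 2 + 2 * d"
      using chord_bound[OF \<beta> conc zW loc d _ out] r1
      unfolding A_def by (auto simp: mult.commute)
    have "\<exists>t. (diag_form (A \<kappa>') z - \<kappa>' * r\<^sup>2) / 2 \<le> t \<and> ennreal (exp t) \<le> E0 z + (\<Sum>k. E k z)"
    proof (cases "\<kappa>' \<le> \<kappa>0")
      case True
      have "r\<^sup>2 \<le> (r + 1/4)\<^sup>2" using r1 by (intro power_mono) auto
      then have "diag_form \<beta> z - r\<^sup>2 \<ge> 0" using out by linarith
      then have "\<kappa>' * (diag_form \<beta> z - r\<^sup>2) \<le> \<kappa>0 * (diag_form \<beta> z - r\<^sup>2)" using True by (intro mult_right_mono)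
      moreover have "diag_form (A \<kappa>') z \<le> diag_form (\<lambda>b. \<kappa>' * \<beta> b) z" using Apos(3)[OF k order_refl] by (intro qmono)
      moreover have "diag_form (\<lambda>b. \<kappa>' * \<beta> b) z = \<kappa>' * diag_form \<beta> z" by (simp add: diag_form_def sum_distrib_left mult.assoc)
      ultimately have "(diag_form (A \<kappa>') z - \<kappa>' * r\<^sup>2) / 2 \<le> \<kappa>0 * (diag_form \<beta> z - r\<^sup>2) / 2"
        by (simp add: right_diff_distrib)
      moreover have "ennreal (exp (\<kappa>0 * (diag_form \<beta> z - r\<^sup>2) / 2)) \<le> E0 z + (\<Sum>k. E k z)"
        unfolding E0_def by simp
      ultimately show ?thesis by blast
    next
      case False
      define k' where "k' = nat \<lfloor>(\<kappa>' - \<kappa>0) / h\<rfloor>"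
      have fl: "0 \<le> (\<kappa>' - \<kappa>0) / h" using False h by simp
      have "real k' \<le> (\<kappa>' - \<kappa>0) / h" "(\<kappa>' - \<kappa>0) / h \<le> real k' + 1"
        unfolding k'_def using fl by linarith+
      then have k1: "\<kappa> k' \<le> \<kappa>'" and k2: "\<kappa>' \<le> \<kappa> (Suc k')"
        using h by (auto simp: \<kappa>_def field_simps)
      have "diag_form (A \<kappa>') z \<le> diag_form (A (\<kappa> (Suc k'))) z" using Apos(2)[OF k k2] by (intro qmono)
      moreover have "\<kappa> k' * r\<^sup>2 \<le> \<kappa>' * r\<^sup>2" using k1 by (intro mult_right_mono) auto
      ultimately have "(diag_form (A \<kappa>') z - \<kappa>' * r\<^sup>2) / 2 \<le> (diag_form (A (\<kappa> (Suc k'))) z - \<kappa> k' * r\<^sup>2) / 2" by simp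
      moreover have "E k' z \<le> E0 z + (\<Sum>k. E k z)"
        using sum_le_suminf[of "\<lambda>k. E k z" "{k'}"] by (simp add: add_increasing)
      ultimately show ?thesis unfolding E_def by blast
    qed
    then obtain t where t: "(diag_form (A \<kappa>') z - \<kappa>' * r\<^sup>2) / 2 \<le> t" "ennreal (exp t) \<le> E0 z + (\<Sum>k. E k z)" by blast
    have "ennreal (exp (\<ll> z + (norm z)\<^sup>2 / 2)) \<le> ennreal (exp (2 * d) * exp t)"
      unfolding exp_add[symmetric] by (intro ennreal_leI, unfold exp_le_cancel_iff) (use b t(1) in linarith)
    also have "\<dots> = ennreal (exp (2 * d)) * ennreal (exp t)" by (simp add: ennreal_mult)
    also have "\<dots> \<le> ennreal (exp (2 * d)) * (E0 z + (\<Sum>k. E k z))" using t(2) by (intro mult_left_mono) auto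
    finally show ?thesis .
  qed
  have quad: "(\<integral>\<^sup>+z. ennreal (exp ((diag_form a z - c) / 2)) \<partial>std_gaussian)
      = ennreal ((\<Prod>b\<in>Basis. 1 / sqrt (1 - a b)) * exp (- (c / 2)))"
    if a: "\<And>b. b \<in> Basis \<Longrightarrow> a b < 1" for a c
  proof -
    have "(\<integral>\<^sup>+z. ennreal (exp ((diag_form a z - c) / 2)) \<partial>std_gaussian) =
        (\<integral>\<^sup>+z. ennreal (exp (diag_form a z / 2)) * ennreal (exp (- (c / 2))) \<partial>std_gaussian)"
      by (intro nn_integral_cong) (simp add: diff_divide_distrib flip: exp_add ennreal_mult)
    also have "\<dots> = (\<integral>\<^sup>+z. ennreal (exp (diag_form a z / 2)) \<partial>std_gaussian) * ennreal (exp (- (c / 2)))"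
      by (rule nn_integral_multc) measurable
    also have "(\<integral>\<^sup>+z. ennreal (exp (diag_form a z / 2)) \<partial>std_gaussian) = ennreal (\<Prod>b\<in>Basis. 1 / sqrt (1 - a b))"
      by (rule gaussian_exp_quadratic[OF a])
    finally show ?thesis using a by (simp add: ennreal_mult prod_nonneg less_imp_le)
  qed
  have I0: "(\<integral>\<^sup>+z. E0 z \<partial>std_gaussian) \<le> ennreal (2 * exp (- x / 2))"
  proof -
    have "(\<integral>\<^sup>+z. E0 z \<partial>std_gaussian) = (\<integral>\<^sup>+z. ennreal (exp ((diag_form (\<lambda>b. \<kappa>0 * \<beta> b) z - \<kappa>0 * r\<^sup>2) / 2)) \<partial>std_gaussian)"
      unfolding E0_def by (simp add: diag_form_def sum_distrib_left mult.assoc right_diff_distrib)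
    also have "\<dots> = ennreal ((\<Prod>b\<in>Basis. 1 / sqrt (1 - \<kappa>0 * \<beta> b)) * exp (- (\<kappa>0 * r\<^sup>2 / 2)))"
      by (rule quad[OF \<kappa>0(2)])
    also have "\<dots> \<le> ennreal (2 * exp (- x / 2))" by (rule ennreal_leI[OF \<kappa>0(3)])
    finally show ?thesis .
  qed
  have Ik: "(\<integral>\<^sup>+z. E k z \<partial>std_gaussian) \<le> ennreal (3/2 * exp (- x / 2) * (1/2) ^ k)" for k
  proof -
    have kpos: "0 < \<kappa> (Suc k)" using \<kappa>0(1) h by (simp add: \<kappa>_def add_pos_nonneg)
    have "(\<integral>\<^sup>+z. E k z \<partial>std_gaussian) =
      ennreal ((\<Prod>b\<in>Basis. 1 / sqrt (1 - A (\<kappa> (Suc k)) b)) * exp (- (\<kappa> k * r\<^sup>2 / 2)))"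
      unfolding E_def using Apos(4)[OF kpos order_refl] by (rule quad)
    also have "\<dots> \<le> ennreal (exp (\<kappa> (Suc k) * p / 2) * exp (- (\<kappa> k * r\<^sup>2 / 2)))"
    proof (intro ennreal_leI mult_right_mono)
      have "(\<Prod>b\<in>Basis. 1 / sqrt (1 - A (\<kappa> (Suc k)) b)) \<le> (\<Prod>b\<in>Basis. exp (\<kappa> (Suc k) * \<beta> b / 2))"
      proof (intro prod_mono conjI)
        fix b :: 'a assume b: "b \<in> Basis"
        let ?y = "\<kappa> (Suc k) * \<beta> b"
        have y: "0 \<le> ?y" using kpos \<beta>(1)[OF b] by simp
        show "0 \<le> 1 / sqrt (1 - A (\<kappa> (Suc k)) b)" using Apos(4)[OF kpos order_refl b] by simp
        have "1 + ?y \<le> (exp (?y / 2))\<^sup>2"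
          using exp_ge_add_one_self[of ?y] by (simp flip: exp_double)
        then have "sqrt (1 + ?y) \<le> exp (?y / 2)" by (rule real_le_lsqrt[rotated]) simp
        then show "1 / sqrt (1 - A (\<kappa> (Suc k)) b) \<le> exp (?y / 2)"
          unfolding Apos(5)[OF kpos order_refl b] by (simp add: real_sqrt_divide)
      qed
      also have "\<dots> = exp (\<kappa> (Suc k) * p / 2)"
        by (simp add: p_def sum_distrib_left flip: exp_sum sum_divide_distrib)
      finally show "(\<Prod>b\<in>Basis. 1 / sqrt (1 - A (\<kappa> (Suc k)) b)) \<le> exp (\<kappa> (Suc k) * p / 2)" .
    qed simp
    also have "exp (\<kappa> (Suc k) * p / 2) * exp (- (\<kappa> k * r\<^sup>2 / 2))
        = exp (h * p / 2) * exp (- (\<kappa>0 * (r\<^sup>2 - p) / 2)) * exp (- (h * (r\<^sup>2 - p) / 2) * real k)"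
      unfolding exp_add[symmetric] by (rule arg_cong[where f = exp]) (simp add: \<kappa>_def field_simps)
    also have "ennreal \<dots> \<le> ennreal (3/2 * exp (- x / 2) * (1/2) ^ k)"
    proof (intro ennreal_leI mult_mono)
      have "h * p / 2 = p / (r\<^sup>2 - p)" using rmp by (simp add: h_def field_simps)
      also have "\<dots> \<le> 1/3" using rp rmp by (simp add: divide_le_eq)
      finally have "exp (h * p / 2) \<le> exp (1/3)" by simp
      also have "exp (1/3 :: real) \<le> 3/2"
      proof -
        have "2/3 \<le> exp (- (1/3) :: real)" using exp_ge_add_one_self[of "- (1/3) :: real"] by simp
        then show ?thesis by (simp add: exp_minus field_simps)
      qed
      finally show "exp (h * p / 2) \<le> 3/2" .
      show "exp (- (\<kappa>0 * (r\<^sup>2 - p) / 2)) \<le> exp (- x / 2)" using \<kappa>0(4) by simp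
      have "h * (r\<^sup>2 - p) / 2 = 1" using rmp by (simp add: h_def)
      then have "exp (- (h * (r\<^sup>2 - p) / 2) * real k) = exp (- 1) ^ k"
        by (simp only: exp_of_nat2_mult)
      also have "\<dots> \<le> (1/2) ^ k"
      proof (rule power_mono)
        have "2 \<le> exp (1::real)" using exp_ge_add_one_self[of "1::real"] by simp
        then show "exp (- 1) \<le> (1/2::real)" by (simp add: exp_minus field_simps)
      qed simp
      finally show "exp (- (h * (r\<^sup>2 - p) / 2) * real k) \<le> (1/2) ^ k" .
    qed simp_all
    finally show ?thesis .
  qed
  have IS: "(\<integral>\<^sup>+z. (\<Sum>k. E k z) \<partial>std_gaussian) \<le> ennreal (3 * exp (- x / 2))"
  proof -
    have "(\<integral>\<^sup>+z. (\<Sum>k. E k z) \<partial>std_gaussian) = (\<Sum>k. \<integral>\<^sup>+z. E k z \<partial>std_gaussian)"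
      by (rule nn_integral_suminf) measurable
    also have "\<dots> \<le> (\<Sum>k. ennreal (3/2 * exp (- x / 2) * (1/2) ^ k))"
      by (rule suminf_le) (use Ik in auto)
    also have "\<dots> = ennreal (\<Sum>k. 3/2 * exp (- x / 2) * (1/2) ^ k)"
      by (rule suminf_ennreal2) (auto intro!: summable_mult summable_geometric)
    also have "(\<Sum>k. 3/2 * exp (- x / 2) * (1/2::real) ^ k) = 3 * exp (- x / 2)"
      by (subst suminf_mult) (auto intro!: summable_geometric simp: suminf_geometric)
    finally show ?thesis .
  qed
  have "(\<integral>\<^sup>+z. indicator {z \<in> W. (r + 1/4)\<^sup>2 < diag_form \<beta> z} z * ennreal (exp (\<ll> z + (norm z)\<^sup>2 / 2)) \<partial>std_gaussian)
      \<le> (\<integral>\<^sup>+z. ennreal (exp (2 * d)) * (E0 z + (\<Sum>k. E k z)) \<partial>std_gaussian)"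
    by (intro nn_integral_mono) (use major in \<open>auto simp: indicator_def\<close>)
  also have "\<dots> = ennreal (exp (2 * d)) * ((\<integral>\<^sup>+z. E0 z \<partial>std_gaussian) + (\<integral>\<^sup>+z. (\<Sum>k. E k z) \<partial>std_gaussian))"
    by (simp add: nn_integral_cmult nn_integral_add)
  also have "\<dots> \<le> ennreal (exp (2 * d)) * (ennreal (2 * exp (- x / 2)) + ennreal (3 * exp (- x / 2)))"
    by (intro mult_left_mono add_mono I0 IS) simp
  also have "\<dots> = ennreal (exp (2 * d) * (5 * exp (- x / 2)))"
    by (subst ennreal_plus[symmetric], simp, simp, subst ennreal_mult[symmetric])
       simp_all
  also have "\<dots> \<le> ennreal (6 * exp (- x / 2))"
  proof (rule ennreal_leI)
    have "exp (2 * d) \<le> 1 + 2 * (2 * d)" using d by (intro real_exp_bound_lemma) auto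
    then have "exp (2 * d) * (5 * exp (- x / 2)) \<le> (6/5) * (5 * exp (- x / 2))"
      using d by (intro mult_right_mono) auto
    then show "exp (2 * d) * (5 * exp (- x / 2)) \<le> 6 * exp (- x / 2)" by simp
  qed
  finally show ?post .
  have "emeasure std_gaussian {z. (r + 1/4)\<^sup>2 < diag_form \<beta> z} = (\<integral>\<^sup>+z. indicator {z. (r + 1/4)\<^sup>2 < diag_form \<beta> z} z \<partial>std_gaussian)"
    by (rule nn_integral_indicator[symmetric]) simp
  also have "\<dots> \<le> (\<integral>\<^sup>+z. E0 z \<partial>std_gaussian)"
  proof (rule nn_integral_mono)
    fix z :: 'a
    show "indicator {z. (r + 1/4)\<^sup>2 < diag_form \<beta> z} z \<le> E0 z"
    proof (cases "(r + 1/4)\<^sup>2 < diag_form \<beta> z")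
      case True
      have "r\<^sup>2 \<le> (r + 1/4)\<^sup>2" using r1 by (intro power_mono) auto
      then have "0 \<le> \<kappa>0 * (diag_form \<beta> z - r\<^sup>2) / 2" using True \<kappa>0(1) by simp
      then have "ennreal 1 \<le> E0 z" unfolding E0_def by (intro ennreal_leI) simp
      then show ?thesis using True by simp
    qed simp
  qed
  also note I0
  finally show ?gauss .
qed


text \<open>Bookkeeping for the normalization: \<open>N\<close> and \<open>T\<close> are the local and outer masses of an event under
the unnormalized measure, \<open>g\<close> and \<open>s\<close> those under the Gaussian one, and the index 1 refers to the
whole space.\<close>

lemma normalized_comparison:
  fixes N T g s N1 T1 g1 s1 \<eta> t :: real
  assumes "\<bar>N - g\<bar> \<le> \<eta>" "\<bar>N1 - g1\<bar> \<le> \<eta>" "0 \<le> T" "T \<le> 6 * t" "0 \<le> T1" "T1 \<le> 6 * t"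
    and "0 \<le> s" "s \<le> 2 * t" "0 \<le> s1" "s1 \<le> 2 * t" and "g1 + s1 = 1"
    and "0 \<le> g + s" "g + s \<le> 1" and small: "\<eta> + 6 * t \<le> 1/2"
  shows "0 < N1 + T1" and "\<bar>(N + T) / (N1 + T1) - (g + s)\<bar> \<le> 4 * (\<eta> + 6 * t)"
proof -
  define D where "D = \<eta> + 6 * t"
  have 1: "\<bar>(N1 + T1) - 1\<bar> \<le> D" and 2: "\<bar>(N + T) - (g + s)\<bar> \<le> D" using assms unfolding D_def by linarith+
  have D: "0 \<le> D" "D \<le> 1/2" using 1 small by (auto simp: D_def)
  have half: "1/2 \<le> N1 + T1" using 1 D by linarith
  then show "0 < N1 + T1" by simp
  have "\<bar>(N + T) - (g + s) * (N1 + T1)\<bar> = \<bar>((N + T) - (g + s)) - (g + s) * ((N1 + T1) - 1)\<bar>"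
    by (simp add: algebra_simps)
  also have "\<dots> \<le> \<bar>(N + T) - (g + s)\<bar> + \<bar>(g + s) * ((N1 + T1) - 1)\<bar>" by (rule abs_triangle_ineq4)
  also have "\<dots> \<le> D + 1 * D"
    unfolding abs_mult using 1 2 assms(12,13) by (intro add_mono mult_mono) auto
  finally have "\<bar>(N + T) - (g + s) * (N1 + T1)\<bar> \<le> 4 * D * (1/2)" by simp
  also have "\<dots> \<le> 4 * D * (N1 + T1)" using half D by (intro mult_left_mono) auto
  finally have "\<bar>(N + T) - (g + s) * (N1 + T1)\<bar> / (N1 + T1) \<le> 4 * D"
    using half by (simp add: divide_le_eq)
  moreover have "(N + T) / (N1 + T1) - (g + s) = ((N + T) - (g + s) * (N1 + T1)) / (N1 + T1)"
    using half by (simp add: diff_divide_distrib)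
  ultimately show "\<bar>(N + T) / (N1 + T1) - (g + s)\<bar> \<le> 4 * (\<eta> + 6 * t)"
    using half by (simp add: abs_divide D_def)
qed

lemma integral_near_one:
  fixes v :: "'a::euclidean_space \<Rightarrow> real"
  assumes S[measurable]: "S \<in> sets borel" and [measurable]: "v \<in> borel_measurable borel"
    and v: "\<And>z. z \<in> S \<Longrightarrow> \<bar>v z - 1\<bar> \<le> \<eta>" and \<eta>: "0 \<le> \<eta>"
  obtains N where "(\<integral>\<^sup>+z. indicator S z * ennreal (v z) \<partial>std_gaussian) = ennreal N" "0 \<le> N"
    "\<bar>N - measure std_gaussian S\<bar> \<le> \<eta>"
proof -
  interpret prob_space "std_gaussian :: 'a measure" by (rule prob_space_std_gaussian)
  let ?I = "\<integral>\<^sup>+z. indicator S z * ennreal (v z) \<partial>std_gaussian"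
  have \<eta>1: "(\<integral>\<^sup>+z. ennreal \<eta> \<partial>(std_gaussian :: 'a measure)) = ennreal \<eta>"
    using emeasure_space_1 by simp
  have S': "(\<integral>\<^sup>+z. indicator S z \<partial>std_gaussian) = ennreal (measure std_gaussian S)"
    by (simp add: emeasure_eq_measure)
  have "?I \<le> (\<integral>\<^sup>+z. indicator S z + ennreal \<eta> \<partial>std_gaussian)"
  proof (intro nn_integral_mono)
    fix z
    show "indicator S z * ennreal (v z) \<le> indicator S z + ennreal \<eta>"
    proof (cases "z \<in> S")
      case True
      then have "ennreal (v z) \<le> ennreal (1 + \<eta>)" using v[OF True] by (intro ennreal_leI) linarith
      then show ?thesis using True \<eta> by simp
    qed simp
  qed
  also have "\<dots> = ennreal (measure std_gaussian S) + ennreal \<eta>"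
    by (subst nn_integral_add) (simp_all only: \<eta>1 S', measurable)
  also have "\<dots> = ennreal (measure std_gaussian S + \<eta>)" using \<eta> by simp
  finally have up: "?I \<le> ennreal (measure std_gaussian S + \<eta>)" .
  then obtain N where N: "?I = ennreal N" "0 \<le> N" by (cases ?I) (auto simp: top_unique)
  have "(\<integral>\<^sup>+z. indicator S z \<partial>std_gaussian) \<le> (\<integral>\<^sup>+z. indicator S z * ennreal (v z) + ennreal \<eta> \<partial>std_gaussian)"
  proof (intro nn_integral_mono)
    fix z
    show "indicator S z \<le> indicator S z * ennreal (v z) + ennreal \<eta>"
    proof (cases "z \<in> S")
      case True
      have "1 \<le> max 0 (v z) + \<eta>" using v[OF True] by linarith
      then have "(1::ennreal) \<le> ennreal (max 0 (v z) + \<eta>)" using ennreal_leI by fastforce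
      also have "\<dots> = ennreal (v z) + ennreal \<eta>" using \<eta> by (simp add: max_def ennreal_neg)
      finally show ?thesis using True by simp
    qed simp
  qed
  also have "\<dots> = ?I + ennreal \<eta>"
    by (subst nn_integral_add) (simp_all only: \<eta>1, measurable)
  finally have "ennreal (measure std_gaussian S) \<le> ennreal (N + \<eta>)" using N \<eta> by (simp add: S')
  then have "measure std_gaussian S \<le> N + \<eta>" using N \<eta> by (subst (asm) ennreal_le_iff) auto
  moreover have "N \<le> measure std_gaussian S + \<eta>"
    using up \<eta> unfolding N by (subst (asm) ennreal_le_iff) auto
  ultimately show ?thesis using that N by (auto simp: abs_le_iff)
qed

text \<open>The reflection \<open>z \<mapsto> - z\<close> preserves the Gaussian measure and \<open>S\<close>, so that \<open>v\<close> may be replaced by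
its even part.\<close>

lemma symmetric_integral_near_one:
  fixes v :: "'a::euclidean_space \<Rightarrow> real"
  assumes S[measurable]: "S \<in> sets borel" and [measurable]: "v \<in> borel_measurable borel"
    and vpos: "\<And>z. 0 \<le> v z"
    and sym: "\<And>z. - z \<in> S \<longleftrightarrow> z \<in> S"
    and v: "\<And>z. z \<in> S \<Longrightarrow> \<bar>(v z + v (- z)) / 2 - 1\<bar> \<le> \<eta>" and \<eta>: "0 \<le> \<eta>"
  obtains N where "(\<integral>\<^sup>+z. indicator S z * ennreal (v z) \<partial>std_gaussian) = ennreal N" "0 \<le> N"
    "\<bar>N - measure std_gaussian S\<bar> \<le> \<eta>"
proof -
  let ?f = "\<lambda>z. indicator S z * ennreal (v z)"
  have refl: "(\<integral>\<^sup>+z. ?f (- z) \<partial>std_gaussian) = (\<integral>\<^sup>+z. ?f z \<partial>std_gaussian)"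
    by (rule gaussian_reflection) measurable
  have "2 * (\<integral>\<^sup>+z. ?f z \<partial>std_gaussian) = (\<integral>\<^sup>+z. ?f z \<partial>std_gaussian) + (\<integral>\<^sup>+z. ?f (- z) \<partial>std_gaussian)"
    unfolding refl by (simp add: mult_2)
  also have "\<dots> = (\<integral>\<^sup>+z. ?f z + ?f (- z) \<partial>std_gaussian)"
    by (rule nn_integral_add[symmetric]) measurable
  also have "\<dots> = (\<integral>\<^sup>+z. 2 * (indicator S z * ennreal ((v z + v (- z)) / 2)) \<partial>std_gaussian)"
  proof (rule nn_integral_cong)
    fix z
    have "ennreal (v z) + ennreal (v (- z)) = 2 * ennreal ((v z + v (- z)) / 2)"
      using vpos[of z] vpos[of "- z"] by (simp add: ennreal_mult[symmetric] flip: ennreal_plus ennreal_numeral)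
    moreover have "indicator S (- z) = (indicator S z :: ennreal)" using sym by (simp add: indicator_def)
    ultimately show "?f z + ?f (- z) = 2 * (indicator S z * ennreal ((v z + v (- z)) / 2))"
      by (simp add: indicator_def)
  qed
  also have "\<dots> = 2 * (\<integral>\<^sup>+z. indicator S z * ennreal ((v z + v (- z)) / 2) \<partial>std_gaussian)"
    by (rule nn_integral_cmult) measurable
  finally have eq: "(\<integral>\<^sup>+z. ?f z \<partial>std_gaussian) = (\<integral>\<^sup>+z. indicator S z * ennreal ((v z + v (- z)) / 2) \<partial>std_gaussian)"
    by (simp add: ennreal_mult_cancel_left)
  have mv: "(\<lambda>z. (v z + v (- z)) / 2) \<in> borel_measurable borel" by measurable
  show ?thesis
    by (rule integral_near_one[OF S mv v \<eta>]) (auto intro: that simp: eq)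
qed

text \<open>The Laplace approximation in normalized coordinates. The space is cut along the ellipsoid of
radius \<open>r0 - 1/4\<close>: inside, the density ratio \<open>v\<close> or its even part is close to 1; outside, both
measures are small by \<open>posterior_tail\<close>.\<close>

theorem laplace_tv:
  fixes \<beta> :: "'a::euclidean_space \<Rightarrow> real" and \<ll> :: "'a \<Rightarrow> real"
  defines "v \<equiv> \<lambda>z. exp (\<ll> z + (norm z)\<^sup>2 / 2)"
  assumes \<beta>: "\<And>b. b \<in> Basis \<Longrightarrow> 0 \<le> \<beta> b" "\<And>b. b \<in> Basis \<Longrightarrow> \<beta> b \<le> 1"
    and W[measurable]: "W \<in> sets borel" and m[measurable]: "\<ll> \<in> borel_measurable borel"
    and conc: "concave_on W \<ll>"
    and loc: "\<And>u. diag_form \<beta> u \<le> r0\<^sup>2 \<Longrightarrow> u \<in> W \<and> \<bar>\<ll> u + (norm u)\<^sup>2 / 2\<bar> \<le> d"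
    and d: "0 \<le> d" "d \<le> 1/64"
    and x: "4 \<le> x" and r: "2 * sqrt (\<Sum>b\<in>Basis. \<beta> b) + sqrt x \<le> r0"
    and A[measurable]: "A \<in> sets borel"
    and \<eta>: "0 \<le> \<eta>" "\<eta> + 6 * exp (- x / 2) \<le> 1/2"
    and err: "(\<forall>z. diag_form \<beta> z \<le> r0\<^sup>2 \<longrightarrow> \<bar>v z - 1\<bar> \<le> \<eta>) \<or>
      (\<forall>z. - z \<in> A \<longleftrightarrow> z \<in> A) \<and> (\<forall>z. diag_form \<beta> z \<le> r0\<^sup>2 \<longrightarrow> \<bar>(v z + v (- z)) / 2 - 1\<bar> \<le> \<eta>)"
  obtains a a1 where "(\<integral>\<^sup>+z. indicator (A \<inter> W) z * ennreal (v z) \<partial>std_gaussian) = ennreal a"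
    "(\<integral>\<^sup>+z. indicator W z * ennreal (v z) \<partial>std_gaussian) = ennreal a1" "0 \<le> a" "0 < a1"
    "\<bar>a / a1 - measure std_gaussian A\<bar> \<le> 4 * (\<eta> + 6 * exp (- x / 2))"
proof -
  interpret prob_space "std_gaussian :: 'a measure" by (rule prob_space_std_gaussian)
  define r where "r = r0 - 1/2"
  have sx: "2 \<le> sqrt x" using real_sqrt_le_mono[OF x] by simp
  have "0 \<le> (\<Sum>b\<in>Basis. \<beta> b)" using \<beta>(1) by (rule sum_nonneg)
  then have r1: "1 \<le> r" using r sx real_sqrt_ge_zero[of "\<Sum>b\<in>Basis. \<beta> b"] unfolding r_def by linarith
  define U where "U = {z. diag_form \<beta> z \<le> (r + 1/4)\<^sup>2}"
  have [measurable]: "diag_form \<beta> \<in> borel_measurable borel" "v \<in> borel_measurable borel"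
    unfolding diag_form_def v_def by measurable
  have U[measurable]: "U \<in> sets borel" unfolding U_def by measurable
  have U0: "diag_form \<beta> z \<le> r0\<^sup>2" if "z \<in> U" for z
  proof -
    have "(r + 1/4)\<^sup>2 \<le> r0\<^sup>2" using r1 unfolding r_def by (intro power_mono) auto
    then show ?thesis using that by (simp add: U_def)
  qed
  have loc': "u \<in> W \<and> \<bar>\<ll> u + (norm u)\<^sup>2 / 2\<bar> \<le> d"
    if "diag_form \<beta> u \<le> (r + 1/2)\<^sup>2" for u
    using loc[of u] that by (simp add: r_def diag_form_def)
  have r': "2 * sqrt (\<Sum>b\<in>Basis. \<beta> b) + sqrt x - 1/2 \<le> r" using r by (simp add: r_def)
  note tails = posterior_tail[OF \<beta> conc loc' d x r']
  have UW: "U \<subseteq> W" using U0 loc by blast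
  have out: "{z \<in> W. (r + 1/4)\<^sup>2 < diag_form \<beta> z} = W - U"
    "{z. (r + 1/4)\<^sup>2 < diag_form \<beta> z} = - U"
    by (auto simp: U_def diag_form_def)
  have Usym: "- z \<in> U \<longleftrightarrow> z \<in> U" for z by (simp add: U_def diag_form_def)
  have vpos: "0 \<le> v z" for z by (simp add: v_def)
  let ?J = "\<lambda>S. \<integral>\<^sup>+z. indicator S z * ennreal (v z) \<partial>std_gaussian"
  have local: "\<exists>N. ?J (B \<inter> U) = ennreal N \<and> 0 \<le> N \<and> \<bar>N - measure std_gaussian (B \<inter> U)\<bar> \<le> \<eta>"
    if [measurable]: "B \<in> sets borel" and B: "B = A \<or> B = UNIV" for B
    using err
  proof
    assume e: "\<forall>z. diag_form \<beta> z \<le> r0\<^sup>2 \<longrightarrow> \<bar>v z - 1\<bar> \<le> \<eta>"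
    show ?thesis
      by (rule integral_near_one[of "B \<inter> U" v \<eta>]) (use e U0 \<eta> in auto)
  next
    assume e: "(\<forall>z. - z \<in> A \<longleftrightarrow> z \<in> A) \<and> (\<forall>z. diag_form \<beta> z \<le> r0\<^sup>2 \<longrightarrow> \<bar>(v z + v (- z)) / 2 - 1\<bar> \<le> \<eta>)"
    show ?thesis
      by (rule symmetric_integral_near_one[of "B \<inter> U" v \<eta>]) (use e U0 \<eta> B Usym vpos in auto)
  qed
  have outer: "\<exists>T. ?J (B \<inter> W - U) = ennreal T \<and> 0 \<le> T \<and> T \<le> 6 * exp (- x / 2)" for B
  proof -
    have "?J (B \<inter> W - U) \<le> ?J (W - U)"
      by (intro nn_integral_mono) (auto simp: indicator_def)
    also have "\<dots> \<le> ennreal (6 * exp (- x / 2))"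
      using tails(1) unfolding out(1) v_def .
    finally have le: "?J (B \<inter> W - U) \<le> ennreal (6 * exp (- x / 2))" .
    then obtain T where "?J (B \<inter> W - U) = ennreal T" "0 \<le> T" by (cases "?J (B \<inter> W - U)") (auto simp: top_unique)
    then show ?thesis using le by (auto simp: ennreal_le_iff)
  qed
  have gout: "measure std_gaussian (B - U) \<le> 2 * exp (- x / 2)" if [measurable]: "B \<in> sets borel" for B
  proof -
    have "emeasure std_gaussian (B - U) \<le> emeasure std_gaussian (- U)"
      by (rule emeasure_mono) auto
    also have "\<dots> \<le> ennreal (2 * exp (- x / 2))"
      using tails(2) unfolding out(2) .
    finally show ?thesis by (simp add: emeasure_eq_measure ennreal_le_iff)
  qed
  have split: "?J (B \<inter> W) = ?J (B \<inter> U) + ?J (B \<inter> W - U)" if [measurable]: "B \<in> sets borel" for B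
  proof -
    have "?J (B \<inter> W) = (\<integral>\<^sup>+z. indicator (B \<inter> U) z * ennreal (v z) + indicator (B \<inter> W - U) z * ennreal (v z) \<partial>std_gaussian)"
      using UW by (intro nn_integral_cong) (auto simp: indicator_def)
    then show ?thesis by (simp add: nn_integral_add)
  qed
  have gsplit: "measure std_gaussian B = measure std_gaussian (B \<inter> U) + measure std_gaussian (B - U)"
    if [measurable]: "B \<in> sets borel" for B
    by (subst finite_measure_Union[symmetric]) (auto intro!: arg_cong[where f = "measure std_gaussian"])
  obtain N T N1 T1 where N: "?J (A \<inter> U) = ennreal N" "0 \<le> N" "\<bar>N - measure std_gaussian (A \<inter> U)\<bar> \<le> \<eta>"
    and N1: "?J (UNIV \<inter> U) = ennreal N1" "0 \<le> N1" "\<bar>N1 - measure std_gaussian (UNIV \<inter> U)\<bar> \<le> \<eta>"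
    and T: "?J (A \<inter> W - U) = ennreal T" "0 \<le> T" "T \<le> 6 * exp (- x / 2)"
    and T1: "?J (UNIV \<inter> W - U) = ennreal T1" "0 \<le> T1" "T1 \<le> 6 * exp (- x / 2)"
    using local[of A] local[of UNIV] outer[of A] outer[of UNIV] by auto
  have g1: "measure std_gaussian (UNIV \<inter> U) + measure std_gaussian (UNIV - U) = (1::real)"
    using gsplit[of UNIV] prob_space by simp
  have ga: "0 \<le> measure std_gaussian (A \<inter> U) + measure std_gaussian (A - U)"
    "measure std_gaussian (A \<inter> U) + measure std_gaussian (A - U) \<le> 1"
    unfolding gsplit[OF A, symmetric] by (auto intro: prob_le_1)
  note cmp = normalized_comparison[OF N(3) N1(3) T(2,3) T1(2,3) measure_nonneg gout[OF A] measure_nonneg gout g1 ga \<eta>(2)]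
  show ?thesis
  proof (rule that[of "N + T" "N1 + T1"])
    show "?J (A \<inter> W) = ennreal (N + T)" using split[OF A] N T by simp
    show "?J W = ennreal (N1 + T1)" using split[of UNIV] N1 T1 by simp
    show "0 \<le> N + T" using N T by simp
    show "0 < N1 + T1" using cmp(1) by simp
    show "\<bar>(N + T) / (N1 + T1) - measure std_gaussian A\<bar> \<le> 4 * (\<eta> + 6 * exp (- x / 2))"
      unfolding gsplit[OF A] using cmp(2) by simp
  qed
qed

section \<open>The log-likelihood and its information operators\<close>

lemma Phi_eq: "Phi m \<upsilon> = lam m / 2 * (norm (snd \<upsilon> - fwd m (fst \<upsilon>)))\<^sup>2"
  by (simp add: Phi_def split: prod.split)

text \<open>The costs below are the negated log-likelihoods, written as \<open>Phi\<close> plus squared norms of affine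
functions of \<open>\<upsilon>\<close>; only \<open>Phi\<close> contributes to derivatives of order three and higher.\<close>

definition neg_loglik ::
  "('x::euclidean_space, 'y::euclidean_space) inverse_model \<Rightarrow> 'y \<Rightarrow> 'x \<times> 'y \<Rightarrow> real" where
  "neg_loglik m y \<upsilon> = Phi m \<upsilon> + 1 / (2 * (sig m)\<^sup>2) * (norm (snd \<upsilon> - y))\<^sup>2"

definition neg_loglik_G ::
  "('x::euclidean_space, 'y::euclidean_space) inverse_model \<Rightarrow> 'y \<Rightarrow> 'x \<times> 'y \<Rightarrow> real" where
  "neg_loglik_G m y \<upsilon> = neg_loglik m y \<upsilon> + (1 / 2 * (norm (G m (fst \<upsilon>) - G m (prior_f m)))\<^sup>2
     + 1 / 2 * (norm (Gam m (snd \<upsilon>) - Gam m (prior_g m)))\<^sup>2)"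

lemma loglik_eq: "loglik m y \<upsilon> = - neg_loglik m y \<upsilon>"
  by (simp add: loglik_def neg_loglik_def Phi_eq norm_minus_commute[of y] split: prod.split)

text \<open>Changing the data changes the cost by an affine function of \<open>\<upsilon>\<close> only. This is why the Hessian
and the concavity of the expected log-likelihood pass to every realisation.\<close>

lemma neg_loglik_shift:
  "neg_loglik m y \<upsilon> = neg_loglik m c \<upsilon> + 1 / (2 * (sig m)\<^sup>2) * ((norm (y - c))\<^sup>2 + 2 * ((y - c) \<bullet> (c - snd \<upsilon>)))"
proof -
  have "snd \<upsilon> - y = (snd \<upsilon> - c) - (y - c)" by simp
  then have "(norm (snd \<upsilon> - y))\<^sup>2 = (norm (snd \<upsilon> - c))\<^sup>2 + ((norm (y - c))\<^sup>2 + 2 * ((y - c) \<bullet> (c - snd \<upsilon>)))"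
    unfolding power2_norm_eq_inner
    by (simp only: inner_diff_left inner_diff_right) (simp add: inner_commute algebra_simps)
  then show ?thesis unfolding neg_loglik_def by (simp only: distrib_left)
qed

locale inverse_problem =
  fixes m :: "('x::euclidean_space, 'y::euclidean_space) inverse_model"
  assumes sm: "smooth (fwd m)" and sig: "0 < sig m" and G: "op_pd (G m)" and Gam: "op_pd (Gam m)"
begin

lemma lin: "linear (G m)" "linear (Gam m)"
  using G Gam unfolding op_pd_def op_symmetric_def by auto

lemma loglik_G_eq:
  "loglik_G m y \<upsilon> = - neg_loglik_G m y \<upsilon>"
  using lin by (simp add: loglik_G_def neg_loglik_G_def loglik_eq linear_diff split: prod.split)

lemma smooth_Phi: "smooth (Phi m)"
proof -
  have "smooth (\<lambda>\<upsilon>. lam m / 2 * ((snd \<upsilon> - fwd m (fst \<upsilon>)) \<bullet> (snd \<upsilon> - fwd m (fst \<upsilon>))))"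
    by (intro smooth_cmult smooth_inner smooth_diff smooth_compose_fst sm smooth_linear linear_snd)
  then show ?thesis by (simp add: Phi_eq[abs_def] power2_norm_eq_inner)
qed

lemma smooth_neg_loglik:
  shows "smooth (neg_loglik m c)"
    and "hessian (neg_loglik m c) \<upsilon> u \<bullet> w = hessian (Phi m) \<upsilon> u \<bullet> w + 1 / (sig m)\<^sup>2 * (snd u \<bullet> snd w)"
proof -
  note sq = hessian_square[where K = snd and c = "1 / (2 * (sig m)\<^sup>2)" and d = c, OF linear_snd]
  have eq: "neg_loglik m c = (\<lambda>\<upsilon>. Phi m \<upsilon> + 1 / (2 * (sig m)\<^sup>2) * (norm (snd \<upsilon> - c))\<^sup>2)"
    by (rule ext) (rule neg_loglik_def)
  show "smooth (neg_loglik m c)" unfolding eq by (rule smooth_add[OF smooth_Phi sq(1)])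
  show "hessian (neg_loglik m c) \<upsilon> u \<bullet> w = hessian (Phi m) \<upsilon> u \<bullet> w + 1 / (sig m)\<^sup>2 * (snd u \<bullet> snd w)"
    unfolding eq hessian_add[OF smooth_Phi sq(1)] inner_add_left sq(2) by simp
qed

lemma smooth_neg_loglik_G:
  shows "smooth (neg_loglik_G m c)"
    and "hessian (neg_loglik_G m c) \<upsilon> u \<bullet> w = hessian (neg_loglik m c) \<upsilon> u \<bullet> w
      + (G m (fst u) \<bullet> G m (fst w) + Gam m (snd u) \<bullet> Gam m (snd w))"
proof -
  note sL = smooth_neg_loglik(1)[of c]
  have l1: "linear (\<lambda>u. G m (fst u))" using linear_compose[OF linear_fst lin(1)] by (simp add: o_def)
  have l2: "linear (\<lambda>u. Gam m (snd u))" using linear_compose[OF linear_snd lin(2)] by (simp add: o_def)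
  note sq1 = hessian_square[where c = "1 / 2" and d = "G m (prior_f m)", OF l1]
  note sq2 = hessian_square[where c = "1 / 2" and d = "Gam m (prior_g m)", OF l2]
  note s12 = smooth_add[OF sq1(1) sq2(1)]
  have eq: "neg_loglik_G m c = (\<lambda>\<upsilon>. neg_loglik m c \<upsilon> + (1 / 2 * (norm (G m (fst \<upsilon>) - G m (prior_f m)))\<^sup>2
     + 1 / 2 * (norm (Gam m (snd \<upsilon>) - Gam m (prior_g m)))\<^sup>2))"
    by (rule ext) (rule neg_loglik_G_def)
  show "smooth (neg_loglik_G m c)" unfolding eq by (rule smooth_add[OF sL s12])
  show "hessian (neg_loglik_G m c) \<upsilon> u \<bullet> w = hessian (neg_loglik m c) \<upsilon> u \<bullet> w
      + (G m (fst u) \<bullet> G m (fst w) + Gam m (snd u) \<bullet> Gam m (snd w))"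
    unfolding eq hessian_add[OF sL s12] hessian_add[OF sq1(1) sq2(1)] inner_add_left sq1(2) sq2(2) by simp
qed

lemma third_derivative_neg_loglik_G:
  "(dirD u ^^ 3) (neg_loglik_G m y) = (dirD u ^^ 3) (Phi m)"
proof
  fix \<upsilon>
  note s\<Psi> = smooth_neg_loglik_G(1)[of y]
  note s\<Phi> = smooth_Phi
  define k where "k = G m (fst u) \<bullet> G m (fst u) + Gam m (snd u) \<bullet> Gam m (snd u) + 1 / (sig m)\<^sup>2 * (snd u \<bullet> snd u)"
  have "dirD u (dirD u (neg_loglik_G m y)) = (\<lambda>\<upsilon>. dirD u (dirD u (Phi m)) \<upsilon> + k)"
    by (simp add: fun_eq_iff k_def smooth_neg_loglik_G(2) smooth_neg_loglik(2)
        flip: hessian_form[OF s\<Psi>] hessian_form[OF s\<Phi>])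
  moreover have "((\<lambda>\<upsilon>. dirD u (dirD u (Phi m)) \<upsilon> + k) has_derivative
      (\<lambda>w. dirD w (dirD u (dirD u (Phi m))) \<upsilon> + 0)) (at \<upsilon>)"
    by (intro has_derivative_add smooth_has_derivative smooth_dirD s\<Phi> has_derivative_const)
  ultimately have "dirD u (dirD u (dirD u (neg_loglik_G m y))) \<upsilon> = dirD u (dirD u (dirD u (Phi m))) \<upsilon>"
    by (simp only: dirD_eq add_0_right)
  then show "(dirD u ^^ 3) (neg_loglik_G m y) \<upsilon> = (dirD u ^^ 3) (Phi m) \<upsilon>" by (simp add: numeral_3_eq_3)
qed

lemma borel_measurable_loglik_G [measurable]: "loglik_G m y \<in> borel_measurable borel"
proof (rule borel_measurable_continuous_onI)
  have "loglik_G m y = (\<lambda>\<upsilon>. - neg_loglik_G m y \<upsilon>)" by (rule ext) (rule loglik_G_eq)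
  then show "continuous_on UNIV (loglik_G m y)"
    using smooth_continuous[OF smooth_neg_loglik_G(1)] by (simp add: continuous_on_minus)
qed

text \<open>Unnormalized posterior integrals in the coordinates \<open>\<upsilon> = v + T z\<close>, relative to the Gaussian
measure. The constant \<open>k\<close> cancels in ratios.\<close>

lemma posterior_in_frame:
  fixes T :: "'x \<times> 'y \<Rightarrow> 'x \<times> 'y"
  assumes op: "open (pset m)" and T: "linear T" "bij T"
  obtains k where "0 < k" and "\<And>S. S \<in> sets borel \<Longrightarrow>
    (\<integral>\<^sup>+z. indicator ({z. T z \<in> S} \<inter> {z. v + T z \<in> pset m}) z
        * ennreal (exp ((loglik_G m y (v + T z) - loglik_G m y v) + (norm z)\<^sup>2 / 2)) \<partial>std_gaussian)
    = ennreal k * (\<integral>\<^sup>+\<upsilon>. indicator {\<upsilon>. \<upsilon> - v \<in> S} \<upsilon> * (ennreal (exp (loglik_G m y \<upsilon>)) * indicator (pset m) \<upsilon>) \<partial>lborel)"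
proof -
  let ?L = "loglik_G m y"
  have [measurable]: "T \<in> borel_measurable borel" by (rule borel_measurable_linear[OF T(1)])
  have [measurable]: "pset m \<in> sets borel" using op by simp
  obtain c where c: "0 < c" "c < \<infinity>" "\<And>f. f \<in> borel_measurable borel \<Longrightarrow>
      (\<integral>\<^sup>+x. f (T x) \<partial>lborel) = c * (\<integral>\<^sup>+x. f x \<partial>lborel :: ennreal)"
    by (rule nn_integral_linear_bij[OF T]) blast
  obtain c' where c': "c = ennreal c'" "0 < c'" using c(1,2) by (cases c) auto
  define \<kappa> where "\<kappa> = (1 / sqrt (2 * pi)) ^ DIM('x \<times> 'y)"
  have \<kappa>: "0 < \<kappa>" by (simp add: \<kappa>_def)
  define k where "k = \<kappa> * c' * exp (- ?L v)"
  show ?thesis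
  proof (rule that[of k])
    show "0 < k" using c' \<kappa> by (simp add: k_def)
    fix S :: "('x \<times> 'y) set" assume [measurable]: "S \<in> sets borel"
    let ?g = "\<lambda>u. indicator S u * (ennreal (exp (?L (v + u))) * indicator (pset m) (v + u))"
    have "(\<integral>\<^sup>+z. indicator ({z. T z \<in> S} \<inter> {z. v + T z \<in> pset m}) z
        * ennreal (exp ((?L (v + T z) - ?L v) + (norm z)\<^sup>2 / 2)) \<partial>std_gaussian)
      = ennreal \<kappa> * (\<integral>\<^sup>+z. (indicator ({z. T z \<in> S} \<inter> {z. v + T z \<in> pset m}) z
        * ennreal (exp ((?L (v + T z) - ?L v) + (norm z)\<^sup>2 / 2))) * ennreal (exp (- (norm z)\<^sup>2 / 2)) \<partial>lborel)"
      unfolding \<kappa>_def by (rule nn_integral_std_gaussian) measurable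
    also have "\<dots> = ennreal \<kappa> * (\<integral>\<^sup>+z. ennreal (exp (- ?L v)) * ?g (T z) \<partial>lborel)"
    proof -
      have "(indicator ({z. T z \<in> S} \<inter> {z. v + T z \<in> pset m}) z
        * ennreal (exp ((?L (v + T z) - ?L v) + (norm z)\<^sup>2 / 2))) * ennreal (exp (- (norm z)\<^sup>2 / 2))
        = ennreal (exp (- ?L v)) * ?g (T z)" for z
      proof -
        have "ennreal (exp ((?L (v + T z) - ?L v) + (norm z)\<^sup>2 / 2)) * ennreal (exp (- (norm z)\<^sup>2 / 2))
            = ennreal (exp (- ?L v)) * ennreal (exp (?L (v + T z)))"
          by (simp add: ennreal_mult[symmetric] flip: exp_add)
        then show ?thesis by (auto simp: indicator_def)
      qed
      then show ?thesis by simp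
    qed
    also have "\<dots> = ennreal \<kappa> * (ennreal (exp (- ?L v)) * (\<integral>\<^sup>+z. ?g (T z) \<partial>lborel))"
      by (subst nn_integral_cmult) measurable
    also have "(\<integral>\<^sup>+z. ?g (T z) \<partial>lborel) = c * (\<integral>\<^sup>+u. ?g u \<partial>lborel)"
      by (rule c(3)) measurable
    also have "(\<integral>\<^sup>+u. ?g u \<partial>lborel) = (\<integral>\<^sup>+u. indicator {\<upsilon>. \<upsilon> - v \<in> S} (v + u) *
        (ennreal (exp (?L (v + u))) * indicator (pset m) (v + u)) \<partial>lborel)"
      by (intro nn_integral_cong) (simp add: indicator_def)
    also have "\<dots> = (\<integral>\<^sup>+\<upsilon>. indicator {\<upsilon>. \<upsilon> - v \<in> S} \<upsilon> * (ennreal (exp (?L \<upsilon>)) * indicator (pset m) \<upsilon>) \<partial>lborel)"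
      by (rule nn_integral_lborel_translate) measurable
    finally show "(\<integral>\<^sup>+z. indicator ({z. T z \<in> S} \<inter> {z. v + T z \<in> pset m}) z
        * ennreal (exp ((?L (v + T z) - ?L v) + (norm z)\<^sup>2 / 2)) \<partial>std_gaussian)
      = ennreal k * (\<integral>\<^sup>+\<upsilon>. indicator {\<upsilon>. \<upsilon> - v \<in> S} \<upsilon> * (ennreal (exp (?L \<upsilon>)) * indicator (pset m) \<upsilon>) \<partial>lborel)"
      using \<kappa> c' by (simp add: k_def ennreal_mult mult_ac)
  qed
qed

lemma emeasure_posterior:
  assumes op: "open (pset m)" and B[measurable]: "B \<in> sets borel"
  shows "emeasure (posterior_f m y) B =
    (\<integral>\<^sup>+\<upsilon>. indicator B (fst \<upsilon>) * (ennreal (exp (loglik_G m y \<upsilon>)) * indicator (pset m) \<upsilon>) \<partial>lborel)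
    / (\<integral>\<^sup>+\<upsilon>. ennreal (exp (loglik_G m y \<upsilon>)) * indicator (pset m) \<upsilon> \<partial>lborel)"
proof -
  have [measurable]: "pset m \<in> sets borel" using op by simp
  have f[measurable]: "(fst :: 'x \<times> 'y \<Rightarrow> 'x) \<in> borel_measurable borel"
    by (rule borel_measurable_linear[OF linear_fst])
  let ?Z = "\<integral>\<^sup>+\<upsilon>. ennreal (exp (loglik_G m y \<upsilon>)) * indicator (pset m) \<upsilon> \<partial>lborel"
  have "emeasure (posterior_f m y) B = emeasure (posterior m y) {\<upsilon>. fst \<upsilon> \<in> B}"
    unfolding posterior_f_def by (subst emeasure_distr) (auto simp: posterior_def Let_def vimage_def)
  also have "\<dots> = (\<integral>\<^sup>+\<upsilon>. ennreal (exp (loglik_G m y \<upsilon>)) * indicator (pset m) \<upsilon> / ?Z * indicator {\<upsilon>. fst \<upsilon> \<in> B} \<upsilon> \<partial>lborel)"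
    unfolding posterior_def Let_def by (subst emeasure_density) auto
  also have "\<dots> = (\<integral>\<^sup>+\<upsilon>. indicator B (fst \<upsilon>) * (ennreal (exp (loglik_G m y \<upsilon>)) * indicator (pset m) \<upsilon>) / ?Z \<partial>lborel)"
    by (intro nn_integral_cong) (simp add: indicator_def)
  also have "\<dots> = (\<integral>\<^sup>+\<upsilon>. indicator B (fst \<upsilon>) * (ennreal (exp (loglik_G m y \<upsilon>)) * indicator (pset m) \<upsilon>) \<partial>lborel) / ?Z"
    by (rule nn_integral_divide) measurable
  finally show ?thesis .
qed

lemma gauss_error_le_1:
  assumes op: "open (pset m)" and B[measurable]: "B \<in> sets borel"
  shows "gauss_error m P Y y v B \<le> 1"
proof -
  let ?L = "loglik_G m y"
  have [measurable]: "pset m \<in> sets borel" using op by simp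
  let ?Z = "\<integral>\<^sup>+\<upsilon>. ennreal (exp (?L \<upsilon>)) * indicator (pset m) \<upsilon> \<partial>lborel"
  have "emeasure (posterior_f m y) {f. f - fst v \<in> B} =
      (\<integral>\<^sup>+\<upsilon>. indicator {f. f - fst v \<in> B} (fst \<upsilon>) * (ennreal (exp (?L \<upsilon>)) * indicator (pset m) \<upsilon>) \<partial>lborel) / ?Z"
    by (rule emeasure_posterior[OF op]) measurable
  also have "\<dots> \<le> ?Z / ?Z"
    by (intro divide_right_mono_ennreal nn_integral_mono) (auto simp: indicator_def)
  also have "\<dots> \<le> 1"
    by (cases "?Z = 0 \<or> ?Z = \<top>") (auto simp: ennreal_divide_self less_top)
  finally have "measure (posterior_f m y) {f. f - fst v \<in> B} \<le> 1"
    unfolding measure_def by (metis enn2real_1 enn2real_mono ennreal_one_less_top)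
  moreover have "measure std_gaussian {\<gamma>. inv (op_sqrt (marg_f m P Y v)) \<gamma> \<in> B} \<le> 1"
    by (rule prob_space.prob_le_1[OF prob_space_std_gaussian])
  moreover have "0 \<le> measure (posterior_f m y) {f. f - fst v \<in> B}"
    "0 \<le> measure std_gaussian {\<gamma>. inv (op_sqrt (marg_f m P Y v)) \<gamma> \<in> B}" by simp_all
  ultimately show ?thesis unfolding gauss_error_def by linarith
qed

end

text \<open>Square integrability of the data is needed since otherwise the expected log-likelihood would be
the default value 0 of the integral.\<close>

locale observed_model = inverse_problem m
  for m :: "('x::euclidean_space, 'y::euclidean_space) inverse_model" +
  fixes P :: "'w measure" and Y :: "'w \<Rightarrow> 'y"
  assumes P: "prob_space P" and Y: "integrable P Y"
    and Y2: "integrable P (\<lambda>\<omega>. (norm (Y \<omega> - (\<integral>\<omega>. Y \<omega> \<partial>P)))\<^sup>2)"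
    and L: "cond_L m P Y"
begin

abbreviation "mean \<equiv> \<integral>\<omega>. Y \<omega> \<partial>P"

abbreviation "noise_energy \<equiv> 1 / (2 * (sig m)\<^sup>2) * (\<integral>\<omega>. (norm (Y \<omega> - mean))\<^sup>2 \<partial>P)"

lemma pset_open: "open (pset m)" and E_loglik_G_concave: "concave_on (pset m) (E_loglik_G m P Y)"
  using L by (auto simp: cond_L_def)

lemma E_loglik_eq:
  shows "integrable P (\<lambda>\<omega>. loglik m (Y \<omega>) \<upsilon>)"
    and "E_loglik m P Y \<upsilon> = - neg_loglik m mean \<upsilon> - noise_energy"
proof -
  interpret prob_space P by (rule P)
  let ?k = "1 / (2 * (sig m)\<^sup>2)"
  have Yc: "integrable P (\<lambda>\<omega>. Y \<omega> - mean)" using Y by simp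
  have Y1: "integrable P (\<lambda>\<omega>. (Y \<omega> - mean) \<bullet> (mean - snd \<upsilon>))" by (rule integrable_inner_left) (rule Yc)
  have eq: "loglik m (Y \<omega>) \<upsilon> = - neg_loglik m mean \<upsilon> - ?k * ((norm (Y \<omega> - mean))\<^sup>2 + 2 * ((Y \<omega> - mean) \<bullet> (mean - snd \<upsilon>)))" for \<omega>
    unfolding loglik_eq neg_loglik_shift[of m "Y \<omega>" \<upsilon> mean] by simp
  show "integrable P (\<lambda>\<omega>. loglik m (Y \<omega>) \<upsilon>)"
    unfolding eq using Y2 Y1 by simp
  have "(\<integral>\<omega>. (Y \<omega> - mean) \<bullet> (mean - snd \<upsilon>) \<partial>P) = (\<integral>\<omega>. Y \<omega> - mean \<partial>P) \<bullet> (mean - snd \<upsilon>)"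
    by (rule integral_inner_left) (rule Yc)
  also have "(\<integral>\<omega>. Y \<omega> - mean \<partial>P) = 0" using Y prob_space by simp
  finally have z: "(\<integral>\<omega>. (Y \<omega> - mean) \<bullet> (mean - snd \<upsilon>) \<partial>P) = 0" by simp
  show "E_loglik m P Y \<upsilon> = - neg_loglik m mean \<upsilon> - noise_energy"
    unfolding E_loglik_def eq using Y2 Y1 prob_space by (simp add: z)
qed

lemma E_loglik_G_eq:
  "E_loglik_G m P Y \<upsilon> = - neg_loglik_G m mean \<upsilon> - noise_energy"
proof -
  interpret prob_space P by (rule P)
  note E = E_loglik_eq[of \<upsilon>]
  let ?p = "1 / 2 * (norm (G m (fst \<upsilon>) - G m (prior_f m)))\<^sup>2 + 1 / 2 * (norm (Gam m (snd \<upsilon>) - Gam m (prior_g m)))\<^sup>2"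
  have "loglik_G m (Y \<omega>) \<upsilon> = loglik m (Y \<omega>) \<upsilon> - ?p" for \<omega>
    unfolding loglik_G_eq neg_loglik_G_def loglik_eq by simp
  then have "E_loglik_G m P Y \<upsilon> = E_loglik m P Y \<upsilon> - ?p"
    unfolding E_loglik_G_def E_loglik_def using E(1) prob_space by simp
  then show ?thesis unfolding E(2) neg_loglik_G_def by simp
qed

lemma info_form:
  shows "linear (info m P Y \<upsilon>)"
    and "info m P Y \<upsilon> u \<bullet> w = hessian (Phi m) \<upsilon> u \<bullet> w + 1 / (sig m)\<^sup>2 * (snd u \<bullet> snd w)"
proof -
  note s = smooth_neg_loglik[of mean]
  have eq: "info m P Y \<upsilon> = hessian (neg_loglik m mean) \<upsilon>"
    unfolding info_def E_loglik_eq(2)[abs_def] by (rule ext) (rule hessian_const_minus[OF s(1)])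
  show "linear (info m P Y \<upsilon>)" unfolding eq by (rule linear_hessian[OF s(1)])
  show "info m P Y \<upsilon> u \<bullet> w = hessian (Phi m) \<upsilon> u \<bullet> w + 1 / (sig m)\<^sup>2 * (snd u \<bullet> snd w)"
    unfolding eq by (rule s(2))
qed

lemma info_G_eq_hessian: "info_G m P Y \<upsilon> = hessian (neg_loglik_G m mean) \<upsilon>"
  unfolding info_G_def E_loglik_G_eq[abs_def]
  by (rule ext) (rule hessian_const_minus[OF smooth_neg_loglik_G(1)])

lemma info_G_form:
  "info_G m P Y \<upsilon> u \<bullet> w = info m P Y \<upsilon> u \<bullet> w
    + (G m (fst u) \<bullet> G m (fst w) + Gam m (snd u) \<bullet> Gam m (snd w))"
  unfolding info_G_eq_hessian smooth_neg_loglik_G(2) info_form(2) smooth_neg_loglik(2) by simp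

lemma info_G_pd:
  assumes psd: "op_psd (info m P Y \<upsilon>)"
  shows "op_pd (info_G m P Y \<upsilon>)"
proof -
  have nz: "G m a \<noteq> 0" if "a \<noteq> 0" for a using G that unfolding op_pd_def by (metis inner_zero_left less_irrefl)
  have nz': "Gam m a \<noteq> 0" if "a \<noteq> 0" for a using Gam that unfolding op_pd_def by (metis inner_zero_left less_irrefl)
  show ?thesis
    unfolding op_pd_def op_symmetric_def
  proof (intro conjI allI impI)
    show "linear (info_G m P Y \<upsilon>)"
      unfolding info_G_eq_hessian by (rule linear_hessian[OF smooth_neg_loglik_G(1)])
    show "info_G m P Y \<upsilon> u \<bullet> w = u \<bullet> info_G m P Y \<upsilon> w" for u w
      using hessian_symmetric[OF smooth_neg_loglik_G(1)] unfolding info_G_eq_hessian op_symmetric_def by blast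
  next
    fix u :: "'x \<times> 'y" assume u: "u \<noteq> 0"
    have "0 \<le> info m P Y \<upsilon> u \<bullet> u" using psd unfolding op_psd_def by blast
    moreover have "0 < G m (fst u) \<bullet> G m (fst u) + Gam m (snd u) \<bullet> Gam m (snd u)"
    proof (cases "fst u = 0")
      case True
      then have "snd u \<noteq> 0" using u by (simp add: prod_eq_iff)
      then show ?thesis using nz' by (simp add: add_nonneg_pos)
    next
      case False
      then show ?thesis using nz by (simp add: add_pos_nonneg)
    qed
    ultimately show "0 < info_G m P Y \<upsilon> u \<bullet> u" unfolding info_G_form by linarith
  qed
qed

lemma concave_loglik_G: "concave_on (pset m) (loglik_G m y)"
proof -
  let ?a = "\<lambda>\<upsilon>. 1 / (2 * (sig m)\<^sup>2) * ((norm (y - mean))\<^sup>2 + 2 * ((y - mean) \<bullet> (mean - snd \<upsilon>)))"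
  have eq: "loglik_G m y \<upsilon> = E_loglik_G m P Y \<upsilon> + (noise_energy - ?a \<upsilon>)" for \<upsilon>
    unfolding loglik_G_eq E_loglik_G_eq neg_loglik_G_def
      neg_loglik_shift[of m y \<upsilon> mean] by simp
  have aff: "concave_on (pset m) (\<lambda>\<upsilon>. noise_energy - ?a \<upsilon>)"
  proof -
    have W: "convex (pset m)" using E_loglik_G_concave by (rule concave_on_imp_convex)
    have affine: "V - k * (N + 2 * (e \<bullet> (c - snd (s *\<^sub>R p + t *\<^sub>R w))))
        = s * (V - k * (N + 2 * (e \<bullet> (c - snd p)))) + t * (V - k * (N + 2 * (e \<bullet> (c - snd w))))"
      if st: "s + t = 1" for k N s t V and e c :: 'y and p w :: "'x \<times> 'y"
    proof -
      have s: "s = 1 - t" using st by simp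
      show ?thesis unfolding s by (simp add: inner_diff_right inner_add_right algebra_simps)
    qed
    show ?thesis unfolding concave_on_iff using W by (auto simp only: affine)
  qed
  show ?thesis unfolding eq[abs_def] by (rule concave_on_add[OF E_loglik_G_concave aff])
qed

section \<open>Localization of the maximizer\<close>

lemma maximizer_optimal:
  assumes "is_arg_max f (\<lambda>\<upsilon>. \<upsilon> \<in> A) v" "w \<in> A"
  shows "f w \<le> (f v :: real)"
  using assms unfolding is_arg_max_def by (meson not_less)

text \<open>Let \<open>u\<close> point from \<open>\<upsilon>s\<close> to \<open>v\<close> and have length \<open>r\<close> in the metric of \<open>F\<^sub>G\<close>, and suppose that \<open>v\<close>
lies beyond \<open>\<upsilon>s + u\<close>. Along this ray the expected cost \<open>?J\<close> has slope 0 at \<open>\<upsilon>s\<close> and second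
derivative at least \<open>r\<^sup>2 - d\<close> up to \<open>\<upsilon>s + u\<close>, while by the Cauchy-Schwarz inequality for \<open>F\<^sub>G\<close> the
noise contributes a slope of at most \<open>(1 - \<rho>) r\<^sup>2\<close>. Hence the realized cost \<open>H\<close> is nondecreasing at
\<open>\<upsilon>s + u\<close> with positive curvature and increases strictly just beyond. This contradicts its
convexity, as \<open>v\<close> is a minimizer further out. The curvature is needed because the slope may
vanish when \<open>\<rho> = 0\<close>.\<close>

theorem maximizer_localized:
  assumes mxs: "is_arg_max (E_loglik_G m P Y) (\<lambda>\<upsilon>. \<upsilon> \<in> pset m) \<upsilon>s"
    and mx: "is_arg_max (loglik_G m y) (\<lambda>\<upsilon>. \<upsilon> \<in> pset m) v"
    and psd: "\<And>\<upsilon>. \<upsilon> \<in> V \<Longrightarrow> op_psd (info m P Y \<upsilon>)"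
    and ball: "{\<upsilon>. norm (DD_G m P Y \<upsilon>s (\<upsilon> - \<upsilon>s)) \<le> r} \<subseteq> V" and V: "V \<subseteq> pset m"
    and r: "0 < r"
    and d: "\<And>\<upsilon> u. norm (DD_G m P Y \<upsilon>s (\<upsilon> - \<upsilon>s)) \<le> r \<Longrightarrow> norm (DD_G m P Y \<upsilon>s u) \<le> r
      \<Longrightarrow> \<bar>dir_deriv 3 u (Phi m) \<upsilon>\<bar> \<le> d"
    and dr: "3 * d \<le> \<rho> * r\<^sup>2" and \<rho>1: "\<rho> \<le> 1/2"
    and S: "op_symmetric S" and x: "0 \<le> x"
  defines "e \<equiv> (1 / sig m) *\<^sub>R (y - mean)"
  assumes noise: "1 / (sig m)\<^sup>2 * (e \<bullet> marg_g_inv m P Y \<upsilon>s e) \<le> (zq (B_SG m P Y S \<upsilon>s) x)\<^sup>2"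
    and z: "zq (B_SG m P Y S \<upsilon>s) x \<le> (1 - \<rho>) * r"
  shows "v \<in> V"
proof (rule ccontr)
  assume notV: "v \<notin> V"
  let ?J = "neg_loglik_G m mean" and ?K = "neg_loglik_G m y" and ?FG = "info_G m P Y \<upsilon>s"
  note sJ = smooth_neg_loglik_G(1)[of mean]
  have Jmin: "?J \<upsilon>s \<le> ?J w" if "w \<in> pset m" for w
  proof -
    have "E_loglik_G m P Y w \<le> E_loglik_G m P Y \<upsilon>s" by (rule maximizer_optimal[OF mxs that])
    then show ?thesis unfolding E_loglik_G_eq by simp
  qed
  have vs: "\<upsilon>s \<in> pset m" using mxs by (simp add: is_arg_max_def)
  note first = interior_min_conditions[OF sJ pset_open vs Jmin]
  have FGh: "?FG = hessian ?J \<upsilon>s" by (rule info_G_eq_hessian)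
  have FGform: "?FG u \<bullet> u = dirD u (dirD u ?J) \<upsilon>s" for u unfolding FGh by (rule hessian_form[OF sJ])
  have FGpsd: "op_psd ?FG"
    unfolding op_psd_def using hessian_symmetric[OF sJ, of \<upsilon>s] first(2) by (simp add: FGh hessian_form[OF sJ])
  have nD: "(norm (DD_G m P Y \<upsilon>s u))\<^sup>2 = ?FG u \<bullet> u" for u
    unfolding DD_G_def by (rule norm_op_sqrt[OF FGpsd])
  have linFG: "linear ?FG" using FGpsd unfolding op_psd_def op_symmetric_def by auto
  have Dscale: "norm (DD_G m P Y \<upsilon>s (a *\<^sub>R u)) = \<bar>a\<bar> * norm (DD_G m P Y \<upsilon>s u)" for a u
  proof -
    have "linear (DD_G m P Y \<upsilon>s)" using op_sqrt_props(1)[OF FGpsd] unfolding DD_G_def op_psd_def op_symmetric_def by auto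
    then show ?thesis by (simp add: linear_scale)
  qed
  have D0: "DD_G m P Y \<upsilon>s 0 = 0" using Dscale[of 0 0] by simp
  have \<rho>: "0 \<le> \<rho>" "\<rho> \<le> 1/2"
  proof -
    have "0 \<le> d" using d[of \<upsilon>s 0] D0 r by simp
    then have "0 \<le> \<rho> * r\<^sup>2" using dr by linarith
    then show "0 \<le> \<rho>" using r by (simp add: zero_le_mult_iff)
  qed (rule \<rho>1)
  have "\<upsilon>s \<in> V" using subsetD[OF ball, of \<upsilon>s] D0 r by simp
  then have FGpd: "op_pd ?FG" by (intro info_G_pd psd)
  note iFG = op_pd_inv[OF FGpd]
  have iFGs: "op_symmetric (inv ?FG)" using iFG(1) unfolding op_pd_def by auto
  note lini = op_symmetricD(1)[OF iFGs]
  have gg: "marg_g_inv m P Y \<upsilon>s a \<bullet> b = inv ?FG (0, a) \<bullet> (0, b)" for a b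
    by (simp add: marg_g_inv_def gg_block_def inner_prod_def)
  \<comment> \<open>the square in the bound on the noise may be removed only because \<open>zq\<close> is nonnegative\<close>
  have zpos: "0 \<le> zq (B_SG m P Y S \<upsilon>s) x"
  proof -
    let ?B = "B_SG m P Y S \<upsilon>s"
    note linS = op_symmetricD(1)[OF S]
    have Bform: "?B a \<bullet> b = 1 / (sig m)\<^sup>2 * (inv ?FG (0, S a) \<bullet> (0, S b))" for a b
      unfolding B_SG_def using op_symmetricD(2)[OF S, of "marg_g_inv m P Y \<upsilon>s (S a)" b] by (simp add: gg)
    have "linear ?B"
    proof -
      have "linear (\<lambda>a. (0::'x, S a))" by (rule linearI) (simp_all add: linear_add[OF linS] linear_scale[OF linS])
      then have "linear (\<lambda>a. snd (inv ?FG (0, S a)))"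
        using linear_compose[OF linear_compose[OF _ lini] linear_snd] by (simp add: o_def)
      then have "linear (\<lambda>a. S (snd (inv ?FG (0, S a))))" using linear_compose[OF _ linS] by (simp add: o_def)
      then show ?thesis unfolding B_SG_def marg_g_inv_def gg_block_def
        by (rule linear_compose_scale_right)
    qed
    moreover have "?B a \<bullet> b = a \<bullet> ?B b" for a b
      unfolding inner_commute[of a] Bform using op_symmetricD(2)[OF iFGs, of "(0, S a)" "(0, S b)"] by (simp add: inner_commute)
    moreover have "0 \<le> ?B a \<bullet> a" for a
      using op_pd_imp_psd[OF iFG(1)] unfolding Bform op_psd_def by simp
    ultimately have "op_psd ?B" unfolding op_psd_def op_symmetric_def by blast
    then show ?thesis unfolding zq_def using eig_max_nonneg op_trace_nonneg x by (intro add_nonneg_nonneg) auto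
  qed
  \<comment> \<open>\<open>v = \<upsilon>s + s u\<close>, and the ray leaves the ball at parameter 1\<close>
  define s where "s = norm (DD_G m P Y \<upsilon>s (v - \<upsilon>s)) / r"
  have "\<not> norm (DD_G m P Y \<upsilon>s (v - \<upsilon>s)) \<le> r" using notV ball by blast
  then have s1: "1 < s" using r by (simp add: s_def)
  define u where "u = (1 / s) *\<^sub>R (v - \<upsilon>s)"
  have vu: "v = \<upsilon>s + s *\<^sub>R u" using s1 by (simp add: u_def)
  have Du: "norm (DD_G m P Y \<upsilon>s u) = r"
  proof -
    have "norm (DD_G m P Y \<upsilon>s (v - \<upsilon>s)) = s * r" using r by (simp add: s_def)
    then show ?thesis unfolding u_def Dscale using s1 by simp
  qed
  have uu: "?FG u \<bullet> u = r\<^sup>2" using nD[of u] Du by simp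
  have inball: "norm (DD_G m P Y \<upsilon>s ((\<upsilon>s + t *\<^sub>R u) - \<upsilon>s)) \<le> r" if "0 \<le> t" "t \<le> 1" for t
    using that r by (simp add: Dscale Du mult_left_le_one_le)
  have up: "\<upsilon>s + u \<in> pset m" using subsetD[OF ball, of "\<upsilon>s + u"] Du V by auto
  define g where "g t = dirD u ?J (\<upsilon>s + t *\<^sub>R u)" for t
  define g1 where "g1 t = dirD u (dirD u ?J) (\<upsilon>s + t *\<^sub>R u)" for t
  have dg: "DERIV g t :> g1 t" for t
    unfolding g_def g1_def by (rule smooth_line_derivative[OF smooth_dirD[OF sJ]])
  have dg1: "DERIV g1 t :> (dirD u ^^ 3) (Phi m) (\<upsilon>s + t *\<^sub>R u)" for t
    unfolding g1_def third_derivative_neg_loglik_G[of u mean, symmetric]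
    using smooth_line_derivative[OF smooth_dirD[OF smooth_dirD[OF sJ]]] by (simp add: numeral_3_eq_3)
  have g1_ge: "r\<^sup>2 - d \<le> g1 t" if t: "0 < t" "t \<le> 1" for t
  proof -
    obtain \<xi> where \<xi>: "0 < \<xi>" "\<xi> < t" "g1 t - g1 0 = (t - 0) * (dirD u ^^ 3) (Phi m) (\<upsilon>s + \<xi> *\<^sub>R u)"
      using MVT2[OF t(1) dg1] by blast
    have b: "\<bar>(dirD u ^^ 3) (Phi m) (\<upsilon>s + \<xi> *\<^sub>R u)\<bar> \<le> d"
      using d[OF inball, of \<xi> u] \<xi> t Du by (simp add: dir_deriv_eq_funpow[OF smooth_Phi])
    have "\<bar>t * (dirD u ^^ 3) (Phi m) (\<upsilon>s + \<xi> *\<^sub>R u)\<bar> \<le> 1 * d"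
      unfolding abs_mult using b t by (intro mult_mono) auto
    moreover have "g1 0 = r\<^sup>2" using uu FGform by (simp add: g1_def)
    ultimately show ?thesis using \<xi>(3) by simp
  qed
  have g_1: "r\<^sup>2 - d \<le> g 1"
  proof -
    obtain \<xi> where \<xi>: "0 < \<xi>" "\<xi> < 1" "g 1 - g 0 = (1 - 0) * g1 \<xi>"
      using MVT2[OF zero_less_one dg] by blast
    moreover have "g 0 = 0" using first(1) by (simp add: g_def)
    ultimately show ?thesis using g1_ge[of \<xi>] by simp
  qed
  define q where "q = 1 / (sig m)\<^sup>2 * ((y - mean) \<bullet> snd u)"
  have q: "q \<le> (1 - \<rho>) * r\<^sup>2"
  proof -
    let ?b = "(0::'x, (1 / sig m) *\<^sub>R e)"
    define w where "w = inv ?FG ?b"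
    have Fw: "?FG w = ?b" unfolding w_def by (rule iFG(2))
    have "q = ?b \<bullet> u" using sig by (simp add: q_def e_def inner_prod_def power2_eq_square)
    also have "\<dots> = ?FG w \<bullet> u" by (simp only: Fw)
    also have "\<dots> \<le> sqrt (?FG w \<bullet> w) * sqrt (?FG u \<bullet> u)" by (rule op_cauchy_schwarz[OF FGpsd])
    also have "sqrt (?FG u \<bullet> u) = r" using r by (simp add: uu)
    also have "?FG w \<bullet> w = 1 / (sig m)\<^sup>2 * (e \<bullet> marg_g_inv m P Y \<upsilon>s e)"
    proof -
      have b: "?b = (1 / sig m) *\<^sub>R (0, e)" by simp
      have wv: "w = (1 / sig m) *\<^sub>R inv ?FG (0, e)" unfolding w_def b by (rule linear_scale[OF lini])
      then have "?FG w \<bullet> w = 1 / sig m * (1 / sig m) * ((0, e) \<bullet> inv ?FG (0, e))"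
        unfolding Fw by (simp only: b wv inner_scaleR_left inner_scaleR_right mult.assoc)
      also have "(0, e) \<bullet> inv ?FG (0, e) = e \<bullet> marg_g_inv m P Y \<upsilon>s e"
        unfolding inner_commute[of "(0, e)"] inner_commute[of e] by (rule gg[symmetric])
      finally show ?thesis by (simp add: power2_eq_square)
    qed
    also have "sqrt \<dots> \<le> zq (B_SG m P Y S \<upsilon>s) x" using noise zpos by (rule real_le_lsqrt[rotated])
    also have "\<dots> * r \<le> (1 - \<rho>) * r * r" using z r by (intro mult_right_mono) auto
    finally show ?thesis using r by (simp add: power2_eq_square mult.assoc)
  qed
  define H where "H t = ?K (\<upsilon>s + t *\<^sub>R u)" for t
  have dH: "DERIV H t :> g t - q" for t
  proof -
    have lin_part: "k * (N + 2 * (A - t * B)) = k * (N + 2 * A) - t * (2 * k * B)" for k N A B t :: real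
      by (simp add: algebra_simps)
    have "(y - mean) \<bullet> (mean - snd (\<upsilon>s + t *\<^sub>R u)) = (y - mean) \<bullet> (mean - snd \<upsilon>s) - t * ((y - mean) \<bullet> snd u)" for t
      by (simp add: inner_diff_right inner_add_right)
    then have "H = (\<lambda>t. ?J (\<upsilon>s + t *\<^sub>R u) + (1 / (2 * (sig m)\<^sup>2) *
        ((norm (y - mean))\<^sup>2 + 2 * ((y - mean) \<bullet> (mean - snd \<upsilon>s))) - t * (2 * (1 / (2 * (sig m)\<^sup>2)) * ((y - mean) \<bullet> snd u))))"
      unfolding H_def neg_loglik_G_def neg_loglik_shift[of m y _ mean] lin_part[symmetric] by (simp add: fun_eq_iff)
    also have "2 * (1 / (2 * (sig m)\<^sup>2)) * ((y - mean) \<bullet> snd u) = q" by (simp add: q_def)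
    finally show ?thesis
      by (auto simp: g_def intro!: derivative_eq_intros smooth_line_derivative[OF sJ])
  qed
  have "\<rho> * r\<^sup>2 \<le> 1/2 * r\<^sup>2" using \<rho> by (intro mult_right_mono) auto
  moreover have r2: "0 < r\<^sup>2" using r by simp
  ultimately have pos1: "0 < g1 1" using g1_ge[OF zero_less_one order_refl] dr by linarith
  have "0 \<le> \<rho> * r\<^sup>2" using \<rho> by simp
  moreover have "(1 - \<rho>) * r\<^sup>2 = r\<^sup>2 - \<rho> * r\<^sup>2" by (simp add: algebra_simps)
  ultimately have pos0: "0 \<le> g 1 - q" using g_1 q dr by linarith
  obtain \<delta> where \<delta>: "\<delta> > 0" "\<And>h. 0 < h \<Longrightarrow> h < \<delta> \<Longrightarrow> g 1 < g (1 + h)"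
    using DERIV_pos_inc_right[OF dg pos1] by blast
  define h where "h = min \<delta> (s - 1) / 2"
  have h: "0 < h" "h < \<delta>" "h < s - 1" using \<delta> s1 by (auto simp: h_def)
  have h1: "(1::real) < 1 + h" using h by simp
  obtain \<xi> where \<xi>: "1 < \<xi>" "\<xi> < 1 + h" "H (1 + h) - H 1 = (1 + h - 1) * (g \<xi> - q)"
    using MVT2[OF h1 dH] by blast
  have "g 1 < g \<xi>" using \<delta>(2)[of "\<xi> - 1"] \<xi> h by simp
  then have "0 < h * (g \<xi> - q)" using pos0 h by (intro mult_pos_pos) auto
  then have up1: "H 1 < H (1 + h)" using \<xi>(3) by simp
  have "concave_on (pset m) (loglik_G m y)" by (rule concave_loglik_G)
  then have Lc: "(1 - t) * loglik_G m y p + t * loglik_G m y w \<le> loglik_G m y ((1 - t) *\<^sub>R p + t *\<^sub>R w)"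
    if "0 \<le> t" "t \<le> 1" "p \<in> pset m" "w \<in> pset m" for t p w
    using that by (rule concave_onD)
  define \<tau> where "\<tau> = h / (s - 1)"
  have \<tau>: "0 \<le> \<tau>" "\<tau> \<le> 1" "\<tau> * (s - 1) = h" using h s1 by (auto simp: \<tau>_def)
  have vp: "v \<in> pset m" using mx by (simp add: is_arg_max_def)
  have "(1 - \<tau>) *\<^sub>R (\<upsilon>s + u) + \<tau> *\<^sub>R v = \<upsilon>s + (1 + \<tau> * (s - 1)) *\<^sub>R u"
    unfolding vu by (simp add: algebra_simps)
  then have "(1 - \<tau>) * loglik_G m y (\<upsilon>s + u) + \<tau> * loglik_G m y v \<le> loglik_G m y (\<upsilon>s + (1 + h) *\<^sub>R u)"
    using Lc[OF \<tau>(1,2) up vp] by (simp add: \<tau>(3))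
  moreover have "loglik_G m y (\<upsilon>s + u) \<le> loglik_G m y v" by (rule maximizer_optimal[OF mx up])
  then have "\<tau> * loglik_G m y (\<upsilon>s + u) \<le> \<tau> * loglik_G m y v" using \<tau> by (intro mult_left_mono) auto
  ultimately have "loglik_G m y (\<upsilon>s + u) \<le> loglik_G m y (\<upsilon>s + (1 + h) *\<^sub>R u)" by (simp add: left_diff_distrib)
  then have "H (1 + h) \<le> H 1" by (simp add: H_def loglik_G_eq)
  then show False using up1 by simp
qed


end

section \<open>The posterior around the maximizer\<close>

text \<open>The hypotheses on the expansion point in real-valued form: \<open>d3\<close> and \<open>d4\<close> stand for the local
smoothness at radius \<open>r\<close>, and the norm of \<open>D u\<close> is expressed by the information operator.\<close>

locale local_expansion = observed_model m P Y
  for m :: "('x::euclidean_space, 'y::euclidean_space) inverse_model" and P :: "'w measure" and Y +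
  fixes y :: 'y and v :: "'x \<times> 'y" and V :: "('x \<times> 'y) set" and r d3 d4 :: real
  assumes mx: "is_arg_max (loglik_G m y) (\<lambda>\<upsilon>. \<upsilon> \<in> pset m) v"
    and psd: "\<And>\<upsilon>. \<upsilon> \<in> V \<Longrightarrow> op_psd (info m P Y \<upsilon>)"
    and sub: "\<And>u. info m P Y v u \<bullet> u \<le> r\<^sup>2 \<Longrightarrow> v + u \<in> V" and V: "V \<subseteq> pset m"
    and r: "0 < r"
    and d3: "\<And>\<upsilon> u. \<upsilon> \<in> V \<Longrightarrow> info m P Y \<upsilon> u \<bullet> u \<le> r\<^sup>2 \<Longrightarrow> \<bar>dir_deriv 3 u (Phi m) \<upsilon>\<bar> \<le> d3"
    and d4: "\<And>\<upsilon> u. \<upsilon> \<in> V \<Longrightarrow> info m P Y \<upsilon> u \<bullet> u \<le> r\<^sup>2 \<Longrightarrow> \<bar>dir_deriv 4 u (Phi m) \<upsilon>\<bar> \<le> d4"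
    and d: "0 \<le> d3" "0 \<le> d4"
begin

text \<open>The cost has the same third and fourth derivatives as \<open>Phi\<close>, its gradient vanishes at the
maximizer, and its Hessian there is the penalized information. Thus \<open>Rem\<close> is, up to sign, its
Taylor remainder.\<close>

lemma posterior_expansion:
  defines "Rem \<equiv> \<lambda>u. loglik_G m y (v + u) - loglik_G m y v + info_G m P Y v u \<bullet> u / 2"
  assumes small: "3 * d3 < r\<^sup>2" and u: "info m P Y v u \<bullet> u \<le> r\<^sup>2"
  shows "\<bar>Rem u\<bar> \<le> d3 / 2" and "\<bar>Rem u + Rem (- u)\<bar> \<le> d4 / 3"
proof -
  let ?\<Psi> = "neg_loglik_G m y"
  note s\<Psi> = smooth_neg_loglik_G(1)[of y] and third = third_derivative_neg_loglik_G[of _ y]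
  define pen where "pen u = G m (fst u) \<bullet> G m (fst u) + Gam m (snd u) \<bullet> Gam m (snd u)" for u
  have second: "dirD u (dirD u ?\<Psi>) \<upsilon> = info m P Y \<upsilon> u \<bullet> u + pen u" for u \<upsilon>
    unfolding hessian_form[OF s\<Psi>, symmetric] smooth_neg_loglik_G(2) smooth_neg_loglik(2) info_form(2) pen_def by simp
  have fourth: "(dirD u ^^ 4) ?\<Psi> = (dirD u ^^ 4) (Phi m)" for u
  proof -
    have "(4::nat) = Suc 3" by simp
    then show ?thesis using third[of u] by (simp only: funpow.simps comp_apply)
  qed
  have vp: "v \<in> pset m" using mx by (simp add: is_arg_max_def)
  have mn: "?\<Psi> v \<le> ?\<Psi> w" if "w \<in> pset m" for w
    using maximizer_optimal[OF mx that] by (simp add: loglik_G_eq)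
  have first: "dirD u ?\<Psi> v = 0" for u by (rule interior_min_conditions(1)[OF s\<Psi> pset_open vp mn])
  have Rem: "Rem u = - (?\<Psi> (v + u) - ?\<Psi> v - dirD u ?\<Psi> v - dirD u (dirD u ?\<Psi>) v / 2)" for u
    unfolding Rem_def first second info_G_form pen_def loglik_G_eq by simp
  have F: "info m P Y \<upsilon> u \<bullet> u = dirD u (dirD u ?\<Psi>) \<upsilon> + - pen u" for \<upsilon> u by (simp add: second)
  have pos: "0 \<le> info m P Y \<upsilon> u \<bullet> u" if "\<upsilon> \<in> V" for \<upsilon> u
    using psd[OF that] unfolding op_psd_def by blast
  note taylor = taylor_remainders[where \<Phi> = ?\<Psi> and F = "info m P Y" and s = "\<lambda>u. - pen u" and V = V and v = v,
      OF s\<Psi> F info_form(1) pos sub r small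
      d3[unfolded dir_deriv_eq_funpow[OF smooth_Phi], folded third]
      d4[unfolded dir_deriv_eq_funpow[OF smooth_Phi], folded fourth] u]
  show "\<bar>Rem u\<bar> \<le> d3 / 2" using taylor(1) unfolding Rem by linarith
  show "\<bar>Rem u + Rem (- u)\<bar> \<le> d4 / 3" using taylor(2) unfolding Rem by linarith
qed

text \<open>The transfer to normalized coordinates: \<open>T\<close> maps the standard Gaussian measure to the Gaussian
approximation and turns the information operator into the diagonal form with entries \<open>\<beta>\<^sub>b\<close>. A
set \<open>B\<close> of \<open>f\<close>-values becomes the cylinder \<open>A\<close>, which inherits the symmetry of \<open>B\<close>.\<close>

theorem gauss_error_bound:
  assumes small3: "d3 \<le> 1/32"
    and x: "4 \<le> x" and rx: "2 * sqrt (eff_dim m P Y v) + sqrt x \<le> r"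
    and B[measurable]: "B \<in> sets borel"
    and \<eta>: "\<eta> = d3 \<or> uminus ` B = B \<and> \<eta> = d3\<^sup>2 / 4 + d4 / 6"
    and small: "\<eta> + 6 * exp (- x / 2) \<le> 1/2"
  shows "gauss_error m P Y y v B \<le> 4 * (\<eta> + 6 * exp (- x / 2))"
proof -
  let ?F = "info m P Y v" and ?FG = "info_G m P Y v"
  have linF: "linear ?F" by (rule info_form(1))
  have vV: "v \<in> V" using sub[of 0] r by (simp add: linear_0[OF linF])
  have F: "op_symmetric ?F" "\<And>u. 0 \<le> ?F u \<bullet> u" using psd[OF vV] unfolding op_psd_def by auto
  have FG: "op_pd ?FG" by (rule info_G_pd[OF psd[OF vV]])
  have linFG: "linear ?FG" using FG unfolding op_pd_def op_symmetric_def by auto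
  obtain e :: "'x \<times> 'y \<Rightarrow> 'x \<times> 'y" and \<beta> where orth: "\<And>i j. i \<in> Basis \<Longrightarrow> j \<in> Basis \<Longrightarrow> ?FG (e i) \<bullet> e j = (if i = j then 1 else 0)"
    and eig: "\<And>i. i \<in> Basis \<Longrightarrow> ?F (e i) = \<beta> i *\<^sub>R ?FG (e i)"
    by (rule simultaneous_diagonalization[OF F(1) FG]) blast
  define T where "T = frame_map e"
  have T: "linear T" "bij T" unfolding T_def by (rule linear_frame_map) (rule bij_frame_map[OF linFG orth])
  have eF: "?F (e i) \<bullet> e j = (if i = j then \<beta> i else 0)" if "i \<in> Basis" "j \<in> Basis" for i j
    using that by (simp add: eig orth)
  have nT: "?FG (T z) \<bullet> T z = (norm z)\<^sup>2" for z
    unfolding T_def by (subst frame_map_form[OF linFG orth]) (simp_all add: diag_form_def sum_squared_coordinates)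
  have qT: "?F (T z) \<bullet> T z = diag_form \<beta> z" for z
    unfolding T_def by (rule frame_map_form[OF linF eF])
  have \<beta>0: "0 \<le> \<beta> b" if "b \<in> Basis" for b using F(2)[of "e b"] eF[OF that that] by simp
  have \<beta>1: "\<beta> b \<le> 1" if "b \<in> Basis" for b
  proof -
    have "1 = \<beta> b + (G m (fst (e b)) \<bullet> G m (fst (e b)) + Gam m (snd (e b)) \<bullet> Gam m (snd (e b)))"
      using info_G_form[of v "e b" "e b"] eF[OF that that] orth[OF that that] by simp
    then show ?thesis
      using inner_ge_zero[of "G m (fst (e b))"] inner_ge_zero[of "Gam m (snd (e b))"] by linarith
  qed
  have eff: "eff_dim m P Y v = (\<Sum>b\<in>Basis. \<beta> b)"
  proof -
    have "op_trace (?F \<circ> inv ?FG) = (\<Sum>b\<in>Basis. ?F (e b) \<bullet> e b)"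
      by (rule frame_trace[OF linF FG orth])
    then show ?thesis by (simp add: eff_dim_def eF cong: sum.cong)
  qed
  let ?L = "loglik_G m y"
  define \<ll> where "\<ll> z = ?L (v + T z) - ?L v" for z
  define W where "W = {z. v + T z \<in> pset m}"
  define A where "A = {z. fst (T z) \<in> B}"
  have [measurable]: "T \<in> borel_measurable borel" by (rule borel_measurable_linear[OF T(1)])
  have [measurable]: "pset m \<in> sets borel" using pset_open by simp
  have [measurable]: "(fst :: 'x \<times> 'y \<Rightarrow> 'x) \<in> borel_measurable borel"
    by (rule borel_measurable_linear[OF linear_fst])
  have W: "W \<in> sets borel" unfolding W_def by measurable
  have m\<ll>: "\<ll> \<in> borel_measurable borel" unfolding \<ll>_def by measurable
  have A: "A \<in> sets borel" unfolding A_def by measurable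
  have conc\<ll>: "concave_on W \<ll>"
  proof -
    have c: "concave_on (pset m) ?L" by (rule concave_loglik_G)
    have aff: "v + T (s *\<^sub>R p + t *\<^sub>R w) = s *\<^sub>R (v + T p) + t *\<^sub>R (v + T w)" if "s + t = 1" for s t p w
    proof -
      have "s *\<^sub>R v + t *\<^sub>R v = v" using that by (simp flip: scaleR_add_left)
      then show ?thesis by (simp add: linear_add[OF T(1)] linear_scale[OF T(1)] scaleR_add_right algebra_simps)
    qed
    have cW: "convex W" using concave_on_imp_convex[OF c] unfolding W_def convex_def by (simp add: aff)
    show ?thesis unfolding concave_on_iff
    proof (intro conjI cW ballI allI impI)
      fix p w s t assume pw: "p \<in> W" "w \<in> W" "0 \<le> (s::real)" "0 \<le> (t::real)" "s + t = 1"
      have "s * ?L (v + T p) + t * ?L (v + T w) \<le> ?L (s *\<^sub>R (v + T p) + t *\<^sub>R (v + T w))"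
        using c pw unfolding concave_on_iff W_def by blast
      moreover have "s * ?L v + t * ?L v = ?L v" using pw(5) by (metis distrib_right mult_1)
      ultimately show "s * \<ll> p + t * \<ll> w \<le> \<ll> (s *\<^sub>R p + t *\<^sub>R w)"
        unfolding \<ll>_def aff[OF pw(5)] by (simp add: right_diff_distrib)
    qed
  qed
  have r2: "2 \<le> r"
  proof -
    have "0 \<le> eff_dim m P Y v" unfolding eff using \<beta>0 by (rule sum_nonneg)
    then have "0 \<le> sqrt (eff_dim m P Y v)" by simp
    moreover have "2 \<le> sqrt x" using real_sqrt_le_mono[OF x] by simp
    ultimately show ?thesis using rx by linarith
  qed
  then have "2\<^sup>2 \<le> r\<^sup>2" by (intro power_mono) auto
  then have sm3: "3 * d3 < r\<^sup>2" using d small3 by simp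
  note expansion = posterior_expansion[OF sm3]
  have Rz: "\<ll> z + (norm z)\<^sup>2 / 2 = ?L (v + T z) - ?L v + ?FG (T z) \<bullet> T z / 2" for z
    by (simp add: \<ll>_def nT)
  have R1: "\<bar>\<ll> z + (norm z)\<^sup>2 / 2\<bar> \<le> d3 / 2" if "diag_form \<beta> z \<le> r\<^sup>2" for z
    unfolding Rz using expansion(1)[of "T z"] that by (simp add: qT)
  have R2: "\<bar>(\<ll> z + (norm z)\<^sup>2 / 2) + (\<ll> (- z) + (norm (- z))\<^sup>2 / 2)\<bar> \<le> d4 / 3"
    if "diag_form \<beta> z \<le> r\<^sup>2" for z
    unfolding Rz using expansion(2)[of "T z"] that by (simp add: qT linear_neg[OF T(1)])
  have loc: "z \<in> W \<and> \<bar>\<ll> z + (norm z)\<^sup>2 / 2\<bar> \<le> d3 / 2" if "diag_form \<beta> z \<le> r\<^sup>2" for z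
    using R1[OF that] sub[of "T z"] V that by (auto simp: W_def qT)
  have err: "(\<forall>z. diag_form \<beta> z \<le> r\<^sup>2 \<longrightarrow> \<bar>exp (\<ll> z + (norm z)\<^sup>2 / 2) - 1\<bar> \<le> \<eta>) \<or>
      (\<forall>z. - z \<in> A \<longleftrightarrow> z \<in> A) \<and> (\<forall>z. diag_form \<beta> z \<le> r\<^sup>2 \<longrightarrow>
        \<bar>(exp (\<ll> z + (norm z)\<^sup>2 / 2) + exp (\<ll> (- z) + (norm (- z))\<^sup>2 / 2)) / 2 - 1\<bar> \<le> \<eta>)"
    using \<eta>
  proof
    assume \<eta>: "\<eta> = d3"
    have "\<bar>exp R - 1\<bar> \<le> d3" if R: "\<bar>R\<bar> \<le> d3 / 2" for R
    proof -
      have "\<bar>exp R - 1 - R\<bar> \<le> R\<^sup>2" using R d small3 by (intro exp_quadratic_bound) linarith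
      moreover have "R\<^sup>2 \<le> d3 / 2"
      proof -
        have "\<bar>R\<bar> * \<bar>R\<bar> \<le> (d3 / 2) * 1" using R d small3 by (intro mult_mono) auto
        then show ?thesis by (simp add: power2_eq_square flip: abs_mult)
      qed
      ultimately show ?thesis using R by linarith
    qed
    then show ?thesis using R1 \<eta> by blast
  next
    assume \<eta>: "uminus ` B = B \<and> \<eta> = d3\<^sup>2 / 4 + d4 / 6"
    have "- b \<in> B \<longleftrightarrow> b \<in> B" for b using \<eta> by (metis imageI minus_minus)
    then have symA: "- z \<in> A \<longleftrightarrow> z \<in> A" for z
      by (simp add: A_def linear_neg[OF T(1)])
    have "\<bar>(exp R + exp R') / 2 - 1\<bar> \<le> \<eta>"
      if R: "\<bar>R\<bar> \<le> d3 / 2" "\<bar>R'\<bar> \<le> d3 / 2" "\<bar>R + R'\<bar> \<le> d4 / 3" for R R'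
    proof -
      have "\<bar>exp R - 1 - R\<bar> \<le> R\<^sup>2" "\<bar>exp R' - 1 - R'\<bar> \<le> R'\<^sup>2"
        using R d small3 by (intro exp_quadratic_bound; linarith)+
      moreover have "R\<^sup>2 \<le> (d3 / 2)\<^sup>2" "R'\<^sup>2 \<le> (d3 / 2)\<^sup>2"
        using R by (simp_all add: abs_le_square_iff[symmetric])
      moreover have "(d3 / 2)\<^sup>2 = d3\<^sup>2 / 4" by (simp add: power_divide)
      ultimately have "\<bar>exp R - 1 - R\<bar> \<le> d3\<^sup>2 / 4" "\<bar>exp R' - 1 - R'\<bar> \<le> d3\<^sup>2 / 4" by linarith+
      moreover have "(exp R + exp R') / 2 - 1 = ((exp R - 1 - R) + (exp R' - 1 - R') + (R + R')) / 2" by simp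
      moreover have "\<bar>(a + b + c) / 2\<bar> \<le> q / 4 + d4 / 6"
        if "\<bar>a\<bar> \<le> q / 4" "\<bar>b\<bar> \<le> q / 4" "\<bar>c\<bar> \<le> d4 / 3" for a b c q :: real
      proof -
        have "\<bar>a + b + c\<bar> \<le> \<bar>a\<bar> + \<bar>b\<bar> + \<bar>c\<bar>"
          using abs_triangle_ineq[of "a + b" c] abs_triangle_ineq[of a b] by linarith
        then have "\<bar>a + b + c\<bar> / 2 \<le> (q / 4 + q / 4 + d4 / 3) / 2"
          using that by (intro divide_right_mono) auto
        then show ?thesis by (simp add: abs_divide add_divide_distrib)
      qed
      ultimately show ?thesis using R(3) \<eta> by presburger
    qed
    then have "\<bar>(exp (\<ll> z + (norm z)\<^sup>2 / 2) + exp (\<ll> (- z) + (norm (- z))\<^sup>2 / 2)) / 2 - 1\<bar> \<le> \<eta>"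
      if "diag_form \<beta> z \<le> r\<^sup>2" for z
      using R1[OF that] R1[of "- z"] R2[OF that] that by simp
    then show ?thesis using symA by blast
  qed
  have \<eta>0: "0 \<le> \<eta>" using \<eta> d by auto
  obtain a a1 where a: "(\<integral>\<^sup>+z. indicator (A \<inter> W) z * ennreal (exp (\<ll> z + (norm z)\<^sup>2 / 2)) \<partial>std_gaussian) = ennreal a"
    and a1: "(\<integral>\<^sup>+z. indicator W z * ennreal (exp (\<ll> z + (norm z)\<^sup>2 / 2)) \<partial>std_gaussian) = ennreal a1"
    and pos: "0 \<le> a" "0 < a1" and bound: "\<bar>a / a1 - measure std_gaussian A\<bar> \<le> 4 * (\<eta> + 6 * exp (- x / 2))"
    by (rule laplace_tv[of \<beta> W \<ll> r "d3 / 2" x A \<eta>, OF \<beta>0 \<beta>1 W m\<ll> conc\<ll> loc _ _ x rx[unfolded eff] A \<eta>0 small err])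
       (use d small3 in auto)
  obtain k where k: "0 < k" and frame: "\<And>S. S \<in> sets borel \<Longrightarrow>
    (\<integral>\<^sup>+z. indicator ({z. T z \<in> S} \<inter> {z. v + T z \<in> pset m}) z
        * ennreal (exp ((?L (v + T z) - ?L v) + (norm z)\<^sup>2 / 2)) \<partial>std_gaussian)
    = ennreal k * (\<integral>\<^sup>+\<upsilon>. indicator {\<upsilon>. \<upsilon> - v \<in> S} \<upsilon> * (ennreal (exp (?L \<upsilon>)) * indicator (pset m) \<upsilon>) \<partial>lborel)"
    by (rule posterior_in_frame[OF pset_open T, of v y]) blast
  have real: "I = ennreal (c / k)" if "ennreal c = ennreal k * I" "0 \<le> c" for I c
  proof -
    have "I \<noteq> \<top>" using that k by (auto simp: ennreal_mult_top)
    then obtain i where i: "I = ennreal i" "0 \<le> i" by (cases I) auto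
    then have "ennreal c = ennreal (k * i)" using that k by (simp add: ennreal_mult)
    then have "c = k * i" using that i k by (subst (asm) ennreal_inj) auto
    then show ?thesis using i k by simp
  qed
  let ?I = "\<lambda>S. \<integral>\<^sup>+\<upsilon>. indicator S \<upsilon> * (ennreal (exp (?L \<upsilon>)) * indicator (pset m) \<upsilon>) \<partial>lborel"
  have "{z. T z \<in> {u. fst u \<in> B}} = A" "{z. v + T z \<in> pset m} = W" by (auto simp: A_def W_def)
  then have "ennreal a = ennreal k * ?I {\<upsilon>. \<upsilon> - v \<in> {u. fst u \<in> B}}"
    using frame[of "{u. fst u \<in> B}"] a unfolding \<ll>_def by simp
  from real[OF this pos(1)] have Ia: "?I {\<upsilon>. fst \<upsilon> - fst v \<in> B} = ennreal (a / k)" by simp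
  have "ennreal a1 = ennreal k * ?I {\<upsilon>. \<upsilon> - v \<in> UNIV}"
    using frame[of UNIV] a1 unfolding \<ll>_def W_def by simp
  from real[OF this] have Ia1: "?I UNIV = ennreal (a1 / k)" using pos by simp
  have "emeasure (posterior_f m y) {f. f - fst v \<in> B} =
      (\<integral>\<^sup>+\<upsilon>. indicator {f. f - fst v \<in> B} (fst \<upsilon>) * (ennreal (exp (?L \<upsilon>)) * indicator (pset m) \<upsilon>) \<partial>lborel)
      / (\<integral>\<^sup>+\<upsilon>. ennreal (exp (?L \<upsilon>)) * indicator (pset m) \<upsilon> \<partial>lborel)"
    by (rule emeasure_posterior[OF pset_open]) measurable
  also have "(\<integral>\<^sup>+\<upsilon>. indicator {f. f - fst v \<in> B} (fst \<upsilon>) * (ennreal (exp (?L \<upsilon>)) * indicator (pset m) \<upsilon>) \<partial>lborel)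
      = ?I {\<upsilon>. fst \<upsilon> - fst v \<in> B}" by (intro nn_integral_cong) (simp add: indicator_def)
  also have "(\<integral>\<^sup>+\<upsilon>. ennreal (exp (?L \<upsilon>)) * indicator (pset m) \<upsilon> \<partial>lborel) = ?I UNIV" by simp
  also have "?I {\<upsilon>. fst \<upsilon> - fst v \<in> B} / ?I UNIV = ennreal (a / a1)"
    unfolding Ia Ia1 using k pos by (subst divide_ennreal) auto
  finally have post: "measure (posterior_f m y) {f. f - fst v \<in> B} = a / a1"
    using pos by (simp add: measure_def)
  have gauss: "measure std_gaussian {\<gamma>. inv (op_sqrt (marg_f m P Y v)) \<gamma> \<in> B} = measure std_gaussian A"
    unfolding marg_f_def A_def by (rule gaussian_marginal[OF FG T nT B, symmetric])
  show ?thesis unfolding gauss_error_def post gauss by (rule bound)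
qed

text \<open>If \<open>n \<le> 10\<^sup>6\<close>, or if the local smoothness is at least \<open>10\<^sup>-\<^sup>6\<close>, the bound exceeds 1 and is
trivial. Otherwise \<open>gauss_error_bound\<close> applies with room to spare.\<close>

lemma gauss_error_rates:
  assumes n: "1 \<le> n"
    and rx: "2 * sqrt (eff_dim m P Y v) + sqrt (2 * ln n) \<le> r"
    and B: "B \<in> sets borel"
  shows "gauss_error m P Y y v B \<le> 10 ^ 6 * (d3 + 1 / n)" (is ?general)
    and "uminus ` B = B \<Longrightarrow> gauss_error m P Y y v B \<le> 10 ^ 6 * (4 * d3\<^sup>2 + 4 * d4 + 1 / n)" (is "_ \<Longrightarrow> ?symmetric")
proof -
  note le1 = gauss_error_le_1[OF pset_open B, of P Y y v]
  have n0: "0 \<le> 1 / n" using n by simp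
  have x: "4 \<le> 2 * ln n" "exp (- (2 * ln n) / 2) = 1 / n" if "10 ^ 6 < n"
  proof -
    have "exp 2 = (exp (1::real))\<^sup>2" using exp_double[of "1::real"] by simp
    moreover have "(exp 1)\<^sup>2 \<le> (3::real)\<^sup>2" using exp_le by (intro power_mono) auto
    ultimately have "exp 2 \<le> n" using that by simp
    then have "2 \<le> ln n" using n by (simp add: ln_ge_iff)
    then show "4 \<le> 2 * ln n" by simp
    show "exp (- (2 * ln n) / 2) = 1 / n" using n by (simp add: exp_minus inverse_eq_divide)
  qed
  have enlarge: "4 * (\<eta> + 6 * t) \<le> 10 ^ 6 * (\<eta>' + t)" if "0 \<le> \<eta>" "\<eta> \<le> \<eta>'" "0 \<le> t" for \<eta> \<eta>' t :: real
    using that by simp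
  have tiny: "q / 4 + p / 6 + 6 * t \<le> 1 / 2" if "4 * q + 4 * p < 1 / 10 ^ 6" "t \<le> 1 / 10 ^ 6" "0 \<le> q" "0 \<le> p"
    for p q t :: real
    using that by simp
  have weaken: "q / 4 + p / 6 \<le> 4 * q + 4 * p" if "0 \<le> q" "0 \<le> p" for p q :: real
    using that by simp
  have large: "1 \<le> 10 ^ 6 * (1 / n) \<or> 1 \<le> 10 ^ 6 * \<eta>" if "\<not> (10 ^ 6 < n \<and> \<eta> < 1 / 10 ^ 6)" for \<eta> :: real
    using that n by (auto simp: field_simps)
  have trivial: "1 \<le> 10 ^ 6 * (\<eta> + t)" if "1 \<le> 10 ^ 6 * t \<or> 1 \<le> 10 ^ 6 * \<eta>" "0 \<le> \<eta>" "0 \<le> t" for \<eta> t :: real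
    using that by auto
  show ?general
  proof (cases "10 ^ 6 < n \<and> d3 < 1 / 10 ^ 6")
    case True
    then have n: "10 ^ 6 < n" and s: "d3 < 1 / 10 ^ 6" by auto
    have ni: "1 / n \<le> 1 / 10 ^ 6" using n by (intro divide_left_mono) auto
    have "gauss_error m P Y y v B \<le> 4 * (d3 + 6 * exp (- (2 * ln n) / 2))"
      by (rule gauss_error_bound[OF _ x(1)[OF n] rx B])
         (use s ni in \<open>unfold x(2)[OF n], auto\<close>)
    also have "\<dots> \<le> 10 ^ 6 * (d3 + 1 / n)" unfolding x(2)[OF n] by (rule enlarge[OF d(1) order_refl n0])
    finally show ?thesis .
  next
    case False
    then have "1 \<le> 10 ^ 6 * (1 / n) \<or> 1 \<le> 10 ^ 6 * d3" by (rule large)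
    then have "1 \<le> 10 ^ 6 * (d3 + 1 / n)" by (rule trivial[OF _ d(1) n0])
    then show ?thesis using le1 by linarith
  qed
  show ?symmetric if sym: "uminus ` B = B"
  proof (cases "10 ^ 6 < n \<and> 4 * d3\<^sup>2 + 4 * d4 < 1 / 10 ^ 6")
    case True
    then have n: "10 ^ 6 < n" and s: "4 * d3\<^sup>2 + 4 * d4 < 1 / 10 ^ 6" by auto
    have ni: "1 / n \<le> 1 / 10 ^ 6" using n by (intro divide_left_mono) auto
    have "d3\<^sup>2 \<le> (1 / 32)\<^sup>2" using s d(2) by (simp add: power_divide)
    then have d32: "d3 \<le> 1 / 32" by (rule power2_le_imp_le) simp
    have q: "0 \<le> d3\<^sup>2" by simp
    have "gauss_error m P Y y v B \<le> 4 * ((d3\<^sup>2 / 4 + d4 / 6) + 6 * exp (- (2 * ln n) / 2))"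
    proof (rule gauss_error_bound[OF d32 x(1)[OF n] rx B])
      show "d3\<^sup>2 / 4 + d4 / 6 = d3 \<or> uminus ` B = B \<and> d3\<^sup>2 / 4 + d4 / 6 = d3\<^sup>2 / 4 + d4 / 6" using sym by simp
      show "d3\<^sup>2 / 4 + d4 / 6 + 6 * exp (- (2 * ln n) / 2) \<le> 1 / 2"
        unfolding x(2)[OF n] by (rule tiny[OF s ni q d(2)])
    qed
    also have "\<dots> \<le> 10 ^ 6 * ((4 * d3\<^sup>2 + 4 * d4) + 1 / n)" unfolding x(2)[OF n]
      by (rule enlarge[OF _ weaken[OF q d(2)] n0]) (use d q in simp)
    finally show ?thesis .
  next
    case False
    then have "1 \<le> 10 ^ 6 * (1 / n) \<or> 1 \<le> 10 ^ 6 * (4 * d3\<^sup>2 + 4 * d4)" by (rule large)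
    then have "1 \<le> 10 ^ 6 * (4 * d3\<^sup>2 + 4 * d4 + 1 / n)"
      using trivial[of "1 / n" "4 * d3\<^sup>2 + 4 * d4"] d n0 by simp
    then show ?thesis using le1 by linarith
  qed
qed

end

section \<open>The accuracy of the Laplace approximation\<close>

text \<open>Exponential moments in each coordinate direction dominate second moments.\<close>

lemma cond_ES_square_integrable:
  fixes m :: "('x::euclidean_space, 'y::euclidean_space) inverse_model"
  assumes ES: "cond_ES m P Y S \<infinity> \<nu>0" and P: "prob_space P" and Y: "integrable P Y" and sig: "0 < sig m"
  shows "integrable P (\<lambda>\<omega>. (norm (Y \<omega> - (\<integral>\<omega>. Y \<omega> \<partial>P)))\<^sup>2)"
proof -
  interpret prob_space P by (rule P)
  let ?e = "noise m P Y"
  have S: "op_pd S" using ES unfolding cond_ES_def by blast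
  have exp_int: "integrable P (\<lambda>\<omega>. exp (t * (u \<bullet> ?e \<omega>) / norm (S u)))" for t u
    using ES unfolding cond_ES_def by simp
  have mY[measurable]: "Y \<in> borel_measurable P" using Y by (rule borel_measurable_integrable)
  have me[measurable]: "?e \<in> borel_measurable P" unfolding noise_def[abs_def] by measurable
  have coord: "integrable P (\<lambda>\<omega>. (?e \<omega> \<bullet> b)\<^sup>2)" if b: "b \<in> Basis" for b
  proof -
    have Sb: "norm (S b) > 0" using S b nonzero_Basis[OF b] unfolding op_pd_def by (metis inner_zero_left less_irrefl zero_less_norm_iff)
    let ?X = "\<lambda>\<omega>. (b \<bullet> ?e \<omega>) / norm (S b)"
    have "integrable P (\<lambda>\<omega>. 2 * (exp (1 * (b \<bullet> ?e \<omega>) / norm (S b)) + exp (- 1 * (b \<bullet> ?e \<omega>) / norm (S b))))"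
      by (intro integrable_mult_right impI Bochner_Integration.integrable_add exp_int)
    then have "integrable P (\<lambda>\<omega>. (?X \<omega>)\<^sup>2)"
    proof (rule Bochner_Integration.integrable_bound)
      show "(\<lambda>\<omega>. (?X \<omega>)\<^sup>2) \<in> borel_measurable P" by measurable
      have "s\<^sup>2 \<le> 2 * (exp s + exp (- s))" for s :: real
      proof (cases "0 \<le> s")
        case True
        have "1 + s + s\<^sup>2 / 2 \<le> exp s" using exp_lower_Taylor_quadratic[OF True] by simp
        then have "2 + 2 * s + s\<^sup>2 \<le> 2 * exp s" by (simp add: field_simps)
        moreover have "0 < exp (- s)" by simp
        ultimately show ?thesis using True unfolding distrib_left by linarith
      next
        case False
        then have "0 \<le> - s" by simp
        have "1 + (- s) + (- s)\<^sup>2 / 2 \<le> exp (- s)" using exp_lower_Taylor_quadratic[OF \<open>0 \<le> - s\<close>] by simp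
        then have "2 - 2 * s + s\<^sup>2 \<le> 2 * exp (- s)" by (simp add: field_simps)
        moreover have "0 < exp s" by simp
        ultimately show ?thesis using False unfolding distrib_left by linarith
      qed
      then show "AE \<omega> in P. norm ((?X \<omega>)\<^sup>2)
          \<le> norm (2 * (exp (1 * (b \<bullet> ?e \<omega>) / norm (S b)) + exp (- 1 * (b \<bullet> ?e \<omega>) / norm (S b))))"
        by (intro always_eventually allI) (simp add: order_trans[OF _ abs_ge_self])
    qed
    then have "integrable P (\<lambda>\<omega>. (norm (S b))\<^sup>2 * (?X \<omega>)\<^sup>2)" by (rule integrable_mult_right)
    moreover have "(norm (S b))\<^sup>2 * (?X \<omega>)\<^sup>2 = (?e \<omega> \<bullet> b)\<^sup>2" for \<omega>
      using Sb by (simp add: power_divide inner_commute)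
    ultimately show ?thesis by simp
  qed
  have "integrable P (\<lambda>\<omega>. (sig m)\<^sup>2 * (\<Sum>b\<in>Basis. (?e \<omega> \<bullet> b)\<^sup>2))"
    by (intro integrable_mult_right Bochner_Integration.integrable_sum coord)
  moreover have "(sig m)\<^sup>2 * (\<Sum>b\<in>Basis. (?e \<omega> \<bullet> b)\<^sup>2) = (norm (Y \<omega> - (\<integral>\<omega>. Y \<omega> \<partial>P)))\<^sup>2" for \<omega>
    unfolding sum_squared_coordinates noise_def using sig by (simp add: power_mult_distrib power_divide)
  ultimately show ?thesis by simp
qed

theorem corollary3p2:
  fixes m :: "('x::euclidean_space, 'y::euclidean_space) inverse_model"
    and P :: "'w measure" and Y :: "'w \<Rightarrow> 'y"
    and fs :: 'x and \<upsilon>s :: "'x \<times> 'y" and \<upsilon>t :: "'w \<Rightarrow> 'x \<times> 'y"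
    and S :: "'y \<Rightarrow> 'y" and \<nu>0 C_GGam C_Om n x \<rho> r_G r0 :: real
    and \<Upsilon>0 U :: "('x \<times> 'y) set" and \<Omega> :: "'w set"
  assumes "smooth (fwd m)" and "0 < sig m" and "0 < lam m"
    and "op_pd (G m)" and "op_pd (Gam m)"
    and "prob_space P" and "integrable P Y" and "(\<integral>\<omega>. Y \<omega> \<partial>P) = fwd m fs"
    and "cond_L m P Y"
    and "cond_ES m P Y S \<infinity> \<nu>0"
    and "cond_G_Gam m P Y fs \<upsilon>s C_GGam"
    and "cond_L0 m \<Upsilon>0 U"
    and "is_arg_max (E_loglik_G m P Y) (\<lambda>\<upsilon>. \<upsilon> \<in> pset m) \<upsilon>s"
    and "\<And>\<omega>. \<omega> \<in> \<Omega> \<Longrightarrow> is_arg_max (loglik_G m (Y \<omega>)) (\<lambda>\<upsilon>. \<upsilon> \<in> pset m) (\<upsilon>t \<omega>)"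
    and "\<And>\<upsilon>. \<upsilon> \<in> \<Upsilon>0 \<Longrightarrow> op_psd (info m P Y \<upsilon>)"
    and "1 \<le> n" and "x = 2 * ln n"
    and "\<Omega> \<in> sets P" and "measure P \<Omega> \<ge> 1 - C_Om * exp (- x)"
    and "\<And>\<omega>. \<omega> \<in> \<Omega> \<Longrightarrow>
      1 / (sig m)\<^sup>2 * (noise m P Y \<omega> \<bullet> marg_g_inv m P Y \<upsilon>s (noise m P Y \<omega>))
        \<le> (zq (B_SG m P Y S \<upsilon>s) x)\<^sup>2"
    and "0 < r_G" and "\<rho> \<le> 1 / 2"
    and "ereal (3 / r_G\<^sup>2) * \<delta>3G m P Y \<upsilon>s r_G \<le> ereal \<rho>"
    and "(1 - \<rho>) * r_G \<ge> zq (B_SG m P Y S \<upsilon>s) x"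
    and "{\<upsilon>. norm (DD_G m P Y \<upsilon>s (\<upsilon> - \<upsilon>s)) \<le> r_G} \<subseteq> \<Upsilon>0" and "\<Upsilon>0 \<subseteq> pset m"
    and "0 < r0"
    and "\<And>\<omega>. \<omega> \<in> \<Omega> \<Longrightarrow> local_set m P Y \<Upsilon>0 (\<upsilon>t \<omega>) r0"
    and "diamond m P Y \<Upsilon>0 r0 \<le> ereal (1 / 2)"
    and "C0 m P Y \<Upsilon>0 r0 \<ge> ereal (1 / 2)"
    and "\<And>\<upsilon>. \<upsilon> \<in> \<Upsilon>0 \<Longrightarrow>
      C0 m P Y \<Upsilon>0 r0 * ereal r0 \<ge> ereal (2 * sqrt (eff_dim m P Y \<upsilon>) + sqrt x)"
  shows "\<forall>\<omega>\<in>\<Omega>.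
      (SUP B\<in>symmetric_borel. ereal (gauss_error m P Y (Y \<omega>) (\<upsilon>t \<omega>) B))
        \<le> ereal abs_const * (diamond m P Y \<Upsilon>0 r0 + ereal (1 / n)) \<and>
      (SUP B\<in>sets borel. ereal (gauss_error m P Y (Y \<omega>) (\<upsilon>t \<omega>) B))
        \<le> ereal abs_const * (\<delta> m P Y \<Upsilon>0 3 r0 + ereal (1 / n))"
proof (rule ballI)
  note A = assms
  fix \<omega> assume \<omega>: "\<omega> \<in> \<Omega>"
  let ?v = "\<upsilon>t \<omega>" and ?y = "Y \<omega>"
  note sm = A(1) and sig = A(2) and G = A(4) and Gam = A(5) and P = A(6) and Y = A(7) and L = A(9)
  note mxs = A(13) and mx = A(14)[OF \<omega>] and psd = A(15)
  have Y2: "integrable P (\<lambda>\<omega>. (norm (Y \<omega> - (\<integral>\<omega>. Y \<omega> \<partial>P)))\<^sup>2)"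
    by (rule cond_ES_square_integrable[OF A(10) P Y sig])
  interpret M: observed_model m P Y
    by (intro observed_model.intro inverse_problem.intro observed_model_axioms.intro sm sig G Gam P Y Y2 L)
  have S: "op_symmetric S" using A(10) unfolding cond_ES_def op_pd_def by blast
  have x0: "0 \<le> x" using A(16,17) by simp
  have rG: "0 < r_G" by (rule A(21))
  have v: "?v \<in> \<Upsilon>0"
  proof -
    let ?D = "\<delta>3G m P Y \<upsilon>s r_G"
    have D_ge: "ereal \<bar>dir_deriv 3 u (Phi m) \<upsilon>\<bar> \<le> ?D"
      if "norm (DD_G m P Y \<upsilon>s (\<upsilon> - \<upsilon>s)) \<le> r_G" "norm (DD_G m P Y \<upsilon>s u) \<le> r_G" for \<upsilon> u
      unfolding \<delta>3G_def using that by (intro SUP_upper2[of \<upsilon>] SUP_upper2[of u]) auto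
    \<comment> \<open>the value for which the required bound \<open>3 d \<le> \<rho> r_G\<^sup>2\<close> is an equality\<close>
    define d where "d = \<rho> * r_G\<^sup>2 / 3"
    have d: "\<bar>dir_deriv 3 u (Phi m) \<upsilon>\<bar> \<le> d"
      if "norm (DD_G m P Y \<upsilon>s (\<upsilon> - \<upsilon>s)) \<le> r_G" "norm (DD_G m P Y \<upsilon>s u) \<le> r_G" for \<upsilon> u
    proof -
      have "ereal (3 / r_G\<^sup>2) * ereal \<bar>dir_deriv 3 u (Phi m) \<upsilon>\<bar> \<le> ereal (3 / r_G\<^sup>2) * ?D"
        using D_ge[OF that] by (intro ereal_mult_left_mono) auto
      also have "\<dots> \<le> ereal \<rho>" by (rule A(23))
      finally have "3 / r_G\<^sup>2 * \<bar>dir_deriv 3 u (Phi m) \<upsilon>\<bar> \<le> \<rho>" by simp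
      then show ?thesis using rG by (simp add: d_def field_simps)
    qed
    show ?thesis
      by (rule M.maximizer_localized[OF mxs mx psd A(25) A(26) rG d _ A(22) S x0 _ A(24)])
         (use A(20)[OF \<omega>] in \<open>simp_all add: d_def noise_def\<close>)
  qed
  have vs: "op_psd (info m P Y ?v)" by (rule psd[OF v])
  have D_le: "norm (DD m P Y \<upsilon> u) \<le> r0" if "\<upsilon> \<in> \<Upsilon>0" "info m P Y \<upsilon> u \<bullet> u \<le> r0\<^sup>2" for \<upsilon> u
  proof (rule power2_le_imp_le)
    show "(norm (DD m P Y \<upsilon> u))\<^sup>2 \<le> r0\<^sup>2"
      unfolding DD_def norm_op_sqrt[OF psd[OF that(1)]] by (rule that(2))
  qed (use A(27) in simp)
  have \<delta>_ge: "ereal \<bar>dir_deriv k u (Phi m) \<upsilon>\<bar> \<le> \<delta> m P Y \<Upsilon>0 k r0"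
    if "\<upsilon> \<in> \<Upsilon>0" "info m P Y \<upsilon> u \<bullet> u \<le> r0\<^sup>2" for \<upsilon> u k
    unfolding \<delta>_def using that D_le by (intro SUP_upper2[of \<upsilon>] SUP_upper2[of u]) auto
  have sub: "?v + u \<in> \<Upsilon>0" if "info m P Y ?v u \<bullet> u \<le> r0\<^sup>2" for u
    using A(28)[OF \<omega>] D_le[OF v that] unfolding local_set_def by (auto dest!: subsetD[of _ _ "?v + u"])
  have "linear (info m P Y ?v)" using vs unfolding op_psd_def op_symmetric_def by blast
  then have "info m P Y ?v 0 \<bullet> 0 \<le> r0\<^sup>2" by simp
  from \<delta>_ge[OF v this] have \<delta>0: "0 \<le> \<delta> m P Y \<Upsilon>0 k r0" for k
    by (meson abs_ge_zero ereal_less_eq(5) order_trans)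
  have fin: "\<delta> m P Y \<Upsilon>0 3 r0 \<noteq> \<infinity>" "\<delta> m P Y \<Upsilon>0 4 r0 \<noteq> \<infinity>"
    using A(29) \<delta>0[of 3] \<delta>0[of 4] unfolding diamond_def
    by (cases "\<delta> m P Y \<Upsilon>0 3 r0"; cases "\<delta> m P Y \<Upsilon>0 4 r0"; simp add: power2_eq_square)+
  obtain d3 where d3: "\<delta> m P Y \<Upsilon>0 3 r0 = ereal d3" "0 \<le> d3"
    using fin(1) \<delta>0[of 3] by (cases "\<delta> m P Y \<Upsilon>0 3 r0") auto
  obtain d4 where d4: "\<delta> m P Y \<Upsilon>0 4 r0 = ereal d4" "0 \<le> d4"
    using fin(2) \<delta>0[of 4] by (cases "\<delta> m P Y \<Upsilon>0 4 r0") auto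
  have dia: "diamond m P Y \<Upsilon>0 r0 = ereal (4 * d3\<^sup>2 + 4 * d4)"
    by (simp add: diamond_def d3 d4 power2_eq_square)
  have rx: "2 * sqrt (eff_dim m P Y ?v) + sqrt (2 * ln n) \<le> r0"
  proof -
    have "ereal (2 * sqrt (eff_dim m P Y ?v) + sqrt x) \<le> C0 m P Y \<Upsilon>0 r0 * ereal r0" using A(31)[OF v] .
    also have "C0 m P Y \<Upsilon>0 r0 = ereal (1 - 3 / r0\<^sup>2 * d3)" by (simp add: C0_def d3 one_ereal_def)
    finally have "2 * sqrt (eff_dim m P Y ?v) + sqrt x \<le> (1 - 3 / r0\<^sup>2 * d3) * r0" by simp
    also have "\<dots> \<le> 1 * r0" using A(27) d3(2) by (intro mult_right_mono) auto
    finally show ?thesis using A(17) by simp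
  qed
  have b3: "\<bar>dir_deriv 3 u (Phi m) \<upsilon>\<bar> \<le> d3" and b4: "\<bar>dir_deriv 4 u (Phi m) \<upsilon>\<bar> \<le> d4"
    if "\<upsilon> \<in> \<Upsilon>0" "info m P Y \<upsilon> u \<bullet> u \<le> r0\<^sup>2" for \<upsilon> u
    using \<delta>_ge[OF that, of 3] \<delta>_ge[OF that, of 4] by (simp_all add: d3 d4)
  interpret E: local_expansion m P Y ?y ?v \<Upsilon>0 r0 d3 d4
    by unfold_locales (fact mx psd sub A(26) A(27) b3 b4 d3(2) d4(2))+
  have general: "gauss_error m P Y ?y ?v B \<le> 10 ^ 6 * (d3 + 1 / n)" if "B \<in> sets borel" for B
    by (rule E.gauss_error_rates(1)[OF A(16) rx that])
  have symmetric: "gauss_error m P Y ?y ?v B \<le> 10 ^ 6 * (4 * d3\<^sup>2 + 4 * d4 + 1 / n)"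
    if "B \<in> sets borel" "uminus ` B = B" for B
    by (rule E.gauss_error_rates(2)[OF A(16) rx that])
  show "(SUP B\<in>symmetric_borel. ereal (gauss_error m P Y (Y \<omega>) (\<upsilon>t \<omega>) B))
        \<le> ereal abs_const * (diamond m P Y \<Upsilon>0 r0 + ereal (1 / n)) \<and>
      (SUP B\<in>sets borel. ereal (gauss_error m P Y (Y \<omega>) (\<upsilon>t \<omega>) B))
        \<le> ereal abs_const * (\<delta> m P Y \<Upsilon>0 3 r0 + ereal (1 / n))"
  proof (intro conjI SUP_least)
    fix B :: "'x set" assume "B \<in> symmetric_borel"
    then have "B \<in> sets borel" "uminus ` B = B" by (auto simp: symmetric_borel_def)
    then have "gauss_error m P Y ?y ?v B \<le> abs_const * (4 * d3\<^sup>2 + 4 * d4 + 1 / n)"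
      unfolding abs_const_def by (rule symmetric)
    then show "ereal (gauss_error m P Y (Y \<omega>) (\<upsilon>t \<omega>) B) \<le> ereal abs_const * (diamond m P Y \<Upsilon>0 r0 + ereal (1 / n))"
      by (simp add: dia)
  next
    fix B :: "'x set" assume "B \<in> sets borel"
    then have "gauss_error m P Y ?y ?v B \<le> abs_const * (d3 + 1 / n)"
      unfolding abs_const_def by (rule general)
    then show "ereal (gauss_error m P Y (Y \<omega>) (\<upsilon>t \<omega>) B) \<le> ereal abs_const * (\<delta> m P Y \<Upsilon>0 3 r0 + ereal (1 / n))"
      by (simp add: d3)
  qed
qed

end
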